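(* Let $0\le d\le n-1$ and let $X$ be the generic symmetric $n\times n$ matrix. For every $A$ in the interior of the hyperbolicity cone $C(P_{d+1},I)$ one has $P_{d+1}(A)>0$ and $P_d(A)>0$, and the polynomial $$D_AP_{d+1}(X)\cdot P_d(X)-P_{d+1}(X)\cdot D_AP_d(X)-\frac{P_{d+1}(A)}{P_d(A)}\cdot P_d(X)^2$$ is a sum of squares of polynomials in the entries of $X$.
   Context: The generic symmetric $n\times n$ matrix $X$ has as entries variables $x_{ij}$, $1\le i\le j\le n$ (with $x_{ji}=x_{ij}$). $P_d(X)=\sigma_{d,n}(\lambda(X))$, where $\sigma_{d,n}$ is the elementary symmetric polynomial of degree $d$ in $n$ variables and $\lambda(X)$ is the vector of eigenvalues; equivalently, $P_d(X)$ is the sum of all principal $d\times d$ minors of $X$ ($P_0=1$). It is a homogeneous polynomial of degree $d$ in the entries of $X$. For a real symmetric matrix $A$, $D_A P$ denotes the directional derivative of a polynomial function $P$ on the space of real symmetric $n\times n$ matrices in direction $A$. For a homogeneous polynomial $h$ on a real vector space $U$ that is hyperbolic with respect to $e\in U$ (that is, $h(e)>0$ and for all $a\in U$ the polynomial $h(te-a)\in\mathbb{R}[t]$ has only real roots), the hyperbolicity cone $C(h,e)$ is the set of $a\in U$ such that all zeros of $h(te-a)$ are nonnegative. $P_{d+1}$ is hyperbolic with respect to the identity matrix $I$ on the space of real symmetric $n\times n$ matrices. *)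

theory Defs
  imports "HOL-Analysis.Analysis"
begin

definition sym_mats :: "(real^'n^'n) set" where
  "sym_mats = {X. transpose X = X}"

text \<open>The vector of eigenvalues, repeated according to multiplicity, in an unspecified order.
  For a symmetric matrix the characteristic polynomial splits over the reals, so such a vector
  exists and is unique up to permutation; on other matrices the value may be arbitrary.\<close>

definition eigenvalue_vec :: "real^'n^'n \<Rightarrow> real^'n" where
  "eigenvalue_vec X = (SOME v. \<forall>t. det (mat t - X) = (\<Prod>i\<in>UNIV. t - v $ i))"

definition elem_sym :: "nat \<Rightarrow> real^'n \<Rightarrow> real" where
  "elem_sym d v = (\<Sum>S | S \<subseteq> UNIV \<and> card S = d. \<Prod>i\<in>S. v $ i)"

text \<open>The invariant polynomial of degree d in the entries of a symmetric matrix, as a polynomial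
  function; it is only meaningful on \<^const>\<open>sym_mats\<close>.\<close>

definition Ppoly :: "nat \<Rightarrow> real^'n^'n \<Rightarrow> real" where
  "Ppoly d X = elem_sym d (eigenvalue_vec X)"

definition dir_deriv :: "'a::real_normed_vector \<Rightarrow> ('a \<Rightarrow> real) \<Rightarrow> 'a \<Rightarrow> real" where
  "dir_deriv A f X = deriv (\<lambda>t. f (X + t *\<^sub>R A)) 0"

text \<open>The hyperbolicity cone of h with respect to e in the space U. It is used for h hyperbolic
  with respect to e, so that all complex zeros of h (t e - a) are real and quantifying over real
  zeros loses nothing.\<close>

definition hyp_cone :: "'a::real_vector set \<Rightarrow> ('a \<Rightarrow> real) \<Rightarrow> 'a \<Rightarrow> 'a set" where
  "hyp_cone U h e = {a \<in> U. \<forall>t. h (t *\<^sub>R e - a) = 0 \<longrightarrow> 0 \<le> t}"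

text \<open>Over the reals, polynomials on U are identified with polynomial functions on U, and these are
  the restrictions of polynomial functions on the ambient space.\<close>

definition sum_of_squares_on :: "'a::real_normed_vector set \<Rightarrow> ('a \<Rightarrow> real) \<Rightarrow> bool" where
  "sum_of_squares_on U f \<longleftrightarrow>
     (\<exists>(k::nat) q. (\<forall>i<k. real_polynomial_function (q i)) \<and>
       (\<forall>X\<in>U. f X = (\<Sum>i<k. (q i X)\<^sup>2)))"

end

theory Submission
  imports Defs
begin

text \<open>
  For diagonal matrices the quotient \<open>e\<^sub>d\<^sub>+\<^sub>1 / e\<^sub>d\<close> is an effective conductance: with
  \<open>h\<^sub>i\<close> the quotient \<open>e\<^sub>d / e\<^sub>d\<^sub>-\<^sub>1\<close> in the variables other than \<open>x\<^sub>i\<close>, it equals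
  \<open>1 / (d + 1)\<close> times the sum of the parallel sums of \<open>x\<^sub>i\<close> and \<open>h\<^sub>i\<close>. Hence the Wronskian of
  \<open>e\<^sub>d\<^sub>+\<^sub>1\<close> and \<open>e\<^sub>d\<close> in direction \<open>a\<close> is the energy, for the conductances \<open>a\<^sub>i\<close>, of a network on
  the subsets \<open>S\<close> of the index set whose potential at \<open>S\<close> is the part of \<open>e\<^sub>d(x)\<close> divisible by
  \<open>\<Prod>\<^sub>i\<^sub>\<in>\<^sub>S x\<^sub>i\<close>. Eliminating the vertices from the leaves up completes squares and leaves
  \<open>e\<^sub>d\<^sub>+\<^sub>1(a) / e\<^sub>d(a)\<close> times the square of the potential \<open>e\<^sub>d(x)\<close> at the empty set.

  For a symmetric matrix \<open>X\<close> the potentials become the partial traces of its \<open>d\<close>-th exterior power,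
  and the energy becomes a quadratic form that is invariant under the orthogonal group acting on
  \<open>X\<close> and \<open>A\<close> simultaneously. Diagonalizing \<open>X\<close> identifies this form with the Wronskian;
  diagonalizing \<open>A\<close> instead splits it into blocks indexed by pairs \<open>(E, E')\<close> of disjoint sets of
  row and column indices, and each block is, up to a positive factor, the diagonal energy of a
  potential that is antisymmetric under swapping the elements of \<open>E\<close> with those of \<open>E'\<close>.\<close>

section \<open>Elementary symmetric polynomials and their cones\<close>

text \<open>The eigenvalues of \<open>X\<close> are not polynomials in its entries, so squares found
  in an eigenbasis of \<open>X\<close> would not be squares of polynomials. Hence \<open>X\<close>
  is diagonalized only pointwise, to identify two numbers, while the squares are read off in an
  eigenbasis of the fixed matrix \<open>A\<close>, where every potential is a polynomial in the
  entries of \<open>X\<close>. This is why an expression with a meaning in both bases is needed. The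
  other obstacle is that \<open>A\<close> need not be positive semidefinite. Single conductances
  \<open>a i\<close> may be negative, so an energy is not visibly nonnegative. Positive are only the
  quantities met during elimination, which are quotients of elementary symmetric polynomials at
  points of the cone; for this the cone must pass to subsets of the indices. For the same reason a
  block with nonempty \<open>E\<close> is not estimated edge by edge but embedded, by its
  antisymmetry, into the energy of the full index set.\<close>

definition esym :: "'a set \<Rightarrow> nat \<Rightarrow> ('a \<Rightarrow> real) \<Rightarrow> real" where
  "esym N m x = (\<Sum>S | S \<subseteq> N \<and> card S = m. \<Prod>i\<in>S. x i)"

definition desym :: "'a set \<Rightarrow> nat \<Rightarrow> ('a \<Rightarrow> real) \<Rightarrow> ('a \<Rightarrow> real) \<Rightarrow> real" where
  "desym N m a x = (if m = 0 then 0 else \<Sum>i\<in>N. a i * esym (N - {i}) (m - 1) x)"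

definition wronskian :: "'a set \<Rightarrow> nat \<Rightarrow> ('a \<Rightarrow> real) \<Rightarrow> ('a \<Rightarrow> real) \<Rightarrow> real" where
  "wronskian N d a x = desym N (Suc d) a x * esym N d x - esym N (Suc d) x * desym N d a x"

text \<open>Double counting of the pairs \<open>i \<in> S\<close>, with either component summed
  outermost. The recursions that delete a variable rest on it.\<close>

lemma sum_remove_subsets:
  fixes F :: "'a \<Rightarrow> 'a set \<Rightarrow> real"
  assumes "finite N"
  shows "(\<Sum>i\<in>N. \<Sum>S\<in>Pow (N - {i}). F i (insert i S)) = (\<Sum>S\<in>Pow N. \<Sum>i\<in>S. F i S)"
proof -
  have fin: "finite S" if "S \<in> Pow N" for S using assms that finite_subset by auto
  have "(\<Sum>i\<in>N. \<Sum>S\<in>Pow (N - {i}). F i (insert i S))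
      = (\<Sum>(i,S)\<in>(SIGMA i:N. Pow (N - {i})). F i (insert i S))"
    by (rule sum.Sigma) (use assms in auto)
  also have "\<dots> = (\<Sum>(S,i)\<in>(SIGMA S:Pow N. S). F i S)"
    by (rule sum.reindex_bij_witness[of _ "\<lambda>(S,i). (i, S - {i})" "\<lambda>(i,S). (insert i S, i)"]) auto
  also have "\<dots> = (\<Sum>S\<in>Pow N. \<Sum>i\<in>S. F i S)"
    by (rule sum.Sigma[symmetric]) (use assms fin in auto)
  finally show ?thesis .
qed

lemma sum_remove_subsets':
  fixes F :: "'a \<Rightarrow> 'a set \<Rightarrow> real"
  assumes "finite N"
  shows "(\<Sum>i\<in>N. \<Sum>S\<in>Pow (N - {i}). F i S) = (\<Sum>S\<in>Pow N. \<Sum>i\<in>N - S. F i S)"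
proof -
  have "(\<Sum>i\<in>N. \<Sum>S\<in>Pow (N - {i}). F i S) = (\<Sum>(i,S)\<in>(SIGMA i:N. Pow (N - {i})). F i S)"
    by (rule sum.Sigma) (use assms in auto)
  also have "\<dots> = (\<Sum>(S,i)\<in>(SIGMA S:Pow N. N - S). F i S)"
    by (rule sum.reindex_bij_witness[of _ "\<lambda>(S,i). (i, S)" "\<lambda>(i,S). (S, i)"]) auto
  also have "\<dots> = (\<Sum>S\<in>Pow N. \<Sum>i\<in>N - S. F i S)"
    by (rule sum.Sigma[symmetric]) (use assms in auto)
  finally show ?thesis .
qed

lemma esym_Pow: "finite N \<Longrightarrow> esym N m x = (\<Sum>S\<in>Pow N. if card S = m then \<Prod>i\<in>S. x i else 0)"
proof -
  assume "finite N"
  moreover have "{S. S \<subseteq> N \<and> card S = m} = {S \<in> Pow N. card S = m}" by auto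
  ultimately show ?thesis
    unfolding esym_def by (simp only: sum.inter_filter finite_Pow_iff)
qed

lemma esym_0 [simp]: "finite N \<Longrightarrow> esym N 0 x = 1"
proof -
  assume "finite N"
  then have "{S. S \<subseteq> N \<and> card S = 0} = {{}}" by (auto simp: card_eq_0_iff dest: finite_subset)
  then show ?thesis by (simp add: esym_def)
qed

lemma esym_eq_0: "finite N \<Longrightarrow> card N < m \<Longrightarrow> esym N m x = 0"
proof -
  assume a: "finite N" "card N < m"
  then have "{S. S \<subseteq> N \<and> card S = m} = {}" by (auto dest: card_mono)
  then show ?thesis unfolding esym_def by (simp only: sum.empty)
qed

lemma esym_cong: "(\<And>i. i \<in> N \<Longrightarrow> x i = y i) \<Longrightarrow> esym N m x = esym N m y"
  unfolding esym_def by (intro sum.cong prod.cong) auto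

lemma esym_Suc_remove:
  assumes "finite N" "i \<in> N"
  shows "esym N (Suc m) x = x i * esym (N - {i}) m x + esym (N - {i}) (Suc m) x"
proof -
  have "{S. S \<subseteq> N \<and> card S = Suc m} =
      insert i ` {S. S \<subseteq> N - {i} \<and> card S = m} \<union> {S. S \<subseteq> N - {i} \<and> card S = Suc m}" (is "?L = ?A \<union> ?B")
  proof (intro set_eqI iffI)
    fix S assume S: "S \<in> ?L"
    then have "finite S" using assms finite_subset by auto
    show "S \<in> ?A \<union> ?B"
    proof (cases "i \<in> S")
      case True
      then have "S = insert i (S - {i})" "S - {i} \<subseteq> N - {i}" "card (S - {i}) = m" using S by auto
      then show ?thesis by blast
    qed (use S in auto)
  next
    fix S assume "S \<in> ?A \<union> ?B"
    moreover have "card (insert i T) = Suc (card T)" if "T \<subseteq> N - {i}" for T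
      using that assms by (subst card_insert_disjoint) (auto intro: finite_subset[of _ N])
    ultimately show "S \<in> ?L" using assms by auto
  qed
  moreover have "inj_on (insert i) {S. S \<subseteq> N - {i} \<and> card S = m}"
    by (intro inj_onI) (metis (no_types, lifting) Diff_insert_absorb mem_Collect_eq subset_Diff_insert)
  moreover have "(\<Prod>j\<in>insert i S. x j) = x i * (\<Prod>j\<in>S. x j)" if "S \<subseteq> N - {i}" for S
    using that assms by (subst prod.insert) (auto intro: finite_subset[of _ N])
  moreover have "sum f (?A \<union> ?B) = sum f ?A + sum f ?B" for f :: "'a set \<Rightarrow> real"
    by (rule sum.union_disjoint) (use assms in auto)
  ultimately show ?thesis
    unfolding esym_def by (simp add: sum.reindex sum_distrib_left)
qed

text \<open>Euler's identity, because \<open>esym (N - {i}) m\<close> is the partial derivative of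
  \<open>esym N (Suc m)\<close> in \<open>x i\<close>. It is the source of the numerical factor in
  the recursions below.\<close>

lemma sum_esym_remove:
  assumes "finite N"
  shows "(\<Sum>i\<in>N. x i * esym (N - {i}) m x) = real (Suc m) * esym N (Suc m) x"
proof -
  have *: "x i * (if card S = m then \<Prod>j\<in>S. x j else 0) =
     (if card (insert i S) = Suc m then \<Prod>j\<in>insert i S. x j else 0)" if "S \<in> Pow (N - {i})" for S i
  proof -
    have "finite S" "i \<notin> S" using that assms by (auto intro: finite_subset[of _ N])
    then show ?thesis by simp
  qed
  have "(\<Sum>i\<in>N. x i * esym (N - {i}) m x) =
     (\<Sum>i\<in>N. \<Sum>S\<in>Pow (N - {i}). if card (insert i S) = Suc m then \<Prod>j\<in>insert i S. x j else 0)"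
    using assms by (simp only: esym_Pow finite_Diff sum_distrib_left *  cong: sum.cong)
  also have "\<dots> = (\<Sum>S\<in>Pow N. \<Sum>i\<in>S. if card S = Suc m then \<Prod>j\<in>S. x j else 0)"
    by (rule sum_remove_subsets[OF assms])
  also have "\<dots> = (\<Sum>S\<in>Pow N. real (Suc m) * (if card S = Suc m then \<Prod>j\<in>S. x j else 0))"
    by (intro sum.cong) auto
  finally show ?thesis using assms by (simp add: esym_Pow sum_distrib_left)
qed

lemma sum_esym_remove':
  assumes "finite N"
  shows "(\<Sum>i\<in>N. esym (N - {i}) m x) = (real (card N) - real m) * esym N m x"
proof -
  have "(\<Sum>i\<in>N. esym (N - {i}) m x) =
     (\<Sum>i\<in>N. \<Sum>S\<in>Pow (N - {i}). if card S = m then \<Prod>j\<in>S. x j else 0)"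
    using assms by (simp add: esym_Pow)
  also have "\<dots> = (\<Sum>S\<in>Pow N. \<Sum>i\<in>N - S. if card S = m then \<Prod>j\<in>S. x j else 0)"
    by (rule sum_remove_subsets'[OF assms])
  also have "\<dots> = (\<Sum>S\<in>Pow N. (real (card N) - real m) * (if card S = m then \<Prod>j\<in>S. x j else 0))"
  proof (intro sum.cong refl)
    fix S assume "S \<in> Pow N"
    then have "finite S" "card (N - S) = card N - card S" "card S \<le> card N"
      using assms by (auto intro: finite_subset card_Diff_subset card_mono)
    then show "(\<Sum>i\<in>N - S. if card S = m then \<Prod>j\<in>S. x j else 0) =
       (real (card N) - real m) * (if card S = m then \<Prod>j\<in>S. x j else 0)" by (auto simp: of_nat_diff)
  qed
  finally show ?thesis using assms by (simp add: esym_Pow sum_distrib_left)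
qed

section \<open>Directional derivatives of elementary symmetric polynomials\<close>

lemma desym_Suc:
  assumes "finite N"
  shows "real (Suc m) * desym N (Suc m) a x = (\<Sum>i\<in>N. a i * esym (N - {i}) m x + x i * desym (N - {i}) m a x)"
proof (cases m)
  case 0
  then show ?thesis by (simp add: desym_def)
next
  case (Suc k)
  have "(\<Sum>i\<in>N. x i * desym (N - {i}) m a x) =
     (\<Sum>i\<in>N. \<Sum>j\<in>N. if j \<noteq> i then x i * (a j * esym (N - {i} - {j}) k x) else 0)"
    using Suc assms by (auto simp: desym_def sum_distrib_left sum.If_cases intro!: sum.cong)
  also have "\<dots> = (\<Sum>j\<in>N. \<Sum>i\<in>N. if i \<noteq> j then a j * (x i * esym (N - {j} - {i}) k x) else 0)"
    by (subst sum.swap) (auto intro!: sum.cong simp: insert_commute Diff_insert2[symmetric])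
  also have "\<dots> = (\<Sum>j\<in>N. a j * (\<Sum>i\<in>N - {j}. x i * esym (N - {j} - {i}) k x))"
    using assms by (auto simp: sum_distrib_left sum.If_cases intro!: sum.cong)
  also have "\<dots> = real m * (\<Sum>j\<in>N. a j * esym (N - {j}) m x)"
    using assms Suc by (simp add: sum_esym_remove sum_distrib_left mult_ac del: of_nat_Suc)
  finally show ?thesis by (simp add: desym_def sum.distrib algebra_simps)
qed

text \<open>The induction differentiates Euler's identity \<open>sum_esym_remove\<close>. Its formal
  counterpart \<open>desym_Suc\<close> therefore has to be obtained beforehand, by counting.\<close>

lemma desym_deriv:
  assumes "finite N"
  shows "((\<lambda>t. esym N m (\<lambda>i. x i + t * a i)) has_real_derivative desym N m a x) (at 0)"
  using assms
proof (induction m arbitrary: N)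
  case 0
  then show ?case by (simp add: desym_def)
next
  case (Suc m)
  have eq: "esym N (Suc m) (\<lambda>i. x i + t * a i) =
      (\<Sum>i\<in>N. (x i + t * a i) * esym (N - {i}) m (\<lambda>i. x i + t * a i)) / real (Suc m)" for t
    using sum_esym_remove[OF Suc.prems, of "\<lambda>i. x i + t * a i" m] by simp
  have 1: "((\<lambda>t. (x i + t * a i) * esym (N - {i}) m (\<lambda>i. x i + t * a i)) has_real_derivative
     a i * esym (N - {i}) m x + x i * desym (N - {i}) m a x) (at 0)" for i
    by (rule derivative_eq_intros Suc.IH refl | use Suc.prems in simp)+
  have "((\<lambda>t. esym N (Suc m) (\<lambda>i. x i + t * a i)) has_real_derivative
     (\<Sum>i\<in>N. a i * esym (N - {i}) m x + x i * desym (N - {i}) m a x) / real (Suc m)) (at 0)"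
    unfolding eq by (intro DERIV_cdivide DERIV_sum 1)
  then show ?case unfolding desym_Suc[OF Suc.prems, symmetric] by (simp del: of_nat_Suc)
qed

lemma desym_Suc_remove:
  assumes "finite N" "i \<in> N"
  shows "desym N (Suc m) a x =
    a i * esym (N - {i}) m x + x i * desym (N - {i}) m a x + desym (N - {i}) (Suc m) a x"
proof -
  have "((\<lambda>t. esym N (Suc m) (\<lambda>i. x i + t * a i)) has_real_derivative
     a i * esym (N - {i}) m x + x i * desym (N - {i}) m a x + desym (N - {i}) (Suc m) a x) (at 0)"
    unfolding esym_Suc_remove[OF assms]
    by (rule derivative_eq_intros desym_deriv refl | use assms in simp)+
  then show ?thesis using DERIV_unique desym_deriv[OF assms(1)] by blast
qed

section \<open>Wronskians and Newton-type inequalities\<close>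

lemma wronskian_0: "finite N \<Longrightarrow> wronskian N 0 a x = (\<Sum>i\<in>N. a i)"
  by (simp add: wronskian_def desym_def)

text \<open>Euler's identity turns the terms of degree \<open>Suc (Suc d)\<close> and their
  derivative into sums over \<open>i\<close>. Splitting \<open>x i\<close> off the remaining factors
  makes the mixed terms cancel. Up to the factor \<open>(esym N (Suc d) x)\<^sup>2\<close> this is
  the derivative of a sum of parallel sums.\<close>

lemma wronskian_Suc:
  assumes "finite N"
  shows "real (Suc (Suc d)) * wronskian N (Suc d) a x =
    (\<Sum>i\<in>N. (x i)\<^sup>2 * wronskian (N - {i}) d a x + a i * (esym (N - {i}) (Suc d) x)\<^sup>2)"
proof -
  let ?g = "\<lambda>i. esym (N - {i}) (Suc d) x" and ?g' = "\<lambda>i. desym (N - {i}) (Suc d) a x"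
  have "real (Suc (Suc d)) * wronskian N (Suc d) a x =
     (real (Suc (Suc d)) * desym N (Suc (Suc d)) a x) * esym N (Suc d) x
     - (real (Suc (Suc d)) * esym N (Suc (Suc d)) x) * desym N (Suc d) a x"
    unfolding wronskian_def by (simp only: right_diff_distrib mult.assoc)
  also have "\<dots> = (\<Sum>i\<in>N. (a i * ?g i + x i * ?g' i) * esym N (Suc d) x - x i * ?g i * desym N (Suc d) a x)"
    unfolding desym_Suc[OF assms] sum_esym_remove[OF assms, symmetric]
    by (simp only: sum_subtractf sum_distrib_right)
  also have "\<dots> = (\<Sum>i\<in>N. (x i)\<^sup>2 * wronskian (N - {i}) d a x + a i * (?g i)\<^sup>2)"
  proof (intro sum.cong refl)
    fix i assume i: "i \<in> N"
    show "(a i * ?g i + x i * ?g' i) * esym N (Suc d) x - x i * ?g i * desym N (Suc d) a x =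
      (x i)\<^sup>2 * wronskian (N - {i}) d a x + a i * (?g i)\<^sup>2"
      unfolding esym_Suc_remove[OF assms i, of d] desym_Suc_remove[OF assms i, of d] wronskian_def
      by (simp add: algebra_simps power2_eq_square)
  qed
  finally show ?thesis .
qed

lemma wronskian_one_nonneg: "finite N \<Longrightarrow> wronskian N d (\<lambda>_. 1) x \<ge> 0"
proof (induction d arbitrary: N)
  case 0
  then show ?case by (simp add: wronskian_0)
next
  case (Suc d)
  have "(\<Sum>i\<in>N. (x i)\<^sup>2 * wronskian (N - {i}) d (\<lambda>_. 1) x + 1 * (esym (N - {i}) (Suc d) x)\<^sup>2) \<ge> 0"
    by (intro sum_nonneg add_nonneg_nonneg mult_nonneg_nonneg Suc.IH) (use Suc.prems in simp_all)
  then have "real (Suc (Suc d)) * wronskian N (Suc d) (\<lambda>_. 1) x \<ge> 0"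
    by (simp only: wronskian_Suc[OF Suc.prems])
  then show ?case by (simp add: zero_le_mult_iff del: of_nat_Suc)
qed

text \<open>The strict form of Newton's inequality, in place of real-rootedness, is what makes
  \<open>esym_cone\<close> below stable under deleting a variable.\<close>

lemma wronskian_one_pos:
  assumes "finite N" "esym N (Suc d) x \<noteq> 0"
  shows "wronskian N d (\<lambda>_. 1) x > 0"
proof (cases d)
  case 0
  have "N \<noteq> {}" using assms esym_eq_0[of "{}" "Suc d"] by auto
  then show ?thesis using 0 assms by (simp add: wronskian_0 card_gt_0_iff)
next
  case (Suc k)
  have "(\<Sum>i\<in>N. x i * esym (N - {i}) d x) \<noteq> 0"
    using assms by (subst sum_esym_remove) (auto simp del: of_nat_Suc)
  then obtain i where i: "i \<in> N" "esym (N - {i}) d x \<noteq> 0"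
    by (auto elim: sum.not_neutral_contains_not_neutral)
  have "0 < (\<Sum>i\<in>N. (x i)\<^sup>2 * wronskian (N - {i}) k (\<lambda>_. 1) x + 1 * (esym (N - {i}) (Suc k) x)\<^sup>2)"
  proof (rule sum_pos2[OF assms(1) i(1)])
    show "0 < (x i)\<^sup>2 * wronskian (N - {i}) k (\<lambda>_. 1) x + 1 * (esym (N - {i}) (Suc k) x)\<^sup>2"
      using i(2) Suc assms(1) by (intro add_nonneg_pos mult_nonneg_nonneg wronskian_one_nonneg) simp_all
    show "0 \<le> (x j)\<^sup>2 * wronskian (N - {j}) k (\<lambda>_. 1) x + 1 * (esym (N - {j}) (Suc k) x)\<^sup>2" for j
      using assms(1) by (intro add_nonneg_nonneg mult_nonneg_nonneg wronskian_one_nonneg) simp_all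
  qed
  then have "0 < real (Suc (Suc k)) * wronskian N (Suc k) (\<lambda>_. 1) x"
    by (simp only: wronskian_Suc[OF assms(1)])
  then show ?thesis using Suc by (simp add: zero_less_mult_iff del: of_nat_Suc)
qed

text \<open>An eigenvalue form of the interior of the hyperbolicity cone, phrased by positivity on
  the ray in the all-ones direction, so that sign arguments along the ray replace the counting of
  real roots.\<close>

definition esym_cone :: "'a set \<Rightarrow> nat \<Rightarrow> ('a \<Rightarrow> real) \<Rightarrow> bool" where
  "esym_cone N m a \<longleftrightarrow> (\<forall>s\<ge>0. esym N m (\<lambda>i. a i + s) > 0)"

lemma esym_shift_deriv:
  assumes "finite N"
  shows "((\<lambda>s. esym N m (\<lambda>i. a i + s)) has_real_derivative desym N m (\<lambda>_. 1) (\<lambda>i. a i + s0)) (at s0)"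
proof -
  have "((\<lambda>t. esym N m (\<lambda>i. (a i + s0) + t * 1)) has_real_derivative desym N m (\<lambda>_. 1) (\<lambda>i. a i + s0)) (at 0)"
    by (rule desym_deriv[OF assms])
  moreover have "(\<lambda>t. esym N m (\<lambda>i. (a i + s0) + t * 1)) = (\<lambda>t. esym N m (\<lambda>i. a i + (t + s0)))"
    by (simp add: algebra_simps)
  ultimately show ?thesis
    using DERIV_shift[of "\<lambda>s. esym N m (\<lambda>i. a i + s)" _ 0 s0] by simp
qed

lemma esym_shift_continuous: "finite N \<Longrightarrow> continuous_on A (\<lambda>s. esym N m (\<lambda>i. a i + s))"
  using esym_shift_deriv by (metis DERIV_continuous_on DERIV_subset top_greatest)

lemma esym_shift_eventually_pos:
  assumes "finite N" "m \<le> card N"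
  obtains s1 where "s1 \<ge> 0" "\<And>s. s > s1 \<Longrightarrow> esym N m (\<lambda>i. a i + s) > 0"
proof
  show "0 \<le> (\<Sum>i\<in>N. \<bar>a i\<bar>)" by (simp add: sum_nonneg)
  fix s assume s: "s > (\<Sum>i\<in>N. \<bar>a i\<bar>)"
  have pos: "a i + s > 0" if "i \<in> N" for i
    using member_le_sum[OF that, of "\<lambda>i. \<bar>a i\<bar>"] s assms by simp
  obtain T where T: "T \<subseteq> N" "card T = m" using assms obtain_subset_with_card_n by metis
  have "finite {S. S \<subseteq> N \<and> card S = m}" using assms by (auto intro: finite_subset[of _ "Pow N"])
  moreover have "(\<Prod>i\<in>S. a i + s) > 0" if "S \<subseteq> N" for S using that pos by (intro prod_pos) auto
  ultimately show "esym N m (\<lambda>i. a i + s) > 0"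
    unfolding esym_def by (intro sum_pos) (use T in auto)
qed

text \<open>At the last parameter \<open>s0\<close> where \<open>esym (N - {i}) m\<close> fails to
  be positive, it vanishes and its derivative is nonnegative. There \<open>esym N (Suc m)\<close>
  reduces to \<open>esym (N - {i}) (Suc m)\<close>, which is thus positive, and the Wronskian is
  minus its product with that derivative, contrary to \<open>wronskian_one_pos\<close>.\<close>

lemma esym_cone_remove:
  assumes "finite N" "i \<in> N" "esym_cone N (Suc m) a"
  shows "esym_cone (N - {i}) m a"
proof (rule ccontr)
  assume neg: "\<not> esym_cone (N - {i}) m a"
  define M where "M = N - {i}"
  have finM: "finite M" using assms M_def by simp
  obtain k where m: "m = Suc k" using neg finM by (cases m) (auto simp: esym_cone_def M_def)
  have "card N \<ge> Suc m"
    using assms esym_eq_0[of N "Suc m"] unfolding esym_cone_def by (metis not_less order_refl order_less_irrefl)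
  then have cM: "card M \<ge> m" using assms by (simp add: M_def)
  define g where "g = (\<lambda>s. esym M m (\<lambda>i. a i + s))"
  obtain s1 where s1: "\<And>s. s > s1 \<Longrightarrow> g s > 0"
    using esym_shift_eventually_pos[OF finM cM, of a] unfolding g_def by metis
  define Z where "Z = {s \<in> {0..s1}. g s \<le> 0}"
  have cont: "continuous_on UNIV g" unfolding g_def by (rule esym_shift_continuous[OF finM])
  have "Z \<noteq> {}" using neg s1 unfolding Z_def esym_cone_def g_def M_def
    by (smt (verit) atLeastAtMost_iff empty_iff mem_Collect_eq)
  moreover have "closed {s. g s \<le> 0}"
    by (intro closed_Collect_le cont continuous_on_const)
  moreover have "Z = {0..s1} \<inter> {s. g s \<le> 0}" by (auto simp: Z_def)
  ultimately have "compact Z" by (metis compact_Icc compact_Int_closed)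
  then obtain s0 where s0: "s0 \<in> Z" "\<And>s. s \<in> Z \<Longrightarrow> s \<le> s0"
    using compact_attains_sup[OF _ \<open>Z \<noteq> {}\<close>] by blast
  have gpos: "g s > 0" if "s > s0" for s
    using s0(2)[of s] s0(1) s1[of s] that unfolding Z_def by (force simp: not_le[symmetric])
  have "g s0 \<ge> 0"
  proof (rule tendsto_lowerbound)
    show "(g \<longlongrightarrow> g s0) (at_right s0)"
      using cont by (simp add: continuous_on_eq_continuous_at isCont_def filterlim_at_split)
    show "\<forall>\<^sub>F s in at_right s0. 0 \<le> g s"
      unfolding eventually_at_right_field using gpos by (metis gt_ex less_imp_le)
  qed simp
  then have g0: "g s0 = 0" using s0 Z_def by auto
  define b where "b = (\<lambda>i. a i + s0)"
  have der: "(g has_real_derivative desym M m (\<lambda>_. 1) b) (at s0)"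
    unfolding g_def b_def by (rule esym_shift_deriv[OF finM])
  have d0: "desym M m (\<lambda>_. 1) b \<ge> 0"
  proof (rule ccontr)
    assume "\<not> ?thesis"
    then obtain e where "e > 0" "\<forall>h>0. h < e \<longrightarrow> g (s0 + h) < g s0"
      using DERIV_neg_dec_right[OF der] by auto
    then show False using gpos[of "s0 + e/2"] g0 by (metis add.commute field_sum_of_halves less_add_same_cancel2 less_asym half_gt_zero)
  qed
  have e0: "esym M m b = 0" using g0 by (simp add: g_def b_def)
  have "esym N (Suc m) b > 0" using assms s0 by (auto simp: esym_cone_def b_def Z_def)
  then have e1: "esym M (Suc m) b > 0" using esym_Suc_remove[OF assms(1,2), of m b] e0 by (simp add: M_def)
  then have "wronskian M m (\<lambda>_. 1) b > 0" using wronskian_one_pos[OF finM] by simp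
  then show False using e0 e1 d0 by (auto simp: wronskian_def zero_less_mult_iff mult_less_0_iff)
qed

text \<open>By \<open>sum_esym_remove'\<close> a positive multiple of \<open>esym N m\<close> is the
  sum of its deletions, each positive by \<open>esym_cone_remove\<close>. The multiple is positive
  because \<open>esym N (Suc m)\<close> would vanish for smaller \<open>N\<close>.\<close>

lemma esym_cone_pred:
  assumes "finite N" "esym_cone N (Suc m) a"
  shows "esym_cone N m a"
  unfolding esym_cone_def
proof (intro allI impI)
  fix s :: real assume s: "s \<ge> 0"
  have "card N \<ge> Suc m"
    using assms esym_eq_0[of N "Suc m"] unfolding esym_cone_def by (metis not_less order_refl order_less_irrefl)
  moreover have "(\<Sum>i\<in>N. esym (N - {i}) m (\<lambda>i. a i + s)) > 0"
    using esym_cone_remove[OF assms(1) _ assms(2)] s assms(1) \<open>card N \<ge> Suc m\<close>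
    by (intro sum_pos) (auto simp: esym_cone_def)
  ultimately show "esym N m (\<lambda>i. a i + s) > 0"
    using assms by (simp add: sum_esym_remove' zero_less_mult_iff)
qed

lemma esym_cone_pos: "esym_cone N m a \<Longrightarrow> esym N m a > 0"
  unfolding esym_cone_def by (metis (no_types, lifting) add.right_neutral esym_cong order_refl)

section \<open>Energies on the lattice of subsets\<close>

lemma sos_cong: "(\<And>X. X \<in> U \<Longrightarrow> f X = g X) \<Longrightarrow> sum_of_squares_on U g \<Longrightarrow> sum_of_squares_on U f"
  unfolding sum_of_squares_on_def by metis

lemma sos_add:
  assumes "sum_of_squares_on U f" "sum_of_squares_on U g"
  shows "sum_of_squares_on U (\<lambda>X. f X + g X)"
proof -
  obtain k p where p: "\<forall>i<k. real_polynomial_function (p i)" "\<forall>X\<in>U. f X = (\<Sum>i<(k::nat). (p i X)\<^sup>2)"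
    using assms(1) unfolding sum_of_squares_on_def by blast
  obtain l q where q: "\<forall>i<l. real_polynomial_function (q i)" "\<forall>X\<in>U. g X = (\<Sum>i<(l::nat). (q i X)\<^sup>2)"
    using assms(2) unfolding sum_of_squares_on_def by blast
  let ?r = "\<lambda>i. if i < k then p i else q (i - k)"
  have "(\<Sum>i<k + l. (?r i X)\<^sup>2) = (\<Sum>i<k. (p i X)\<^sup>2) + (\<Sum>i<l. (q i X)\<^sup>2)" for X
  proof -
    have "(\<Sum>i<k + l. (?r i X)\<^sup>2) = (\<Sum>i<k. (?r i X)\<^sup>2) + (\<Sum>i=k..<k + l. (?r i X)\<^sup>2)"
      unfolding lessThan_atLeast0 by (rule sum.atLeastLessThan_concat[symmetric]) auto
    moreover have "(\<Sum>i=k..<k + l. (?r i X)\<^sup>2) = (\<Sum>i<l. (q i X)\<^sup>2)"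
      by (rule sum.reindex_bij_witness[of _ "\<lambda>i. i + k" "\<lambda>i. i - k"]) auto
    ultimately show ?thesis by simp
  qed
  moreover have "\<forall>i<k + l. real_polynomial_function (?r i)" using p q by auto
  ultimately show ?thesis
    unfolding sum_of_squares_on_def using p q by (intro exI[of _ "k + l"] exI[of _ ?r]) auto
qed

lemma sos_square: "real_polynomial_function q \<Longrightarrow> sum_of_squares_on U (\<lambda>X. (q X)\<^sup>2)"
  unfolding sum_of_squares_on_def by (intro exI[of _ 1] exI[of _ "\<lambda>_. q"]) auto

lemma sos_zero: "sum_of_squares_on U (\<lambda>X. 0)"
  unfolding sum_of_squares_on_def by (intro exI[of _ 0]) auto

lemma sos_sum: "(\<And>i. i \<in> I \<Longrightarrow> sum_of_squares_on U (f i)) \<Longrightarrow> sum_of_squares_on U (\<lambda>X. \<Sum>i\<in>I. f i X)"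
  by (induction I rule: infinite_finite_induct) (auto intro: sos_zero sos_add)

lemma sos_scale:
  assumes "c \<ge> 0" "sum_of_squares_on U f"
  shows "sum_of_squares_on U (\<lambda>X. c * f X)"
proof -
  obtain k p where p: "\<forall>i<k. real_polynomial_function (p i)" "\<forall>X\<in>U. f X = (\<Sum>i<(k::nat). (p i X)\<^sup>2)"
    using assms(2) unfolding sum_of_squares_on_def by blast
  have "\<forall>i<k. real_polynomial_function (\<lambda>X. sqrt c * p i X)" using p by auto
  moreover have "\<forall>X\<in>U. c * f X = (\<Sum>i<k. (sqrt c * p i X)\<^sup>2)"
    using p assms(1) by (simp add: power_mult_distrib sum_distrib_left)
  ultimately show ?thesis
    unfolding sum_of_squares_on_def by (intro exI[of _ k] exI[of _ "\<lambda>i X. sqrt c * p i X"]) auto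
qed

text \<open>Recursive parallel sums give a network on the tree of repetition-free sequences, with weight
  \<open>(d - k)! / (d + 1)!\<close> at depth \<open>k\<close>; the factor \<open>k!\<close> arises from merging the sequences that
  enumerate the same set.\<close>

definition coef :: "nat \<Rightarrow> nat \<Rightarrow> real" where
  "coef d k = (if k \<le> d then fact k * fact (d - k) / fact (Suc d) else 0)"

text \<open>The parameters \<open>m\<close> and \<open>s\<close> account for \<open>m\<close> pairs of indices that have already been split off,
  \<open>s\<close> being half the sum of their weights \<open>a\<close>; the network itself is the case \<open>m = 0\<close>, \<open>s = 0\<close>.\<close>

definition energy :: "nat \<Rightarrow> ('a \<Rightarrow> real) \<Rightarrow> 'a set \<Rightarrow> nat \<Rightarrow> real \<Rightarrow> ('a set \<Rightarrow> real) \<Rightarrow> real" where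
  "energy d a M m s w = (\<Sum>R\<in>Pow M.
     coef d (card R + m) * (\<Sum>i\<in>M - R. a i * (w R - w (insert i R))\<^sup>2)
     + s * (coef d (card R + m) + coef d (card R + m - 1)) * (w R)\<^sup>2)"

text \<open>A set of size \<open>k\<close> hangs below each of its \<open>k\<close> elements, at
  depth \<open>k - 1\<close> of the smaller network. At the root the truncated \<open>k - 1\<close>
  is multiplied by \<open>0\<close>.\<close>

lemma coef_Suc: "real (Suc (Suc d)) * coef (Suc d) k = (if k = 0 then 1 else 0) + real k * coef d (k - 1)"
proof (cases k)
  case 0
  then show ?thesis by (simp add: coef_def)
next
  case (Suc j)
  then show ?thesis by (simp add: coef_def divide_simps)
qed

lemma energy_cong:
  assumes "\<And>S. S \<subseteq> M \<Longrightarrow> w S = v S"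
  shows "energy d a M m s w = energy d a M m s v"
  unfolding energy_def
proof (intro sum.cong refl)
  fix R assume R: "R \<in> Pow M"
  have "(\<Sum>i\<in>M - R. a i * (w R - w (insert i R))\<^sup>2) = (\<Sum>i\<in>M - R. a i * (v R - v (insert i R))\<^sup>2)"
    using R assms by (intro sum.cong refl) auto
  then show "coef d (card R + m) * (\<Sum>i\<in>M - R. a i * (w R - w (insert i R))\<^sup>2)
     + s * (coef d (card R + m) + coef d (card R + m - 1)) * (w R)\<^sup>2
     = coef d (card R + m) * (\<Sum>i\<in>M - R. a i * (v R - v (insert i R))\<^sup>2)
     + s * (coef d (card R + m) + coef d (card R + m - 1)) * (v R)\<^sup>2" using R assms by simp
qed

lemma energy_scale: "energy d a M m s (\<lambda>S. c * w S) = c\<^sup>2 * energy d a M m s w"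
proof -
  have "a i * (c * w R - c * w (insert i R))\<^sup>2 = c\<^sup>2 * (a i * (w R - w (insert i R))\<^sup>2)" for i R
    by (simp add: power2_eq_square algebra_simps)
  then have "(\<Sum>i\<in>M - R. a i * (c * w R - c * w (insert i R))\<^sup>2) = c\<^sup>2 * (\<Sum>i\<in>M - R. a i * (w R - w (insert i R))\<^sup>2)" for R
    by (simp only: sum_distrib_left)
  then show ?thesis
    unfolding energy_def sum_distrib_left[of "c\<^sup>2" _ "Pow M"]
    by (intro sum.cong refl) (simp add: power_mult_distrib algebra_simps)
qed

lemma energy_0:
  assumes "finite N"
  shows "energy 0 a N 0 0 w = (\<Sum>i\<in>N. a i * (w {} - w {i})\<^sup>2)"
proof -
  have "energy 0 a N 0 0 w = (\<Sum>R\<in>Pow N. if R = {} then (\<Sum>i\<in>N - R. a i * (w R - w (insert i R))\<^sup>2) else 0)"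
    unfolding energy_def using assms
    by (intro sum.cong refl) (auto simp: coef_def card_eq_0_iff intro: finite_subset)
  also have "\<dots> = (\<Sum>i\<in>N. a i * (w {} - w {i})\<^sup>2)"
    using assms by (subst sum.delta) auto
  finally show ?thesis .
qed

text \<open>Below each \<open>{i}\<close> hangs a copy of the network on \<open>N - {i}\<close>. A
  set \<open>S\<close> lies in \<open>card S\<close> of these copies, which \<open>coef_Suc\<close>
  accounts for. The shape is that of \<open>wronskian_Suc\<close>.\<close>

lemma energy_Suc:
  assumes "finite N"
  shows "real (Suc (Suc d)) * energy (Suc d) a N 0 0 w =
     (\<Sum>i\<in>N. a i * (w {} - w {i})\<^sup>2 + energy d a (N - {i}) 0 0 (\<lambda>S. w (insert i S)))"
proof -
  define G where "G S = (\<Sum>j\<in>N - S. a j * (w S - w (insert j S))\<^sup>2)" for S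
  have "energy d a (N - {i}) 0 0 (\<lambda>S. w (insert i S)) =
      (\<Sum>S\<in>Pow (N - {i}). coef d (card (insert i S) - 1) * G (insert i S))" for i
    unfolding energy_def G_def
  proof (intro sum.cong refl)
    fix R assume "R \<in> Pow (N - {i})"
    then have "finite R" "i \<notin> R" "N - {i} - R = N - insert i R" using assms finite_subset by auto
    then show "coef d (card R + 0) * (\<Sum>j\<in>N - {i} - R. a j * (w (insert i R) - w (insert i (insert j R)))\<^sup>2) +
         0 * (coef d (card R + 0) + coef d (card R + 0 - 1)) * (w (insert i R))\<^sup>2 =
         coef d (card (insert i R) - 1) *
         (\<Sum>j\<in>N - insert i R. a j * (w (insert i R) - w (insert j (insert i R)))\<^sup>2)"
      by (simp add: insert_commute)
  qed
  then have "(\<Sum>i\<in>N. energy d a (N - {i}) 0 0 (\<lambda>S. w (insert i S))) =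
      (\<Sum>S\<in>Pow N. \<Sum>i\<in>S. coef d (card S - 1) * G S)"
    using sum_remove_subsets[OF assms, of "\<lambda>i S. coef d (card S - 1) * G S"] by simp
  also have "\<dots> = (\<Sum>S\<in>Pow N. (real (card S) * coef d (card S - 1)) * G S)" by (simp add: mult.assoc)
  finally have 1: "(\<Sum>i\<in>N. energy d a (N - {i}) 0 0 (\<lambda>S. w (insert i S))) =
      (\<Sum>S\<in>Pow N. (real (card S) * coef d (card S - 1)) * G S)" .
  have "(\<Sum>S\<in>Pow N. (if card S = 0 then 1 else 0) * G S) = (\<Sum>S\<in>Pow N. if S = {} then G S else 0)"
    using assms by (intro sum.cong refl) (auto simp: card_eq_0_iff intro: finite_subset)
  also have "\<dots> = (\<Sum>i\<in>N. a i * (w {} - w {i})\<^sup>2)"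
    using assms by (subst sum.delta) (auto simp: G_def)
  finally have 2: "(\<Sum>S\<in>Pow N. (if card S = 0 then 1 else 0) * G S) = (\<Sum>i\<in>N. a i * (w {} - w {i})\<^sup>2)" .
  have "real (Suc (Suc d)) * energy (Suc d) a N 0 0 w =
      (\<Sum>S\<in>Pow N. (real (Suc (Suc d)) * coef (Suc d) (card S)) * G S)"
    unfolding energy_def G_def[symmetric] by (simp add: sum_distrib_left mult.assoc)
  also have "\<dots> = (\<Sum>S\<in>Pow N. (if card S = 0 then 1 else 0) * G S) +
      (\<Sum>S\<in>Pow N. (real (card S) * coef d (card S - 1)) * G S)"
    unfolding coef_Suc by (simp only: distrib_right sum.distrib)
  finally show ?thesis unfolding 1[symmetric] 2 by (simp only: sum.distrib)
qed

definition tree_potential :: "'a set \<Rightarrow> nat \<Rightarrow> ('a \<Rightarrow> real) \<Rightarrow> 'a set \<Rightarrow> real" where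
  "tree_potential N d x S = (if card S \<le> d then (\<Prod>i\<in>S. x i) * esym (N - S) (d - card S) x else 0)"

text \<open>Both sides satisfy the same recursion: below \<open>{i}\<close> the potential is
  \<open>x i\<close> times that of the smaller network, whence the factor
  \<open>(x i)\<^sup>2\<close>, and the drop along the root edge of \<open>i\<close> is
  \<open>esym (N - {i}) (Suc d) x\<close>.\<close>

lemma wronskian_energy:
  "finite N \<Longrightarrow> wronskian N d a x = energy d a N 0 0 (tree_potential N d x)"
proof (induction d arbitrary: N)
  case 0
  then show ?case by (simp add: wronskian_0 energy_0 tree_potential_def)
next
  case (Suc d)
  have "energy d a (N - {i}) 0 0 (\<lambda>S. tree_potential N (Suc d) x (insert i S)) =
      (x i)\<^sup>2 * wronskian (N - {i}) d a x" if i: "i \<in> N" for i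
  proof -
    have "energy d a (N - {i}) 0 0 (\<lambda>S. tree_potential N (Suc d) x (insert i S)) =
       energy d a (N - {i}) 0 0 (\<lambda>S. x i * tree_potential (N - {i}) d x S)"
    proof (rule energy_cong)
      fix S assume "S \<subseteq> N - {i}"
      then have "finite S" "i \<notin> S" "N - insert i S = N - {i} - S" using Suc.prems finite_subset by auto
      then show "tree_potential N (Suc d) x (insert i S) = x i * tree_potential (N - {i}) d x S"
        by (simp add: tree_potential_def)
    qed
    then show ?thesis using Suc.IH[of "N - {i}"] Suc.prems by (simp only: energy_scale finite_Diff)
  qed
  moreover have "tree_potential N (Suc d) x {} - tree_potential N (Suc d) x {i} = esym (N - {i}) (Suc d) x"
    if "i \<in> N" for i
    using esym_Suc_remove[OF Suc.prems that, of d x] by (simp add: tree_potential_def)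
  ultimately have "real (Suc (Suc d)) * wronskian N (Suc d) a x =
     real (Suc (Suc d)) * energy (Suc d) a N 0 0 (tree_potential N (Suc d) x)"
    unfolding wronskian_Suc[OF Suc.prems] energy_Suc[OF Suc.prems] by (intro sum.cong refl) simp
  then show ?case by (simp del: of_nat_Suc)
qed

text \<open>Completing the square at every vertex: a leaf conductance \<open>\<beta>\<close> in series with \<open>a\<^sub>i\<close>
  contributes the parallel sum of \<open>a\<^sub>i\<close> and \<open>\<beta>\<close>.\<close>

lemma energy_sos:
  fixes w :: "'a set \<Rightarrow> 'b::real_normed_vector \<Rightarrow> real"
  assumes "finite N" "esym_cone N d a"
    and "\<And>S. S \<subseteq> N \<Longrightarrow> real_polynomial_function (w S)"
    and "\<And>S X. S \<subseteq> N \<Longrightarrow> card S > d \<Longrightarrow> w S X = 0"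
  shows "sum_of_squares_on U
     (\<lambda>X. energy d a N 0 0 (\<lambda>S. w S X) - esym N (Suc d) a / esym N d a * (w {} X)\<^sup>2)"
  using assms
proof (induction d arbitrary: N w)
  case 0
  have "w {i} X = 0" if "i \<in> N" for i X using 0(4)[of "{i}"] that by simp
  moreover have "esym N (Suc 0) a = (\<Sum>i\<in>N. a i)" using sum_esym_remove[OF 0(1), of a 0] 0(1) by simp
  ultimately show ?case
    using 0(1) by (simp add: energy_0 sos_zero sum_distrib_right)
next
  case (Suc d)
  \<comment> \<open>\<open>\<beta> i\<close> is the effective conductance below \<open>{i}\<close>,
    and \<open>\<gamma> i\<close> will be its sum with \<open>a i\<close>. Either summand may be
    negative on the cone; \<open>\<gamma> i\<close>, a quotient of two positive values, may
    not.\<close>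
  define \<beta> where "\<beta> i = esym (N - {i}) (Suc d) a / esym (N - {i}) d a" for i
  define \<gamma> where "\<gamma> i = esym N (Suc d) a / esym (N - {i}) d a" for i
  define F where "F i X = energy d a (N - {i}) 0 0 (\<lambda>S. w (insert i S) X) - \<beta> i * (w {i} X)\<^sup>2" for i X
  define h where "h = esym N (Suc (Suc d)) a / esym N (Suc d) a"
  have pos: "esym N (Suc d) a > 0" using Suc.prems esym_cone_pos by blast
  have cone: "esym_cone (N - {i}) d a" if "i \<in> N" for i
    using Suc.prems that by (intro esym_cone_remove)
  then have pos': "esym (N - {i}) d a > 0" if "i \<in> N" for i using that esym_cone_pos by blast
  have \<gamma>: "\<gamma> i = a i + \<beta> i" "\<gamma> i > 0" if "i \<in> N" for i
    using pos'[OF that] pos esym_Suc_remove[OF Suc.prems(1) that, of d a]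
    by (auto simp: \<gamma>_def \<beta>_def field_simps)
  have F: "sum_of_squares_on U (F i)" if i: "i \<in> N" for i
    unfolding F_def \<beta>_def
  proof (rule Suc.IH)
    show "finite (N - {i})" using Suc.prems by simp
    show "esym_cone (N - {i}) d a" using cone i .
    show "real_polynomial_function (w (insert i S))" if "S \<subseteq> N - {i}" for S
      using that i by (intro Suc.prems) auto
    show "w (insert i S) X = 0" if "S \<subseteq> N - {i}" "card S > d" for S X
    proof (rule Suc.prems)
      show "insert i S \<subseteq> N" using that i by auto
      have "finite S" "i \<notin> S" using that Suc.prems(1) finite_subset[of S N] by auto
      then show "card (insert i S) > Suc d" using that by simp
    qed
  qed
  have hsum: "real (Suc (Suc d)) * h = (\<Sum>i\<in>N. a i * \<beta> i / \<gamma> i)"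
  proof -
    have "a i * \<beta> i / \<gamma> i = a i * esym (N - {i}) (Suc d) a / esym N (Suc d) a" if "i \<in> N" for i
      using pos'[OF that] pos by (simp add: \<beta>_def \<gamma>_def)
    then have "(\<Sum>i\<in>N. a i * \<beta> i / \<gamma> i) = (\<Sum>i\<in>N. a i * esym (N - {i}) (Suc d) a) / esym N (Suc d) a"
      by (simp add: sum_divide_distrib)
    then show ?thesis by (simp only: sum_esym_remove[OF Suc.prems(1)] h_def times_divide_eq_right)
  qed
  \<comment> \<open>With the root value fixed, \<open>a i * (w {} X - w {i} X)\<^sup>2 + \<beta> i *
    (w {i} X)\<^sup>2\<close> is minimal when \<open>w {i} X\<close> is
    \<open>a i / \<gamma> i\<close> times \<open>w {} X\<close>; the minimal factors
    \<open>a i * \<beta> i / \<gamma> i\<close> add up by \<open>hsum\<close>.\<close>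
  have eq: "energy (Suc d) a N 0 0 (\<lambda>S. w S X) - h * (w {} X)\<^sup>2 =
     (1 / real (Suc (Suc d))) * (\<Sum>i\<in>N. \<gamma> i * (w {i} X - (a i / \<gamma> i) * w {} X)\<^sup>2 + F i X)" for X
  proof -
    have "real (Suc (Suc d)) * (energy (Suc d) a N 0 0 (\<lambda>S. w S X) - h * (w {} X)\<^sup>2) =
       (\<Sum>i\<in>N. a i * (w {} X - w {i} X)\<^sup>2 + energy d a (N - {i}) 0 0 (\<lambda>S. w (insert i S) X))
       - (\<Sum>i\<in>N. a i * \<beta> i / \<gamma> i * (w {} X)\<^sup>2)"
      by (simp only: right_diff_distrib energy_Suc[OF Suc.prems(1)] mult.assoc[symmetric] hsum sum_distrib_right)
    also have "\<dots> = (\<Sum>i\<in>N. \<gamma> i * (w {i} X - (a i / \<gamma> i) * w {} X)\<^sup>2 + F i X)"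
      unfolding sum_subtractf[symmetric]
    proof (intro sum.cong refl)
      fix i assume i: "i \<in> N"
      define b where "b = \<beta> i"
      have b: "\<gamma> i = a i + b" "a i + b \<noteq> 0" using \<gamma>[OF i] by (auto simp: b_def)
      show "a i * (w {} X - w {i} X)\<^sup>2 + energy d a (N - {i}) 0 0 (\<lambda>S. w (insert i S) X) -
         a i * \<beta> i / \<gamma> i * (w {} X)\<^sup>2 = \<gamma> i * (w {i} X - (a i / \<gamma> i) * w {} X)\<^sup>2 + F i X"
        unfolding F_def b(1) b_def[symmetric] using b(2)
        by (simp add: divide_simps power2_eq_square) (simp add: algebra_simps)
    qed
    finally show ?thesis by (simp add: field_simps del: of_nat_Suc)
  qed
  have "sum_of_squares_on U (\<lambda>X. \<gamma> i * (w {i} X - (a i / \<gamma> i) * w {} X)\<^sup>2 + F i X)" if i: "i \<in> N" for i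
  proof (intro sos_add sos_scale sos_square F i)
    show "0 \<le> \<gamma> i" using \<gamma>[OF i] by simp
    have "real_polynomial_function (w {i})" "real_polynomial_function (w {})" using i Suc.prems by auto
    then show "real_polynomial_function (\<lambda>X. w {i} X - (a i / \<gamma> i) * w {} X)"
      by (intro real_polynomial_function_diff real_polynomial_function.intros(2,4))
  qed
  then show ?case unfolding h_def[symmetric] eq by (intro sos_scale sos_sum) auto
qed

section \<open>Splitting off antisymmetric pairs of indices\<close>

lemma sum_Pow_insert:
  fixes f :: "'a set \<Rightarrow> real"
  assumes "finite A" "x \<notin> A"
  shows "(\<Sum>S\<in>Pow (insert x A). f S) = (\<Sum>S\<in>Pow A. f S + f (insert x S))"
proof -
  have "inj_on (insert x) (Pow A)" using assms by (intro inj_onI) (metis PowD insert_ident subsetD)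
  then show ?thesis using assms
    by (simp add: Pow_insert sum.distrib, subst sum.union_disjoint) (auto simp: sum.reindex)
qed

text \<open>Of the four sets over \<open>R\<close>, only \<open>insert e R\<close> and
  \<open>insert e' R\<close> carry potential, namely \<open>w R\<close> and \<open>- w R\<close>.
  The edges entering them from \<open>R\<close> have coefficient \<open>coef d (card R + m)\<close>,
  the edges leaving them for the fourth set the next one. Each kind contributes its coefficient
  times \<open>(a e + a e') * (w R)\<^sup>2\<close>, which is the origin of the term with
  \<open>s\<close> in \<open>energy\<close>. The factor \<open>2\<close> counts the two
  copies.\<close>

lemma energy_pair:
  fixes w :: "'a set \<Rightarrow> real"
  assumes "finite M" "e \<in> M" "e' \<in> M" "e \<noteq> e'"
  defines "w' \<equiv> \<lambda>S. if e \<in> S \<and> e' \<notin> S then w (S - {e}) else if e' \<in> S \<and> e \<notin> S then - w (S - {e'}) else 0"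
  shows "energy d a M m s w' = 2 * energy d a (M - {e,e'}) (Suc m) (s + (a e + a e') / 2) w"
proof -
  define M' where "M' = M - {e,e'}"
  have M: "M = insert e (insert e' M')" and notin: "e \<notin> M'" "e' \<notin> M'" "e \<notin> insert e' M'" and fin: "finite M'"
    using assms by (auto simp: M'_def)
  define f where "f R = coef d (card R + m) * (\<Sum>i\<in>M - R. a i * (w' R - w' (insert i R))\<^sup>2)
     + s * (coef d (card R + m) + coef d (card R + m - 1)) * (w' R)\<^sup>2" for R
  have "energy d a M m s w' = (\<Sum>R\<in>Pow M'. f R + f (insert e' R) + (f (insert e R) + f (insert e (insert e' R))))"
  proof -
    have "energy d a M m s w' = (\<Sum>R\<in>Pow (insert e (insert e' M')). f R)"
      unfolding energy_def f_def M[symmetric] by simp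
    also have "\<dots> = (\<Sum>R\<in>Pow (insert e' M'). f R + f (insert e R))"
      using fin notin by (intro sum_Pow_insert) auto
    also have "\<dots> = (\<Sum>R\<in>Pow M'. f R + f (insert e R) + (f (insert e' R) + f (insert e (insert e' R))))"
      using fin notin by (intro sum_Pow_insert) auto
    finally show ?thesis by (simp add: algebra_simps)
  qed
  also have "\<dots> = (\<Sum>R\<in>Pow M'. 2 * (coef d (card R + Suc m) * (\<Sum>i\<in>M' - R. a i * (w R - w (insert i R))\<^sup>2)
     + (s + (a e + a e') / 2) * (coef d (card R + Suc m) + coef d (card R + Suc m - 1)) * (w R)\<^sup>2))"
  proof (intro sum.cong refl)
    fix R assume "R \<in> Pow M'"
    then have R: "R \<subseteq> M'" "finite R" "e \<notin> R" "e' \<notin> R" using fin notin finite_subset by auto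
    let ?g = "\<Sum>i\<in>M' - R. a i * (w R - w (insert i R))\<^sup>2"
    have D: "M - R = insert e (insert e' (M' - R))" "M - insert e R = insert e' (M' - R)"
      "M - insert e' R = insert e (M' - R)" "M - insert e (insert e' R) = M' - R"
      using R notin assms(4) unfolding M by auto
    have W: "w' R = 0" "w' (insert e R) = w R" "w' (insert e' R) = - w R" "w' (insert e (insert e' R)) = 0"
      "w' (insert e' (insert e R)) = 0"
      using R assms(4) by (auto simp: w'_def)
    have Wi: "w' (insert i R) = 0" "w' (insert i (insert e R)) = w (insert i R)"
      "w' (insert i (insert e' R)) = - w (insert i R)" "w' (insert i (insert e (insert e' R))) = 0"
      if "i \<in> M' - R" for i
    proof -
      have i: "i \<noteq> e" "i \<noteq> e'" using that notin by auto
      then have "insert i (insert e R) - {e} = insert i R" "insert i (insert e' R) - {e'} = insert i R"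
        using R by auto
      then show "w' (insert i R) = 0" "w' (insert i (insert e R)) = w (insert i R)"
        "w' (insert i (insert e' R)) = - w (insert i R)" "w' (insert i (insert e (insert e' R))) = 0"
        using R i assms(4) by (auto simp: w'_def)
    qed
    have f1: "f R = coef d (card R + m) * ((a e + a e') * (w R)\<^sup>2)"
      unfolding f_def D using fin R notin assms(4) by (simp add: W Wi algebra_simps)
    have f2: "f (insert e R) = coef d (card R + Suc m) * (a e' * (w R)\<^sup>2 + ?g)
       + s * (coef d (card R + Suc m) + coef d (card R + m)) * (w R)\<^sup>2"
      unfolding f_def D using fin R notin assms(4) by (simp add: W Wi)
    have f3: "f (insert e' R) = coef d (card R + Suc m) * (a e * (w R)\<^sup>2 + ?g)
       + s * (coef d (card R + Suc m) + coef d (card R + m)) * (w R)\<^sup>2"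
      unfolding f_def D using fin R notin assms(4) by (simp add: W Wi power2_commute)
    have f4: "f (insert e (insert e' R)) = 0"
      unfolding f_def D using fin R notin assms(4) by (simp add: W Wi)
    show "f R + f (insert e' R) + (f (insert e R) + f (insert e (insert e' R))) =
       2 * (coef d (card R + Suc m) * ?g
     + (s + (a e + a e') / 2) * (coef d (card R + Suc m) + coef d (card R + Suc m - 1)) * (w R)\<^sup>2)"
      unfolding f1 f2 f3 f4 by (simp add: field_simps)
  qed
  finally show ?thesis unfolding energy_def M'_def[symmetric] by (simp add: sum_distrib_left)
qed

text \<open>The induction undoes the splitting: \<open>energy_pair\<close> rewrites the reduced
  energy as half the energy of an antisymmetric potential with one pair restored, until
  \<open>energy_sos\<close> applies on all of \<open>N\<close>.\<close>

lemma energy_pairs_sos: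
  fixes w :: "'a set \<Rightarrow> 'b::real_normed_vector \<Rightarrow> real"
  assumes "finite N" "esym_cone N (Suc d) a"
    and "E \<subseteq> N" "E' \<subseteq> N" "E \<inter> E' = {}" "card E = card E'"
    and "\<And>S. S \<subseteq> N - (E \<union> E') \<Longrightarrow> real_polynomial_function (w S)"
    and "\<And>S X. S \<subseteq> N - (E \<union> E') \<Longrightarrow> card S + card E > d \<Longrightarrow> w S X = 0"
  shows "sum_of_squares_on U
     (\<lambda>X. energy d a (N - (E \<union> E')) (card E) ((sum a E + sum a E') / 2) (\<lambda>S. w S X))"
proof -
  have "finite E" using finite_subset[OF assms(3,1)] .
  then show ?thesis using assms(3-)
  proof (induction E arbitrary: E' w)
    case empty
    then have E': "E' = {}" using finite_subset[OF _ assms(1), of E'] by simp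
    have cone: "esym_cone N d a" using esym_cone_pred assms by blast
    have sos: "sum_of_squares_on U
       (\<lambda>X. energy d a N 0 0 (\<lambda>S. w S X) - esym N (Suc d) a / esym N d a * (w {} X)\<^sup>2)"
      using empty E' by (intro energy_sos assms(1) cone) auto
    have "real_polynomial_function (w {})" using empty by auto
    moreover have "esym N (Suc d) a > 0" "esym N d a > 0"
      using esym_cone_pos assms(2) cone by blast+
    \<comment> \<open>The square subtracted in \<open>energy_sos\<close> is added back; the cone in
      degree \<open>Suc d\<close> makes its factor positive.\<close>
    ultimately have "sum_of_squares_on U (\<lambda>X. esym N (Suc d) a / esym N d a * (w {} X)\<^sup>2)"
      by (intro sos_scale sos_square) auto
    from sos_add[OF sos this] show ?case using E' by simp
  next
    case (insert e E)
    have finE': "finite E'" using finite_subset[OF insert.prems(2) assms(1)] .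
    have "card E' = Suc (card E)" using insert by simp
    then obtain e' where e': "e' \<in> E'" by fastforce
    define F where "F = E' - {e'}"
    have E': "E' = insert e' F" "e' \<notin> F" "finite F" using e' finE' by (auto simp: F_def)
    define M where "M = N - (E \<union> F)"
    have M: "finite M" "e \<in> M" "e' \<in> M" "e \<noteq> e'" "N - (insert e E \<union> E') = M - {e,e'}"
      using insert E' assms(1) by (auto simp: M_def)
    define w' where "w' S X = (if e \<in> S \<and> e' \<notin> S then w (S - {e}) X
      else if e' \<in> S \<and> e \<notin> S then - w (S - {e'}) X else 0)" for S X
    have "sum_of_squares_on U (\<lambda>X. energy d a (N - (E \<union> F)) (card E) ((sum a E + sum a F) / 2) (\<lambda>S. w' S X))"
    proof (rule insert.IH)
      show "E \<subseteq> N" "F \<subseteq> N" "E \<inter> F = {}" using insert.prems E' by auto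
      show "card E = card F" using \<open>card E' = Suc (card E)\<close> E' by simp
      fix S assume S: "S \<subseteq> N - (E \<union> F)"
      have r: "real_polynomial_function (w (S - {e}))" if "e' \<notin> S"
        using S that by (intro insert.prems(5)) (auto simp: E')
      have r': "real_polynomial_function (w (S - {e'}))" if "e \<notin> S"
        using S that by (intro insert.prems(5)) (auto simp: E')
      consider "e \<in> S" "e' \<notin> S" | "e' \<in> S" "e \<notin> S" | "e \<in> S \<longleftrightarrow> e' \<in> S" by blast
      then show "real_polynomial_function (w' S)"
      proof cases
        case 1
        then have "w' S = w (S - {e})" by (auto simp: w'_def)
        then show ?thesis using r 1 by simp
      next
        case 2
        then have "w' S = (\<lambda>X. - w (S - {e'}) X)" by (auto simp: w'_def)
        then show ?thesis using r' 2 real_polynomial_function_minus by simp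
      next
        case 3
        then have "w' S = (\<lambda>X. 0)" by (auto simp: w'_def)
        then show ?thesis by (simp add: real_polynomial_function.intros)
      qed
    next
      fix S X assume S: "S \<subseteq> N - (E \<union> F)" "card S + card E > d"
      have "finite S" using finite_subset[OF S(1)] assms(1) by simp
      \<comment> \<open>Restoring a pair takes one element from the block sets and gives one to
        \<open>S\<close>, so the bound on the depth is the same.\<close>
      then have c: "card (S - {x}) + card (insert e E) = card S + card E" if "x \<in> S" for x
        using that insert.hyps by (simp add: card_Diff_singleton) (metis Suc_pred add_Suc card_gt_0_iff empty_iff)
      have "w (S - {e}) X = 0" if "e \<in> S" "e' \<notin> S"
        using S that c by (intro insert.prems(6)) (auto simp: E')
      moreover have "w (S - {e'}) X = 0" if "e' \<in> S" "e \<notin> S"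
        using S that c by (intro insert.prems(6)) (auto simp: E')
      ultimately show "w' S X = 0" by (auto simp: w'_def)
    qed
    then have "sum_of_squares_on U (\<lambda>X. (1/2) * energy d a M (card E) ((sum a E + sum a F) / 2) (\<lambda>S. w' S X))"
      unfolding M_def by (intro sos_scale) auto
    moreover have "(1/2) * energy d a M (card E) ((sum a E + sum a F) / 2) (\<lambda>S. w' S X) =
       energy d a (N - (insert e E \<union> E')) (card (insert e E)) ((sum a (insert e E) + sum a E') / 2) (\<lambda>S. w S X)" for X
      unfolding w'_def M(5) using energy_pair[OF M(1-4), of d a "card E" "(sum a E + sum a F) / 2" "\<lambda>S. w S X"] insert.hyps E'
      by (simp add: algebra_simps add_divide_distrib)
    ultimately show ?case by simp
  qed
qed

section \<open>Minors as covariant alternating tensors\<close>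

abbreviation nlists :: "nat \<Rightarrow> 'a list set" where
  "nlists k \<equiv> {I. length I = k}"

lemma finite_nlists [simp]: "finite (nlists k :: 'n::finite list set)"
  using finite_lists_length_eq[of "UNIV :: 'n set" k] by simp

lemma sum_nlists_Suc:
  fixes f :: "'n::finite list \<Rightarrow> real"
  shows "(\<Sum>I\<in>nlists (Suc k). f I) = (\<Sum>i\<in>UNIV. \<Sum>I\<in>nlists k. f (i # I))"
proof -
  have "(\<Sum>I\<in>nlists (Suc k). f I) = (\<Sum>(i,I)\<in>UNIV \<times> nlists k. f (i # I))"
    by (rule sum.reindex_bij_witness[of _ "\<lambda>(i,I). i # I" "\<lambda>I. (hd I, tl I)"]) (auto simp: length_Suc_conv)
  then show ?thesis by (simp add: sum.cartesian_product)
qed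

lemma nlists_0 [simp]: "nlists 0 = {[]}"
  by auto

lemma prod_sum_nlists:
  fixes f :: "nat \<Rightarrow> 'n::finite \<Rightarrow> real"
  shows "(\<Prod>a<k. \<Sum>p\<in>UNIV. f a p) = (\<Sum>K\<in>nlists k. \<Prod>a<k. f a (K ! a))"
proof (induction k arbitrary: f)
  case (Suc k)
  show ?case
    unfolding prod.lessThan_Suc_shift sum_nlists_Suc Suc.IH[of "\<lambda>a. f (Suc a)"]
    by (simp add: sum_distrib_left sum_distrib_right) (rule sum.swap)
qed simp

text \<open>Lists may repeat entries and come in any order, unlike increasing index sequences. Sums
  over lists then factor slot by slot, and a change of basis acts by plain tensor powers.\<close>

definition minor :: "real^'n^'n \<Rightarrow> 'n list \<Rightarrow> 'n list \<Rightarrow> real" where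
  "minor X I J = (\<Sum>\<pi> | \<pi> permutes {..<length I}.
     of_int (sign \<pi>) * (\<Prod>a<length I. X $ (I ! a) $ (J ! \<pi> a)))"

definition tensor_pow :: "real^'n^'n \<Rightarrow> 'n list \<Rightarrow> 'n list \<Rightarrow> real" where
  "tensor_pow Q I K = (\<Prod>a<length I. Q $ (I ! a) $ (K ! a))"

lemma tensor_pow_Nil [simp]: "tensor_pow Q [] K = 1"
  by (simp add: tensor_pow_def)

lemma tensor_pow_Cons [simp]: "tensor_pow Q (i # I) (k # K) = Q $ i $ k * tensor_pow Q I K"
  by (simp add: tensor_pow_def prod.lessThan_Suc_shift del: prod.lessThan_Suc)

lemma minor_transpose:
  assumes "length I = length J"
  shows "minor (transpose X) I J = minor X J I"
proof -
  let ?n = "length J"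
  have "minor (transpose X) I J = (\<Sum>\<pi> | \<pi> permutes {..<?n}. of_int (sign (inv \<pi>)) *
     (\<Prod>a<?n. X $ (J ! inv \<pi> a) $ (I ! a)))"
    unfolding minor_def assms transpose_def
    by (subst sum_permutations_inverse) simp
  also have "\<dots> = (\<Sum>\<pi> | \<pi> permutes {..<?n}. of_int (sign \<pi>) * (\<Prod>a<?n. X $ (J ! a) $ (I ! \<pi> a)))"
  proof (intro sum.cong refl)
    fix \<pi> assume "\<pi> \<in> {\<pi>. \<pi> permutes {..<?n}}"
    then have p: "\<pi> permutes {..<?n}" by simp
    have "(\<Prod>a<?n. X $ (J ! inv \<pi> a) $ (I ! a)) = (\<Prod>a<?n. X $ (J ! a) $ (I ! \<pi> a))"
      using p by (subst prod.permute[OF p]) (simp add: permutes_inverses)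
    then show "of_int (sign (inv \<pi>)) * (\<Prod>a<?n. X $ (J ! inv \<pi> a) $ (I ! a)) =
       of_int (sign \<pi>) * (\<Prod>a<?n. X $ (J ! a) $ (I ! \<pi> a))"
      using p by (simp add: sign_inverse permutation_permutes[of \<pi>] exI[of _ "{..<?n}"])
  qed
  finally show ?thesis unfolding minor_def .
qed

text \<open>Multilinearity in the rows. As \<open>K\<close> runs over all lists, no Cauchy-Binet
  regrouping is involved.\<close>

lemma minor_mult_left:
  "minor (Q ** X) I J = (\<Sum>K\<in>nlists (length I). tensor_pow Q I K * minor X K J)"
proof -
  let ?k = "length I"
  have "minor (Q ** X) I J = (\<Sum>\<pi> | \<pi> permutes {..<?k}. of_int (sign \<pi>) *
     (\<Sum>K\<in>nlists ?k. \<Prod>a<?k. Q $ (I ! a) $ (K ! a) * X $ (K ! a) $ (J ! \<pi> a)))"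
    unfolding minor_def by (simp add: matrix_matrix_mult_def prod_sum_nlists)
  also have "\<dots> = (\<Sum>K\<in>nlists ?k. \<Sum>\<pi> | \<pi> permutes {..<?k}. of_int (sign \<pi>) *
     (\<Prod>a<?k. Q $ (I ! a) $ (K ! a) * X $ (K ! a) $ (J ! \<pi> a)))"
    by (simp add: sum_distrib_left sum.swap[of _ "nlists ?k"])
  also have "\<dots> = (\<Sum>K\<in>nlists ?k. tensor_pow Q I K * minor X K J)"
    by (intro sum.cong refl) (simp add: minor_def tensor_pow_def prod.distrib sum_distrib_left mult_ac)
  finally show ?thesis .
qed

lemma minor_mult_right:
  assumes "length I = length J"
  shows "minor (X ** transpose Q) I J = (\<Sum>L\<in>nlists (length J). tensor_pow Q J L * minor X I L)"
proof -
  have "minor (X ** transpose Q) I J = minor (Q ** transpose X) J I"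
    using minor_transpose[OF assms[symmetric], of "X ** transpose Q"] by (simp add: matrix_transpose_mul)
  also have "\<dots> = (\<Sum>L\<in>nlists (length J). tensor_pow Q J L * minor (transpose X) L I)"
    by (rule minor_mult_left)
  also have "\<dots> = (\<Sum>L\<in>nlists (length J). tensor_pow Q J L * minor X I L)"
    using assms by (intro sum.cong refl) (simp add: minor_transpose)
  finally show ?thesis .
qed

section \<open>Tensors transforming under the orthogonal group\<close>

definition covariant :: "real^'n^'n \<Rightarrow> nat \<Rightarrow> ('n list \<Rightarrow> 'n list \<Rightarrow> real) \<Rightarrow> ('n list \<Rightarrow> 'n list \<Rightarrow> real) \<Rightarrow> bool" where
  "covariant Q k T T' \<longleftrightarrow> (\<forall>I\<in>nlists k. \<forall>J\<in>nlists k.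
     T' I J = (\<Sum>K\<in>nlists k. \<Sum>L\<in>nlists k. tensor_pow Q I K * (tensor_pow Q J L * T K L)))"

lemma covariantD: "covariant Q k T T' \<Longrightarrow> length I = k \<Longrightarrow> length J = k \<Longrightarrow>
  T' I J = (\<Sum>K\<in>nlists k. \<Sum>L\<in>nlists k. tensor_pow Q I K * (tensor_pow Q J L * T K L))"
  by (simp add: covariant_def)

lemma covariant_minor: "covariant Q k (minor X) (minor (Q ** X ** transpose Q))"
  unfolding covariant_def
proof (intro ballI)
  fix I J :: "'a list" assume IJ: "I \<in> nlists k" "J \<in> nlists k"
  have "minor (Q ** X ** transpose Q) I J = minor (Q ** (X ** transpose Q)) I J"
    by (simp add: matrix_mul_assoc)
  also have "\<dots> = (\<Sum>K\<in>nlists k. tensor_pow Q I K * minor (X ** transpose Q) K J)"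
    using IJ by (simp add: minor_mult_left)
  also have "\<dots> = (\<Sum>K\<in>nlists k. \<Sum>L\<in>nlists k. tensor_pow Q I K * (tensor_pow Q J L * minor X K L))"
    using IJ by (intro sum.cong refl) (simp add: minor_mult_right sum_distrib_left)
  finally show "minor (Q ** X ** transpose Q) I J =
    (\<Sum>K\<in>nlists k. \<Sum>L\<in>nlists k. tensor_pow Q I K * (tensor_pow Q J L * minor X K L))" .
qed

lemma orthogonal_isometry:
  fixes Q :: "real^'n^'n"
  assumes "orthogonal_matrix Q"
  shows "(\<Sum>i\<in>UNIV. (\<Sum>p\<in>UNIV. Q $ i $ p * f p) * (\<Sum>q\<in>UNIV. Q $ i $ q * g q)) = (\<Sum>p\<in>UNIV. f p * g p)"
proof -
  have orth: "(\<Sum>i\<in>UNIV. Q $ i $ p * Q $ i $ q) = (if p = q then 1 else 0)" for p q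
    using assms unfolding orthogonal_matrix_def
    by (simp add: matrix_matrix_mult_def transpose_def mat_def vec_eq_iff)
  have "(\<Sum>i\<in>UNIV. (\<Sum>p\<in>UNIV. Q $ i $ p * f p) * (\<Sum>q\<in>UNIV. Q $ i $ q * g q)) =
      (\<Sum>i\<in>UNIV. \<Sum>p\<in>UNIV. \<Sum>q\<in>UNIV. (Q $ i $ p * Q $ i $ q) * (f p * g q))"
    unfolding sum_product by (intro sum.cong refl) (simp add: mult_ac)
  also have "\<dots> = (\<Sum>p\<in>UNIV. \<Sum>i\<in>UNIV. \<Sum>q\<in>UNIV. (Q $ i $ p * Q $ i $ q) * (f p * g q))"
    by (rule sum.swap)
  also have "\<dots> = (\<Sum>p\<in>UNIV. \<Sum>q\<in>UNIV. \<Sum>i\<in>UNIV. (Q $ i $ p * Q $ i $ q) * (f p * g q))"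
    by (intro sum.cong refl sum.swap)
  also have "\<dots> = (\<Sum>p\<in>UNIV. \<Sum>q\<in>UNIV. (if p = q then 1 else 0) * (f p * g q))"
    by (simp only: sum_distrib_right[symmetric] orth)
  also have "\<dots> = (\<Sum>p\<in>UNIV. f p * g p)" by (simp add: if_distrib[of "\<lambda>c. c * _"] cong: if_cong)
  finally show ?thesis .
qed

text \<open>Stripping off one slot at a time reduces the orthogonality of a tensor power of
  \<open>Q\<close> to that of \<open>Q\<close>.\<close>

lemma tensor_isometry:
  assumes "orthogonal_matrix Q"
  shows "(\<Sum>I\<in>nlists k. (\<Sum>K\<in>nlists k. tensor_pow Q I K * f K) * (\<Sum>K\<in>nlists k. tensor_pow Q I K * g K))
     = (\<Sum>K\<in>nlists k. f K * g K)"
proof (induction k arbitrary: f g)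
  case (Suc k)
  let ?F = "\<lambda>f I p. \<Sum>K\<in>nlists k. tensor_pow Q I K * f (p # K)"
  have e: "(\<Sum>K\<in>nlists (Suc k). tensor_pow Q (i # I) K * f K) = (\<Sum>p\<in>UNIV. Q $ i $ p * ?F f I p)" for i I f
    by (simp add: sum_nlists_Suc sum_distrib_left mult_ac)
  have "(\<Sum>I\<in>nlists (Suc k). (\<Sum>K\<in>nlists (Suc k). tensor_pow Q I K * f K) * (\<Sum>K\<in>nlists (Suc k). tensor_pow Q I K * g K))
     = (\<Sum>i\<in>UNIV. \<Sum>I\<in>nlists k. (\<Sum>p\<in>UNIV. Q $ i $ p * ?F f I p) * (\<Sum>p\<in>UNIV. Q $ i $ p * ?F g I p))"
    unfolding sum_nlists_Suc[of "\<lambda>I. (\<Sum>K\<in>nlists (Suc k). tensor_pow Q I K * f K) * (\<Sum>K\<in>nlists (Suc k). tensor_pow Q I K * g K)"] e ..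
  also have "\<dots> = (\<Sum>I\<in>nlists k. \<Sum>i\<in>UNIV. (\<Sum>p\<in>UNIV. Q $ i $ p * ?F f I p) * (\<Sum>p\<in>UNIV. Q $ i $ p * ?F g I p))"
    by (rule sum.swap)
  also have "\<dots> = (\<Sum>I\<in>nlists k. \<Sum>p\<in>UNIV. ?F f I p * ?F g I p)"
    by (simp only: orthogonal_isometry[OF assms])
  also have "\<dots> = (\<Sum>p\<in>UNIV. \<Sum>I\<in>nlists k. ?F f I p * ?F g I p)"
    by (rule sum.swap)
  also have "\<dots> = (\<Sum>K\<in>nlists (Suc k). f K * g K)"
    by (simp only: Suc.IH sum_nlists_Suc)
  finally show ?case .
qed simp

text \<open>The isometry acts on the row slots and on the column slots separately. Apart from the
  trace of \<open>A\<close>, all ingredients of \<open>tenergy\<close> are pairings of this kind,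
  which gives its invariance.\<close>

lemma covariant_pairing:
  assumes "orthogonal_matrix Q" "covariant Q k T T'" "covariant Q k U U'"
  shows "(\<Sum>I\<in>nlists k. \<Sum>J\<in>nlists k. T' I J * U' I J) = (\<Sum>I\<in>nlists k. \<Sum>J\<in>nlists k. T I J * U I J)"
proof -
  let ?F = "\<lambda>T K J. \<Sum>L\<in>nlists k. tensor_pow Q J L * T K L"
  have "T' I J = (\<Sum>K\<in>nlists k. tensor_pow Q I K * ?F T K J)"
    "U' I J = (\<Sum>K\<in>nlists k. tensor_pow Q I K * ?F U K J)" if "I \<in> nlists k" "J \<in> nlists k" for I J
    using that assms(2,3)[THEN covariantD, of I J] by (simp_all add: sum_distrib_left)
  then have "(\<Sum>I\<in>nlists k. \<Sum>J\<in>nlists k. T' I J * U' I J) =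
     (\<Sum>I\<in>nlists k. \<Sum>J\<in>nlists k. (\<Sum>K\<in>nlists k. tensor_pow Q I K * ?F T K J) * (\<Sum>K\<in>nlists k. tensor_pow Q I K * ?F U K J))"
    by (intro sum.cong refl) simp
  also have "\<dots> = (\<Sum>J\<in>nlists k. \<Sum>I\<in>nlists k. (\<Sum>K\<in>nlists k. tensor_pow Q I K * ?F T K J) * (\<Sum>K\<in>nlists k. tensor_pow Q I K * ?F U K J))"
    by (rule sum.swap)
  also have "\<dots> = (\<Sum>J\<in>nlists k. \<Sum>K\<in>nlists k. ?F T K J * ?F U K J)"
    by (simp only: tensor_isometry[OF assms(1)])
  also have "\<dots> = (\<Sum>K\<in>nlists k. \<Sum>J\<in>nlists k. ?F T K J * ?F U K J)"
    by (rule sum.swap)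
  also have "\<dots> = (\<Sum>I\<in>nlists k. \<Sum>J\<in>nlists k. T I J * U I J)"
    by (simp only: tensor_isometry[OF assms(1)])
  finally show ?thesis .
qed

lemma conj_entry:
  fixes Q :: "real^'n^'n"
  shows "(Q ** B ** transpose Q) $ i $ j = (\<Sum>p\<in>UNIV. \<Sum>q\<in>UNIV. Q $ i $ p * (Q $ j $ q * B $ p $ q))"
proof -
  have "(Q ** B ** transpose Q) $ i $ j = (\<Sum>q\<in>UNIV. \<Sum>p\<in>UNIV. Q $ i $ p * B $ p $ q * Q $ j $ q)"
    by (simp add: matrix_matrix_mult_def transpose_def sum_distrib_right)
  also have "\<dots> = (\<Sum>p\<in>UNIV. \<Sum>q\<in>UNIV. Q $ i $ p * B $ p $ q * Q $ j $ q)"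
    by (rule sum.swap)
  finally show ?thesis by (simp add: mult_ac)
qed

text \<open>\<open>B\<close> acts on one row slot only. For alternating tensors all row slots
  contribute equally to the pairing, so the derivation induced by \<open>B\<close> costs just the
  factor \<open>real k\<close> in \<open>tleft\<close>.\<close>

definition insert_left :: "real^'n^'n \<Rightarrow> ('n list \<Rightarrow> 'n list \<Rightarrow> real) \<Rightarrow> 'n list \<Rightarrow> 'n list \<Rightarrow> real" where
  "insert_left B T I J = (\<Sum>u\<in>UNIV. B $ hd I $ u * T (u # tl I) J)"

definition contract :: "real^'n^'n \<Rightarrow> ('n list \<Rightarrow> 'n list \<Rightarrow> real) \<Rightarrow> 'n list \<Rightarrow> 'n list \<Rightarrow> real" where
  "contract B T I J = (\<Sum>i\<in>UNIV. \<Sum>j\<in>UNIV. B $ i $ j * T (i # I) (j # J))"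

text \<open>Summation over the inserted index cancels the two factors \<open>Q\<close> attached to
  it by orthogonality, while the factor at the free row index survives.\<close>

lemma covariant_insert_left:
  assumes "orthogonal_matrix Q" "covariant Q (Suc k) T T'"
  shows "covariant Q (Suc k) (insert_left B T) (insert_left (Q ** B ** transpose Q) T')"
  unfolding covariant_def
proof (intro ballI)
  fix I' J :: "'a list" assume IJ: "I' \<in> nlists (Suc k)" "J \<in> nlists (Suc k)"
  then obtain i I where I': "I' = i # I" and I: "length I = k" by (auto simp: length_Suc_conv)
  define g where "g p = (\<Sum>K\<in>nlists k. \<Sum>L\<in>nlists (Suc k). tensor_pow Q I K * (tensor_pow Q J L * T (p # K) L))" for p
  have T': "T' (u # I) J = (\<Sum>p\<in>UNIV. Q $ u $ p * g p)" for u
  proof -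
    have "T' (u # I) J = (\<Sum>K\<in>nlists (Suc k). \<Sum>L\<in>nlists (Suc k). tensor_pow Q (u # I) K * (tensor_pow Q J L * T K L))"
      using I IJ by (intro covariantD[OF assms(2)]) simp_all
    also have "\<dots> = (\<Sum>p\<in>UNIV. \<Sum>K\<in>nlists k. \<Sum>L\<in>nlists (Suc k). tensor_pow Q (u # I) (p # K) * (tensor_pow Q J L * T (p # K) L))"
      by (rule sum_nlists_Suc)
    finally show ?thesis by (simp add: g_def sum_distrib_left mult.assoc)
  qed
  have B': "(Q ** B ** transpose Q) $ i $ u = (\<Sum>q\<in>UNIV. Q $ u $ q * (\<Sum>p\<in>UNIV. Q $ i $ p * B $ p $ q))" for u
    unfolding conj_entry sum_distrib_left by (subst sum.swap) (intro sum.cong refl, simp add: mult_ac)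
  have "insert_left (Q ** B ** transpose Q) T' I' J = (\<Sum>q\<in>UNIV. (\<Sum>p\<in>UNIV. Q $ i $ p * B $ p $ q) * g q)"
    unfolding insert_left_def I' list.sel T' B' by (rule orthogonal_isometry[OF assms(1)])
  also have "\<dots> = (\<Sum>p\<in>UNIV. \<Sum>q\<in>UNIV. Q $ i $ p * (B $ p $ q * g q))"
    unfolding sum_distrib_right mult.assoc by (rule sum.swap)
  also have "\<dots> = (\<Sum>p\<in>UNIV. \<Sum>q\<in>UNIV. \<Sum>K\<in>nlists k. \<Sum>L\<in>nlists (Suc k).
     Q $ i $ p * tensor_pow Q I K * (tensor_pow Q J L * (B $ p $ q * T (q # K) L)))"
    unfolding g_def sum_distrib_left by (intro sum.cong refl) (simp add: mult_ac)
  also have "\<dots> = (\<Sum>p\<in>UNIV. \<Sum>K\<in>nlists k. \<Sum>q\<in>UNIV. \<Sum>L\<in>nlists (Suc k).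
     Q $ i $ p * tensor_pow Q I K * (tensor_pow Q J L * (B $ p $ q * T (q # K) L)))"
    by (intro sum.cong refl sum.swap)
  also have "\<dots> = (\<Sum>p\<in>UNIV. \<Sum>K\<in>nlists k. \<Sum>L\<in>nlists (Suc k). \<Sum>q\<in>UNIV.
     Q $ i $ p * tensor_pow Q I K * (tensor_pow Q J L * (B $ p $ q * T (q # K) L)))"
    by (intro sum.cong refl sum.swap)
  also have "\<dots> = (\<Sum>p\<in>UNIV. \<Sum>K\<in>nlists k. \<Sum>L\<in>nlists (Suc k).
     tensor_pow Q I' (p # K) * (tensor_pow Q J L * insert_left B T (p # K) L))"
    by (simp add: I' insert_left_def sum_distrib_left)
  also have "\<dots> = (\<Sum>K\<in>nlists (Suc k). \<Sum>L\<in>nlists (Suc k). tensor_pow Q I' K * (tensor_pow Q J L * insert_left B T K L))"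
    by (rule sum_nlists_Suc[symmetric])
  finally show "insert_left (Q ** B ** transpose Q) T' I' J =
    (\<Sum>K\<in>nlists (Suc k). \<Sum>L\<in>nlists (Suc k). tensor_pow Q I' K * (tensor_pow Q J L * insert_left B T K L))" .
qed

lemma orthogonal_isometry2:
  fixes Q :: "real^'n^'n"
  assumes "orthogonal_matrix Q"
  shows "(\<Sum>i\<in>UNIV. \<Sum>j\<in>UNIV. (Q ** B ** transpose Q) $ i $ j * (\<Sum>p\<in>UNIV. \<Sum>q\<in>UNIV. Q $ i $ p * (Q $ j $ q * g p q)))
    = (\<Sum>p\<in>UNIV. \<Sum>q\<in>UNIV. B $ p $ q * g p q)"
proof -
  let ?F = "\<lambda>T p j. \<Sum>q\<in>UNIV. Q $ j $ q * T p q"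
  have "(\<Sum>i\<in>UNIV. \<Sum>j\<in>UNIV. (Q ** B ** transpose Q) $ i $ j * (\<Sum>p\<in>UNIV. \<Sum>q\<in>UNIV. Q $ i $ p * (Q $ j $ q * g p q)))
     = (\<Sum>i\<in>UNIV. \<Sum>j\<in>UNIV. (\<Sum>p\<in>UNIV. Q $ i $ p * ?F (\<lambda>p q. B $ p $ q) p j) * (\<Sum>p\<in>UNIV. Q $ i $ p * ?F g p j))"
    by (simp only: conj_entry sum_distrib_left[symmetric])
  also have "\<dots> = (\<Sum>j\<in>UNIV. \<Sum>i\<in>UNIV. (\<Sum>p\<in>UNIV. Q $ i $ p * ?F (\<lambda>p q. B $ p $ q) p j) * (\<Sum>p\<in>UNIV. Q $ i $ p * ?F g p j))"
    by (rule sum.swap)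
  also have "\<dots> = (\<Sum>j\<in>UNIV. \<Sum>p\<in>UNIV. ?F (\<lambda>p q. B $ p $ q) p j * ?F g p j)"
    by (simp only: orthogonal_isometry[OF assms])
  also have "\<dots> = (\<Sum>p\<in>UNIV. \<Sum>j\<in>UNIV. ?F (\<lambda>p q. B $ p $ q) p j * ?F g p j)"
    by (rule sum.swap)
  also have "\<dots> = (\<Sum>p\<in>UNIV. \<Sum>q\<in>UNIV. B $ p $ q * g p q)"
    by (simp only: orthogonal_isometry[OF assms])
  finally show ?thesis .
qed

lemma covariant_contract:
  assumes "orthogonal_matrix Q" "covariant Q (Suc k) T T'"
  shows "covariant Q k (contract B T) (contract (Q ** B ** transpose Q) T')"
  unfolding covariant_def
proof (intro ballI)
  fix I J :: "'a list" assume IJ: "I \<in> nlists k" "J \<in> nlists k"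
  define g where "g p q = (\<Sum>K\<in>nlists k. \<Sum>L\<in>nlists k. tensor_pow Q I K * (tensor_pow Q J L * T (p # K) (q # L)))" for p q
  have "T' (i # I) (j # J) = (\<Sum>p\<in>UNIV. \<Sum>q\<in>UNIV. Q $ i $ p * (Q $ j $ q * g p q))" for i j
  proof -
    have "T' (i # I) (j # J) = (\<Sum>p\<in>UNIV. \<Sum>K\<in>nlists k. \<Sum>q\<in>UNIV. \<Sum>L\<in>nlists k.
       tensor_pow Q (i # I) (p # K) * (tensor_pow Q (j # J) (q # L) * T (p # K) (q # L)))"
      using covariantD[OF assms(2), of "i # I" "j # J"] IJ by (simp only: sum_nlists_Suc) simp
    also have "\<dots> = (\<Sum>p\<in>UNIV. \<Sum>q\<in>UNIV. \<Sum>K\<in>nlists k. \<Sum>L\<in>nlists k.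
       tensor_pow Q (i # I) (p # K) * (tensor_pow Q (j # J) (q # L) * T (p # K) (q # L)))"
      by (intro sum.cong refl sum.swap)
    finally show ?thesis unfolding g_def sum_distrib_left tensor_pow_Cons by (simp only: mult_ac)
  qed
  then have "contract (Q ** B ** transpose Q) T' I J = (\<Sum>p\<in>UNIV. \<Sum>q\<in>UNIV. B $ p $ q * g p q)"
    unfolding contract_def by (simp only: orthogonal_isometry2[OF assms(1)])
  also have "\<dots> = (\<Sum>p\<in>UNIV. \<Sum>K\<in>nlists k. \<Sum>q\<in>UNIV. \<Sum>L\<in>nlists k. B $ p $ q * (tensor_pow Q I K * (tensor_pow Q J L * T (p # K) (q # L))))"
    unfolding g_def sum_distrib_left by (intro sum.cong refl sum.swap)
  also have "\<dots> = (\<Sum>K\<in>nlists k. \<Sum>p\<in>UNIV. \<Sum>L\<in>nlists k. \<Sum>q\<in>UNIV. B $ p $ q * (tensor_pow Q I K * (tensor_pow Q J L * T (p # K) (q # L))))"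
    by (subst sum.swap) (intro sum.cong refl sum.swap)
  also have "\<dots> = (\<Sum>K\<in>nlists k. \<Sum>L\<in>nlists k. \<Sum>p\<in>UNIV. \<Sum>q\<in>UNIV. B $ p $ q * (tensor_pow Q I K * (tensor_pow Q J L * T (p # K) (q # L))))"
    by (intro sum.cong refl sum.swap)
  also have "\<dots> = (\<Sum>K\<in>nlists k. \<Sum>L\<in>nlists k. tensor_pow Q I K * (tensor_pow Q J L * contract B T K L))"
    unfolding contract_def sum_distrib_left by (intro sum.cong refl) (simp only: mult_ac)
  finally show "contract (Q ** B ** transpose Q) T' I J =
    (\<Sum>K\<in>nlists k. \<Sum>L\<in>nlists k. tensor_pow Q I K * (tensor_pow Q J L * contract B T K L))" .
qed

text \<open>The partial trace over \<open>r\<close> slots of the exterior power of degree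
  \<open>length I + r\<close>. The divisors multiply up to \<open>fact r\<close>, the number of
  orderings of the traced indices, so on empty lists this is the sum of the principal minors of size
  \<open>r\<close>.\<close>

primrec traced_minor :: "real^'n^'n \<Rightarrow> nat \<Rightarrow> 'n list \<Rightarrow> 'n list \<Rightarrow> real" where
  "traced_minor X 0 = minor X"
| "traced_minor X (Suc r) = (\<lambda>I J. (\<Sum>u\<in>UNIV. traced_minor X r (u # I) (u # J)) / real (Suc r))"

lemma contract_mat_1: "contract (mat 1 :: real^'n^'n) T I J = (\<Sum>u\<in>UNIV. T (u # I) (u # J))"
  by (simp add: contract_def mat_def if_distrib[of "\<lambda>c. c * _"] cong: if_cong)

lemma covariant_scale: "covariant Q k T T' \<Longrightarrow> covariant Q k (\<lambda>I J. T I J / c) (\<lambda>I J. T' I J / c)"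
  unfolding covariant_def by (simp add: sum_divide_distrib)

lemma covariant_traced_minor:
  assumes "orthogonal_matrix Q"
  shows "covariant Q k (traced_minor X r) (traced_minor (Q ** X ** transpose Q) r)"
proof (induction r arbitrary: k)
  case 0
  then show ?case by (simp add: covariant_minor)
next
  case (Suc r)
  have "Q ** mat 1 ** transpose Q = mat 1"
    using assms by (simp add: orthogonal_matrix_def)
  then have "covariant Q k (contract (mat 1) (traced_minor X r)) (contract (mat 1) (traced_minor (Q ** X ** transpose Q) r))"
    using covariant_contract[OF assms Suc, where B = "mat 1"] by simp
  from covariant_scale[OF this, of "real (Suc r)"] show ?case by (simp add: contract_mat_1)
qed

lemma traced_minor_transpose:
  "length I = length J \<Longrightarrow> traced_minor (transpose X) r I J = traced_minor X r J I"
  by (induction r arbitrary: I J) (simp_all add: minor_transpose)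

lemma traced_minor_polynomial:
  assumes "\<And>i j. real_polynomial_function (\<lambda>X. f X $ i $ j)"
  shows "real_polynomial_function (\<lambda>X. traced_minor (f X) r I J)"
proof (induction r arbitrary: I J)
  case 0
  have "finite {\<pi>. \<pi> permutes {..<length I}}" by (rule finite_permutations) simp
  then show ?case unfolding traced_minor.simps minor_def
    by (intro real_polynomial_function_sum real_polynomial_function.intros(2,4) real_polynomial_function_prod assms) auto
next
  case (Suc r)
  show ?case unfolding traced_minor.simps divide_inverse
    by (intro real_polynomial_function.intros(2,4) real_polynomial_function_sum Suc) auto
qed

text \<open>Adjacent swaps generate all reorderings. The length condition reflects that
  \<open>minor\<close> reads its size off the first list: swapping columns across that size need not
  change the sign.\<close>

definition alternating :: "('a list \<Rightarrow> 'a list \<Rightarrow> real) \<Rightarrow> bool" where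
  "alternating T \<longleftrightarrow> (\<forall>P x y Q J. length J = Suc (Suc (length P + length Q)) \<longrightarrow>
     T (P @ x # y # Q) J = - T (P @ y # x # Q) J \<and> T J (P @ x # y # Q) = - T J (P @ y # x # Q))"

text \<open>Composing the permutations with the transposition \<open>p\<close> and reindexing each
  product by \<open>p\<close> leaves nothing but the sign of \<open>p\<close>.\<close>

lemma minor_swap:
  fixes X :: "real^'n^'n"
  shows "minor X (P @ x # y # Q) J = - minor X (P @ y # x # Q) J"
proof -
  define a where "a = length P"
  define n where "n = Suc (Suc (length P + length Q))"
  define p where "p = Transposition.transpose a (Suc a)"
  let ?I = "P @ x # y # Q" and ?I' = "P @ y # x # Q"
  have p: "p permutes {..<n}" unfolding p_def by (rule permutes_swap_id) (auto simp: a_def n_def)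
  have sp: "sign p = -1" unfolding p_def by (simp add: sign_swap_id)
  have I': "?I' ! b = ?I ! p b" for b
    by (auto simp: p_def a_def Transposition.transpose_def nth_append nth_Cons')
  have "minor X ?I' J = (\<Sum>\<pi> | \<pi> permutes {..<n}. of_int (sign \<pi>) * (\<Prod>b<n. X $ (?I ! p b) $ (J ! \<pi> b)))"
    unfolding minor_def I' by (simp add: n_def)
  also have "\<dots> = (\<Sum>\<pi> | \<pi> permutes {..<n}. of_int (sign (\<pi> \<circ> p)) * (\<Prod>b<n. X $ (?I ! p b) $ (J ! (\<pi> \<circ> p) b)))"
    by (rule sum_permutations_compose_right[OF p])
  also have "\<dots> = (\<Sum>\<pi> | \<pi> permutes {..<n}. - (of_int (sign \<pi>) * (\<Prod>b<n. X $ (?I ! b) $ (J ! \<pi> b))))"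
  proof (intro sum.cong refl)
    fix \<pi> assume "\<pi> \<in> {\<pi>. \<pi> permutes {..<n}}"
    then have q: "\<pi> permutes {..<n}" by simp
    have "permutation \<pi>" "permutation p" using p q permutation_permutes by blast+
    then have "sign (\<pi> \<circ> p) = - sign \<pi>" using sp by (simp add: sign_compose)
    moreover have "(\<Prod>b<n. X $ (?I ! p b) $ (J ! (\<pi> \<circ> p) b)) = (\<Prod>b<n. X $ (?I ! b) $ (J ! \<pi> b))"
      by (subst (2) prod.permute[OF p]) (simp add: comp_def)
    ultimately show "of_int (sign (\<pi> \<circ> p)) * (\<Prod>b<n. X $ (?I ! p b) $ (J ! (\<pi> \<circ> p) b)) =
       - (of_int (sign \<pi>) * (\<Prod>b<n. X $ (?I ! b) $ (J ! \<pi> b)))" by simp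
  qed
  also have "\<dots> = - minor X ?I J"
    unfolding minor_def by (simp add: sum_negf n_def)
  finally show ?thesis by simp
qed

lemma alternating_minor: "alternating (minor X)"
  unfolding alternating_def
proof (intro allI impI conjI)
  fix P Q J :: "'a list" and x y assume J: "length J = Suc (Suc (length P + length Q))"
  show "minor X (P @ x # y # Q) J = - minor X (P @ y # x # Q) J" by (rule minor_swap)
  show "minor X J (P @ x # y # Q) = - minor X J (P @ y # x # Q)"
    using J minor_transpose[of "P @ x # y # Q" J X] minor_transpose[of "P @ y # x # Q" J X]
      minor_swap[of "transpose X" P x y Q J] by simp
qed

lemma alternating_traced_minor: "alternating (traced_minor X r)"
proof (induction r)
  case 0
  then show ?case by (simp add: alternating_minor)
next
  case (Suc r)
  have *: "traced_minor X r (u # P @ x # y # Q) (u # J) = - traced_minor X r (u # P @ y # x # Q) (u # J)"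
     "traced_minor X r (u # J) (u # P @ x # y # Q) = - traced_minor X r (u # J) (u # P @ y # x # Q)"
    if "length J = Suc (Suc (length P + length Q))" for u P x y Q J
    using Suc[unfolded alternating_def, rule_format, of "u # J" "u # P" Q x y] that by simp_all
  show ?case
    unfolding alternating_def
  proof (intro allI impI)
    fix P Q J :: "'a list" and x y
    assume J: "length J = Suc (Suc (length P + length Q))"
    have "(\<Sum>u\<in>UNIV. traced_minor X r (u # P @ x # y # Q) (u # J)) = (\<Sum>u\<in>UNIV. - traced_minor X r (u # P @ y # x # Q) (u # J))"
      "(\<Sum>u\<in>UNIV. traced_minor X r (u # J) (u # P @ x # y # Q)) = (\<Sum>u\<in>UNIV. - traced_minor X r (u # J) (u # P @ y # x # Q))"
      using *[OF J] by (intro sum.cong refl; blast)+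
    then show "traced_minor X (Suc r) (P @ x # y # Q) J = - traced_minor X (Suc r) (P @ y # x # Q) J \<and>
      traced_minor X (Suc r) J (P @ x # y # Q) = - traced_minor X (Suc r) J (P @ y # x # Q)"
      by (simp only: traced_minor.simps sum_negf minus_divide_left)
  qed
qed

section \<open>Minors of diagonal matrices and reordering of indices\<close>

lemma minor_diag_eq_0:
  assumes "length I = length J" "mset I \<noteq> mset J"
  shows "minor (\<chi> i j. if i = j then x i else 0) I J = 0"
  unfolding minor_def
proof (intro sum.neutral ballI)
  fix \<pi> assume "\<pi> \<in> {\<pi>. \<pi> permutes {..<length I}}"
  then have p: "\<pi> permutes {..<length J}" using assms by simp
  have "I \<noteq> permute_list \<pi> J" using assms mset_permute_list[OF p] by metis
  then obtain a where a: "a < length I" "I ! a \<noteq> J ! \<pi> a"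
    using assms p by (auto simp: list_eq_iff_nth_eq permute_list_nth)
  then have "(\<Prod>a<length I. (\<chi> i j. if i = j then x i else 0) $ (I ! a) $ (J ! \<pi> a)) = 0"
    by (intro prod_zero) auto
  then show "of_int (sign \<pi>) * (\<Prod>a<length I. (\<chi> i j. if i = j then x i else 0) $ (I ! a) $ (J ! \<pi> a)) = 0"
    by simp
qed

lemma minor_diag:
  assumes "distinct I"
  shows "minor (\<chi> i j. if i = j then x i else 0) I I = (\<Prod>i\<in>set I. x i)"
proof -
  let ?n = "length I" and ?X = "\<chi> i j. if i = j then x i else 0"
  let ?f = "\<lambda>\<pi>. of_int (sign \<pi>) * (\<Prod>a<?n. ?X $ (I ! a) $ (I ! \<pi> a)) :: real"
  have "minor ?X I I = sum ?f {id}"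
    unfolding minor_def
  proof (rule sum.mono_neutral_right)
    show "\<forall>\<pi>\<in>{\<pi>. \<pi> permutes {..<?n}} - {id}. ?f \<pi> = 0"
    proof
      fix \<pi> assume "\<pi> \<in> {\<pi>. \<pi> permutes {..<?n}} - {id}"
      then have p: "\<pi> permutes {..<?n}" "\<pi> \<noteq> id" by auto
      then obtain a where a: "\<pi> a \<noteq> a" by (auto simp: fun_eq_iff)
      then have "a < ?n" "\<pi> a < ?n" using p permutes_not_in[of \<pi> "{..<?n}" a] permutes_in_image[of \<pi> "{..<?n}" a] by auto
      then have "I ! a \<noteq> I ! \<pi> a" using a assms nth_eq_iff_index_eq by metis
      then show "?f \<pi> = 0" using \<open>a < ?n\<close> by (auto intro!: prod_zero)
    qed
  qed (auto simp: finite_permutations permutes_id)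
  also have "\<dots> = (\<Prod>a<?n. x (I ! a))" by (simp add: sign_id)
  also have "\<dots> = (\<Prod>i\<in>set I. x i)"
    using assms by (intro prod.reindex_bij_betw bij_betw_nth) auto
  finally show ?thesis .
qed

lemma alternating_move:
  assumes "alternating T" "length J = length P + Suc (length B + length C)"
  shows "T (P @ x # B @ C) J = (- 1) ^ length B * T (P @ B @ x # C) J"
    and "T J (P @ x # B @ C) = (- 1) ^ length B * T J (P @ B @ x # C)"
proof -
  have "T (P @ x # B @ C) J = (- 1) ^ length B * T (P @ B @ x # C) J \<and>
     T J (P @ x # B @ C) = (- 1) ^ length B * T J (P @ B @ x # C)"
    using assms(2)
  proof (induction B arbitrary: P)
    case (Cons b B)
    show ?case
      using assms(1)[unfolded alternating_def, rule_format, of J P "B @ C" x b] Cons.IH[of "P @ [b]"] Cons.prems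
      by simp
  qed simp
  then show "T (P @ x # B @ C) J = (- 1) ^ length B * T (P @ B @ x # C) J"
    and "T J (P @ x # B @ C) = (- 1) ^ length B * T J (P @ B @ x # C)" by auto
qed

text \<open>The sign is chosen before \<open>T\<close>, \<open>P\<close> and \<open>J\<close>, so it
  is the same for rows and columns and for different tensors. Signs always meet in pairs later,
  hence \<open>\<epsilon> * \<epsilon> = 1\<close> is all that is recorded of it.\<close>

lemma alternating_perm:
  assumes "mset I = mset I'"
  shows "\<exists>\<epsilon>. \<epsilon> * \<epsilon> = 1 \<and> (\<forall>T P J. alternating T \<longrightarrow> length J = length P + length I \<longrightarrow>
     T (P @ I) J = \<epsilon> * T (P @ I') J \<and> T J (P @ I) = \<epsilon> * T J (P @ I'))"
  using assms
proof (induction I arbitrary: I')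
  case Nil
  then show ?case by (intro exI[of _ 1]) auto
next
  case (Cons x I)
  then have "x \<in> set I'" by (metis list.set_intros(1) set_mset_mset)
  then obtain B C where I': "I' = B @ x # C" by (meson split_list)
  have m: "mset I = mset (B @ C)" using Cons.prems I' by simp
  then have len: "length I = length B + length C" by (metis length_append mset_eq_length)
  obtain \<epsilon> where e: "\<epsilon> * \<epsilon> = 1" "\<And>T P J. alternating T \<Longrightarrow> length J = length P + length I \<Longrightarrow>
     T (P @ I) J = \<epsilon> * T (P @ B @ C) J \<and> T J (P @ I) = \<epsilon> * T J (P @ B @ C)"
    using Cons.IH[OF m] by blast
  show ?case
  proof (intro exI[of _ "(- 1) ^ length B * \<epsilon>"] conjI allI impI)
    have "(- 1) ^ length B * \<epsilon> * ((- 1) ^ length B * \<epsilon>) = ((- 1) ^ length B * (- 1) ^ length B) * (\<epsilon> * \<epsilon>)"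
      by (simp add: mult_ac)
    then show "(- 1) ^ length B * \<epsilon> * ((- 1) ^ length B * \<epsilon>) = 1"
      using e by (simp flip: power_mult_distrib)
    fix T :: "'a list \<Rightarrow> 'a list \<Rightarrow> real" and P J :: "'a list"
    assume T: "alternating T" and J: "length J = length P + length (x # I)"
    have 2: "T ((P @ [x]) @ I) J = \<epsilon> * T ((P @ [x]) @ B @ C) J \<and> T J ((P @ [x]) @ I) = \<epsilon> * T J ((P @ [x]) @ B @ C)"
      using J by (intro e(2) T) simp
    show "T (P @ x # I) J = (- 1) ^ length B * \<epsilon> * T (P @ I') J"
      using alternating_move(1)[OF T, of J P B C x] 2 J len by (simp add: I')
    show "T J (P @ x # I) = (- 1) ^ length B * \<epsilon> * T J (P @ I')"
      using alternating_move(2)[OF T, of J P B C x] 2 J len by (simp add: I')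
  qed
qed

lemma alternating_not_distinct:
  assumes "alternating T" "\<not> distinct I" "length J = length I"
  shows "T I J = 0 \<and> T J I = 0"
proof -
  obtain A B C x where I: "I = A @ [x] @ B @ [x] @ C" using assms not_distinct_decomp by blast
  define I' where "I' = x # x # A @ B @ C"
  have m: "mset I = mset I'" by (simp add: I I'_def)
  obtain \<epsilon> where e: "\<And>T P J. alternating T \<Longrightarrow> length J = length P + length I \<Longrightarrow>
     T (P @ I) J = \<epsilon> * T (P @ I') J \<and> T J (P @ I) = \<epsilon> * T J (P @ I')"
    using alternating_perm[OF m] by blast
  have "T I' J = - T I' J \<and> T J I' = - T J I'"
    using assms(1)[unfolded alternating_def, rule_format, of J "[]" "A @ B @ C" x x] assms(3) by (simp add: I I'_def)
  then show ?thesis using e[OF assms(1), of J "[]"] assms(3) by auto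
qed

lemma traced_minor_diag_eq_0:
  "length I = length J \<Longrightarrow> mset I \<noteq> mset J \<Longrightarrow> traced_minor (\<chi> i j. if i = j then x i else 0) r I J = 0"
  by (induction r arbitrary: I J) (simp_all add: minor_diag_eq_0)

text \<open>A traced index that already occurs in \<open>I\<close> contributes nothing by
  alternation. The others are summed by Euler's identity, whose factor cancels the divisor in
  \<open>traced_minor\<close>.\<close>

lemma traced_minor_diag:
  assumes "distinct I"
  shows "traced_minor (\<chi> i j. if i = j then x i else 0) r I I = (\<Prod>i\<in>set I. x i) * esym (- set I) r x"
  using assms
proof (induction r arbitrary: I)
  case 0
  then show ?case by (simp add: minor_diag)
next
  case (Suc r)
  let ?X = "\<chi> i j. if i = j then x i else 0"
  have "traced_minor ?X r (u # I) (u # I) = (if u \<in> - set I then (\<Prod>i\<in>set I. x i) * (x u * esym (- set I - {u}) r x) else 0)" for u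
  proof (cases "u \<in> set I")
    case True
    then show ?thesis using alternating_not_distinct[OF alternating_traced_minor, of "u # I" "u # I"] by simp
  next
    case False
    then show ?thesis using Suc.IH[of "u # I"] Suc.prems by (simp add: mult_ac Compl_insert)
  qed
  then have "(\<Sum>u\<in>UNIV. traced_minor ?X r (u # I) (u # I)) =
     (\<Sum>u\<in>- set I. (\<Prod>i\<in>set I. x i) * (x u * esym (- set I - {u}) r x))"
    by (simp add: sum.If_cases Compl_eq)
  also have "\<dots> = (\<Prod>i\<in>set I. x i) * (real (Suc r) * esym (- set I) (Suc r) x)"
    unfolding sum_distrib_left[symmetric] by (subst sum_esym_remove) simp_all
  finally have S: "(\<Sum>u\<in>UNIV. traced_minor ?X r (u # I) (u # I)) =
     (\<Prod>i\<in>set I. x i) * (real (Suc r) * esym (- set I) (Suc r) x)" .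
  show ?case unfolding traced_minor.simps S by (simp del: of_nat_Suc)
qed

section \<open>The tensor energy of a diagonal matrix\<close>

text \<open>Tensors are indexed by lists instead of sets, whence the divisions by \<open>(k!)\<^sup>2\<close>. The factor
  \<open>real k\<close> in \<open>tleft\<close> also removes the junk value of \<^const>\<open>hd\<close> for \<open>k = 0\<close>.\<close>

definition tnorm :: "(nat \<Rightarrow> 'n::finite list \<Rightarrow> 'n list \<Rightarrow> real) \<Rightarrow> nat \<Rightarrow> real" where
  "tnorm T k = (\<Sum>I\<in>nlists k. \<Sum>J\<in>nlists k. T k I J * T k I J) / (fact k)\<^sup>2"

definition tleft :: "real^'n^'n \<Rightarrow> (nat \<Rightarrow> 'n list \<Rightarrow> 'n list \<Rightarrow> real) \<Rightarrow> nat \<Rightarrow> real" where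
  "tleft A T k = real k * (\<Sum>I\<in>nlists k. \<Sum>J\<in>nlists k. T k I J * insert_left A (T k) I J) / (fact k)\<^sup>2"

definition tcross :: "real^'n^'n \<Rightarrow> (nat \<Rightarrow> 'n list \<Rightarrow> 'n list \<Rightarrow> real) \<Rightarrow> nat \<Rightarrow> real" where
  "tcross A T k = (\<Sum>I\<in>nlists k. \<Sum>J\<in>nlists k. T k I J * contract A (T (Suc k)) I J) / (fact k)\<^sup>2"

text \<open>The diagonal \<open>energy\<close> with its squares expanded into invariant pieces. The
  trace minus the left action collects the \<open>a i\<close> outside a set. The square at the far
  end of an edge is booked at that far vertex, one level deeper, hence
  \<open>coef d (k - 1)\<close>. At \<open>k = 0\<close> the truncation is harmless, as
  \<open>tleft\<close> vanishes.\<close>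

definition tenergy :: "nat \<Rightarrow> real^'n^'n \<Rightarrow> (nat \<Rightarrow> 'n list \<Rightarrow> 'n list \<Rightarrow> real) \<Rightarrow> real" where
  "tenergy d A T = (\<Sum>k\<le>d. coef d k * (trace A * tnorm T k - tleft A T k - 2 * tcross A T k)
     + coef d (k - 1) * tleft A T k)"

text \<open>Tracing out \<open>d - k\<close> slots of the exterior power of degree \<open>d\<close>
  leaves \<open>k\<close> slots. Beyond \<open>d\<close> the truncated difference would produce
  untraced minors, so the value zero is set explicitly.\<close>

definition potential :: "nat \<Rightarrow> real^'n^'n \<Rightarrow> nat \<Rightarrow> 'n list \<Rightarrow> 'n list \<Rightarrow> real" where
  "potential d X k = (if k \<le> d then traced_minor X (d - k) else (\<lambda>I J. 0))"

lemma covariant_potential: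
  assumes "orthogonal_matrix Q"
  shows "covariant Q k (potential d X k) (potential d (Q ** X ** transpose Q) k)"
  using covariant_traced_minor[OF assms] by (simp add: potential_def covariant_def)

lemma alternating_potential: "alternating (potential d X k)"
  by (cases "k \<le> d") (simp_all add: potential_def alternating_traced_minor, simp add: alternating_def)

lemma tenergy_conj:
  fixes Q :: "real^'n^'n"
  assumes Q: "orthogonal_matrix Q"
  shows "tenergy d (Q ** A ** transpose Q) (potential d (Q ** X ** transpose Q)) = tenergy d A (potential d X)"
proof -
  have "trace (Q ** A ** transpose Q) = trace (transpose Q ** (Q ** A))" by (rule trace_mul_sym)
  also have "\<dots> = trace A" using Q by (simp add: matrix_mul_assoc orthogonal_matrix)
  finally have "trace (Q ** A ** transpose Q) = trace A" .
  moreover have "tnorm (potential d (Q ** X ** transpose Q)) k = tnorm (potential d X) k" for k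
    unfolding tnorm_def by (simp only: covariant_pairing[OF Q covariant_potential[OF Q] covariant_potential[OF Q]])
  moreover have "tcross (Q ** A ** transpose Q) (potential d (Q ** X ** transpose Q)) k = tcross A (potential d X) k" for k
    unfolding tcross_def
    by (simp only: covariant_pairing[OF Q covariant_potential[OF Q] covariant_contract[OF Q covariant_potential[OF Q]]])
  moreover have "tleft (Q ** A ** transpose Q) (potential d (Q ** X ** transpose Q)) k = tleft A (potential d X) k" for k
  proof (cases k)
    case (Suc j)
    show ?thesis unfolding tleft_def Suc
      by (simp only: covariant_pairing[OF Q covariant_potential[OF Q] covariant_insert_left[OF Q covariant_potential[OF Q]]])
  qed (simp add: tleft_def)
  ultimately show ?thesis unfolding tenergy_def by simp
qed

section \<open>From sums over lists to sums over sets\<close>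

definition listing :: "'n set \<Rightarrow> 'n list" where
  "listing S = (SOME xs. distinct xs \<and> set xs = S)"

lemma listing:
  assumes "finite S"
  shows "distinct (listing S)" "set (listing S) = S" "length (listing S) = card S"
proof -
  have "distinct (listing S) \<and> set (listing S) = S"
    unfolding listing_def using finite_distinct_list[OF assms]
    by (intro someI_ex[of "\<lambda>xs. distinct xs \<and> set xs = S"]) blast
  then show "distinct (listing S)" "set (listing S) = S" "length (listing S) = card S"
    using distinct_card[of "listing S"] by auto
qed

text \<open>Each element of a set of size \<open>Suc k\<close> heads \<open>fact k\<close> of its
  orderings. With the unweighted count as a hypothesis, the lemma serves both as the induction step
  of that count, for constant weight, and for the weights \<open>a\<close> in
  \<open>tleft_sets\<close>.\<close>

lemma sum_distinct_nlists_aux: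
  fixes G :: "'n::finite set \<Rightarrow> real" and \<phi> :: "'n \<Rightarrow> real"
  assumes "\<And>H :: 'n set \<Rightarrow> real. (\<Sum>I\<in>nlists k. if distinct I then H (set I) else 0) = fact k * (\<Sum>S | card S = k. H S)"
  shows "(\<Sum>I\<in>nlists (Suc k). \<phi> (hd I) * (if distinct I then G (set I) else 0)) =
    fact k * (\<Sum>S | card S = Suc k. (\<Sum>i\<in>S. \<phi> i) * G S)"
proof -
  have "(\<Sum>I\<in>nlists k. if distinct (i # I) then G (set (i # I)) else 0) =
     fact k * (\<Sum>S\<in>Pow (UNIV - {i}). if card (insert i S) = Suc k then G (insert i S) else 0)" for i
  proof -
    have "(\<Sum>I\<in>nlists k. if distinct (i # I) then G (set (i # I)) else 0) =
       (\<Sum>I\<in>nlists k. if distinct I then (if i \<notin> set I then G (insert i (set I)) else 0) else 0)"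
      by (intro sum.cong refl) auto
    also have "\<dots> = fact k * (\<Sum>S | card S = k. if i \<notin> S then G (insert i S) else 0)"
      by (rule assms)
    also have "(\<Sum>S | card S = k. if i \<notin> S then G (insert i S) else 0) =
       (\<Sum>S\<in>{S. card S = k \<and> i \<notin> S}. G (insert i S))"
      by (intro sum.mono_neutral_cong_right) auto
    also have "\<dots> = (\<Sum>S\<in>Pow (UNIV - {i}). if card (insert i S) = Suc k then G (insert i S) else 0)"
      by (intro sum.mono_neutral_cong_left) (auto simp: card_insert_if)
    finally show ?thesis .
  qed
  then have "(\<Sum>I\<in>nlists (Suc k). \<phi> (hd I) * (if distinct I then G (set I) else 0)) =
    (\<Sum>i\<in>UNIV. \<phi> i * (fact k * (\<Sum>S\<in>Pow (UNIV - {i}). if card (insert i S) = Suc k then G (insert i S) else 0)))"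
    unfolding sum_nlists_Suc list.sel sum_distrib_left[symmetric] by (simp only:)
  also have "\<dots> = fact k * (\<Sum>i\<in>UNIV. \<Sum>S\<in>Pow (UNIV - {i}). if card (insert i S) = Suc k then \<phi> i * G (insert i S) else 0)"
    unfolding sum_distrib_left by (intro sum.cong refl) auto
  also have "(\<Sum>i\<in>UNIV. \<Sum>S\<in>Pow (UNIV - {i}). if card (insert i S) = Suc k then \<phi> i * G (insert i S) else 0) =
     (\<Sum>S\<in>Pow UNIV. \<Sum>i\<in>S. if card S = Suc k then \<phi> i * G S else 0)"
    by (rule sum_remove_subsets) simp
  also have "\<dots> = (\<Sum>S | card S = Suc k. (\<Sum>i\<in>S. \<phi> i) * G S)"
    by (intro sum.mono_neutral_cong_right) (auto simp: sum_distrib_right)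
  finally show ?thesis .
qed

lemma sum_distinct_nlists:
  fixes G :: "'n::finite set \<Rightarrow> real"
  shows "(\<Sum>I\<in>nlists k. if distinct I then G (set I) else 0) = fact k * (\<Sum>S | card S = k. G S)"
proof (induction k arbitrary: G)
  case 0
  have "{S :: 'n set. card S = 0} = {{}}" by auto
  then show ?case by simp
next
  case (Suc k)
  have "(\<Sum>I\<in>nlists (Suc k). if distinct I then G (set I) else 0) = fact k * (\<Sum>S | card S = Suc k. (\<Sum>i\<in>S. 1) * G S)"
    using sum_distinct_nlists_aux[of k "\<lambda>_. 1" G] Suc.IH by simp
  also have "\<dots> = fact k * (\<Sum>S | card S = Suc k. real (Suc k) * G S)"
    by simp
  also have "\<dots> = fact k * (real (Suc k) * (\<Sum>S | card S = Suc k. G S))"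
    by (simp only: sum_distrib_left)
  finally show ?case by (simp add: mult_ac del: of_nat_Suc)
qed

lemmas sum_distinct_nlists_weighted = sum_distinct_nlists_aux[OF sum_distinct_nlists]

lemma sum_distinct_nlists2:
  fixes H :: "'n::finite set \<Rightarrow> 'n set \<Rightarrow> real"
  shows "(\<Sum>I\<in>nlists k. \<Sum>J\<in>nlists k. if distinct I \<and> distinct J then H (set I) (set J) else 0) =
    (fact k)\<^sup>2 * (\<Sum>S | card S = k. \<Sum>S' | card S' = k. H S S')"
proof -
  have "(\<Sum>I\<in>nlists k. \<Sum>J\<in>nlists k. if distinct I \<and> distinct J then H (set I) (set J) else 0) =
     (\<Sum>I\<in>nlists k. if distinct I then (\<Sum>J\<in>nlists k. if distinct J then H (set I) (set J) else 0) else 0)"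
    by (intro sum.cong refl) auto
  also have "\<dots> = (\<Sum>I\<in>nlists k. if distinct I then fact k * (\<Sum>S' | card S' = k. H (set I) S') else 0)"
    by (simp only: sum_distinct_nlists)
  also have "\<dots> = fact k * (\<Sum>S | card S = k. fact k * (\<Sum>S' | card S' = k. H S S'))"
    by (rule sum_distinct_nlists)
  finally show ?thesis by (simp add: sum_distrib_left power2_eq_square mult.assoc)
qed

text \<open>Reordering gives both factors the same signs. The prefixes make room for a contracted
  index.\<close>

lemma alternating_pair:
  assumes "alternating T" "alternating U" "mset I = mset I'" "mset J = mset J'"
    and "length I = length J" "length P = length P'" "length R = length R'"
  shows "T (P @ I) (P' @ J) * U (R @ I) (R' @ J) = T (P @ I') (P' @ J') * U (R @ I') (R' @ J')"
proof -
  obtain \<epsilon> where e: "\<epsilon> * \<epsilon> = 1" "\<And>T P J. alternating T \<Longrightarrow> length J = length P + length I \<Longrightarrow>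
     T (P @ I) J = \<epsilon> * T (P @ I') J \<and> T J (P @ I) = \<epsilon> * T J (P @ I')"
    using alternating_perm[OF assms(3)] by blast
  obtain \<delta> where d: "\<delta> * \<delta> = 1" "\<And>T P I. alternating T \<Longrightarrow> length I = length P + length J \<Longrightarrow>
     T (P @ J) I = \<delta> * T (P @ J') I \<and> T I (P @ J) = \<delta> * T I (P @ J')"
    using alternating_perm[OF assms(4)] by blast
  have l: "length I' = length I" "length J' = length J" using assms(3,4) mset_eq_length by metis+
  have "T (P @ I) (P' @ J) = \<epsilon> * (\<delta> * T (P @ I') (P' @ J'))"
    using e(2)[OF assms(1), of "P' @ J" P] d(2)[OF assms(1), of "P @ I'" P'] assms l by simp
  moreover have "U (R @ I) (R' @ J) = \<epsilon> * (\<delta> * U (R @ I') (R' @ J'))"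
    using e(2)[OF assms(2), of "R' @ J" R] d(2)[OF assms(2), of "R @ I'" R'] assms l by simp
  ultimately have "T (P @ I) (P' @ J) * U (R @ I) (R' @ J) =
     (\<epsilon> * \<epsilon>) * (\<delta> * \<delta>) * (T (P @ I') (P' @ J') * U (R @ I') (R' @ J'))" by (simp only: mult_ac)
  then show ?thesis using e d by simp
qed

lemma mset_listing: "distinct I \<Longrightarrow> mset I = mset (listing (set I))"
  using listing[of "set I"] set_eq_iff_mset_eq_distinct by force

lemma sum_alternating:
  fixes f :: "'n::finite list \<Rightarrow> 'n list \<Rightarrow> real"
  assumes "\<And>I J. length I = k \<Longrightarrow> length J = k \<Longrightarrow> f I J = (if distinct I \<and> distinct J then f (listing (set I)) (listing (set J)) else 0)"
  shows "(\<Sum>I\<in>nlists k. \<Sum>J\<in>nlists k. f I J) / (fact k)\<^sup>2 = (\<Sum>S | card S = k. \<Sum>S' | card S' = k. f (listing S) (listing S'))"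
proof -
  have "(\<Sum>I\<in>nlists k. \<Sum>J\<in>nlists k. f I J) =
      (\<Sum>I\<in>nlists k. \<Sum>J\<in>nlists k. if distinct I \<and> distinct J then f (listing (set I)) (listing (set J)) else 0)"
    using assms by (intro sum.cong refl) simp
  then show ?thesis by (simp only: sum_distinct_nlists2[where H = "\<lambda>S S'. f (listing S) (listing S')"]) simp
qed

lemma tnorm_sets:
  assumes "alternating (T k)"
  shows "tnorm T k = (\<Sum>S | card S = k. \<Sum>S' | card S' = k. (T k (listing S) (listing S'))\<^sup>2)"
  unfolding tnorm_def power2_eq_square[of "T k _ _"]
proof (rule sum_alternating)
  fix I J :: "'a list" assume IJ: "length I = k" "length J = k"
  show "T k I J * T k I J = (if distinct I \<and> distinct J
      then T k (listing (set I)) (listing (set J)) * T k (listing (set I)) (listing (set J)) else 0)"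
    using alternating_not_distinct[OF assms] IJ
      alternating_pair[OF assms assms mset_listing mset_listing, of I J "[]" "[]" "[]" "[]"] by auto
qed

abbreviation diagm :: "('n::finite \<Rightarrow> real) \<Rightarrow> real^'n^'n" where
  "diagm x \<equiv> (\<chi> i j. if i = j then x i else 0)"

lemma contract_diag: "contract (diagm a) T I J = (\<Sum>i\<in>UNIV. a i * T (i # I) (i # J))"
  by (simp add: contract_def if_distrib[of "\<lambda>c. c * _"] cong: if_cong)

lemma insert_left_diag: "I \<noteq> [] \<Longrightarrow> insert_left (diagm a) T I J = a (hd I) * T I J"
  by (simp add: insert_left_def if_distrib[of "\<lambda>c. c * _"] cong: if_cong)

lemma tcross_sets:
  assumes "alternating (T k)" "alternating (T (Suc k))"
  shows "tcross (diagm a) T k = (\<Sum>S | card S = k. \<Sum>S' | card S' = k.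
     T k (listing S) (listing S') * (\<Sum>i\<in>UNIV. a i * T (Suc k) (i # listing S) (i # listing S')))"
  unfolding tcross_def contract_diag
proof (rule sum_alternating)
  fix I J :: "'a list" assume IJ: "length I = k" "length J = k"
  show "T k I J * (\<Sum>i\<in>UNIV. a i * T (Suc k) (i # I) (i # J)) = (if distinct I \<and> distinct J
     then T k (listing (set I)) (listing (set J)) * (\<Sum>i\<in>UNIV. a i * T (Suc k) (i # listing (set I)) (i # listing (set J))) else 0)"
  proof (cases "distinct I \<and> distinct J")
    case True
    have "T k I J * T (Suc k) (i # I) (i # J) =
        T k (listing (set I)) (listing (set J)) * T (Suc k) (i # listing (set I)) (i # listing (set J))" for i
      using alternating_pair[OF assms mset_listing mset_listing, of I J "[]" "[]" "[i]" "[i]"] True IJ by simp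
    then have "T k I J * (\<Sum>i\<in>UNIV. a i * T (Suc k) (i # I) (i # J)) =
       T k (listing (set I)) (listing (set J)) * (\<Sum>i\<in>UNIV. a i * T (Suc k) (i # listing (set I)) (i # listing (set J)))"
      unfolding sum_distrib_left mult.left_commute[of "T k _ _"] by simp
    then show ?thesis using True by simp
  next
    case False
    then have "T k I J = 0" using alternating_not_distinct[OF assms(1)] IJ by auto
    then show ?thesis using False by auto
  qed
qed

text \<open>The orderings of a set with prescribed head number \<open>fact (k - 1)\<close>; the
  factor \<open>real k\<close> in \<open>tleft\<close> completes this to
  \<open>fact k\<close>.\<close>

lemma tleft_sets:
  assumes "alternating (T k)"
  shows "tleft (diagm a) T k = (\<Sum>S | card S = k. \<Sum>S' | card S' = k. (\<Sum>i\<in>S. a i) * (T k (listing S) (listing S'))\<^sup>2)"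
proof (cases k)
  case 0
  then have "(\<Sum>i\<in>S. a i) = 0" if "card S = k" for S :: "'a set" using that by (simp add: card_eq_0_iff)
  then show ?thesis using 0 by (simp add: tleft_def)
next
  case (Suc j)
  let ?t = "\<lambda>S S'. (T k (listing S) (listing S'))\<^sup>2"
  have "T k I J * insert_left (diagm a) (T k) I J =
     a (hd I) * (if distinct I then (if distinct J then ?t (set I) (set J) else 0) else 0)"
    if "length I = k" "length J = k" for I J
  proof -
    have "T k I J * T k I J = (if distinct I then (if distinct J then ?t (set I) (set J) else 0) else 0)"
      using alternating_not_distinct[OF assms] that
        alternating_pair[OF assms assms mset_listing mset_listing, of I J "[]" "[]" "[]" "[]"] by (auto simp: power2_eq_square)
    moreover have "T k I J * insert_left (diagm a) (T k) I J = a (hd I) * (T k I J * T k I J)"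
      using that Suc by (subst insert_left_diag) auto
    ultimately show ?thesis by simp
  qed
  then have "(\<Sum>I\<in>nlists k. \<Sum>J\<in>nlists k. T k I J * insert_left (diagm a) (T k) I J) =
     (\<Sum>I\<in>nlists k. \<Sum>J\<in>nlists k. a (hd I) * (if distinct I then (if distinct J then ?t (set I) (set J) else 0) else 0))"
    by (intro sum.cong refl) simp
  also have "\<dots> = (\<Sum>I\<in>nlists k. a (hd I) * (if distinct I then (\<Sum>J\<in>nlists k. if distinct J then ?t (set I) (set J) else 0) else 0))"
    by (intro sum.cong refl) (auto simp: sum_distrib_left)
  also have "\<dots> = (\<Sum>I\<in>nlists k. a (hd I) * (if distinct I then fact k * (\<Sum>S' | card S' = k. ?t (set I) S') else 0))"
    by (simp only: sum_distinct_nlists[where G = "?t (set I)" for I])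
  also have "\<dots> = fact j * (\<Sum>S | card S = k. (\<Sum>i\<in>S. a i) * (fact k * (\<Sum>S' | card S' = k. ?t S S')))"
    unfolding Suc by (rule sum_distinct_nlists_weighted)
  also have "\<dots> = fact j * fact k * (\<Sum>S | card S = k. \<Sum>S' | card S' = k. (\<Sum>i\<in>S. a i) * ?t S S')"
    by (simp add: sum_distrib_left mult_ac)
  finally have "tleft (diagm a) T k = real k * (fact j * fact k * (\<Sum>S | card S = k. \<Sum>S' | card S' = k. (\<Sum>i\<in>S. a i) * ?t S S')) / (fact k)\<^sup>2"
    unfolding tleft_def by simp
  also have "\<dots> = (fact k * fact k) * (\<Sum>S | card S = k. \<Sum>S' | card S' = k. (\<Sum>i\<in>S. a i) * ?t S S') / (fact k)\<^sup>2"
    using Suc by (simp add: mult_ac)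
  finally show ?thesis by (simp add: power2_eq_square)
qed

section \<open>Decomposition into blocks\<close>

lemma sum_pairs_blocks:
  fixes g :: "'n::finite set \<Rightarrow> 'n set \<Rightarrow> real"
  shows "(\<Sum>(S,S') | card S = card S'. g S S') =
    (\<Sum>(E,E') | E \<inter> E' = {} \<and> card E = card E'. \<Sum>R\<in>Pow (- (E \<union> E')). g (E \<union> R) (E' \<union> R))"
proof -
  have c: "card (S - S') = card (S' - S) \<longleftrightarrow> card S = card S'" for S S' :: "'n set"
  proof -
    have "card S = card (S - S') + card (S \<inter> S')" for S S' :: "'n set"
      by (metis card_Int_Diff finite_code add.commute)
    from this[of S S'] this[of S' S] show ?thesis by (simp add: Int_commute)
  qed
  let ?B = "{(E,E'). E \<inter> E' = {} \<and> card E = card (E' :: 'n set)}"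
  have "(\<Sum>p\<in>{(S,S'). card S = card S'}. g (fst p) (snd p)) =
     (\<Sum>q\<in>(SIGMA p:?B. Pow (- (fst p \<union> snd p))). g (fst (fst q) \<union> snd q) (snd (fst q) \<union> snd q))"
  proof (rule sum.reindex_bij_witness[of _ "\<lambda>q. (fst (fst q) \<union> snd q, snd (fst q) \<union> snd q)"
        "\<lambda>p. ((fst p - snd p, snd p - fst p), fst p \<inter> snd p)"])
    fix q assume q: "q \<in> (SIGMA p:?B. Pow (- (fst p \<union> snd p)))"
    obtain E E' R where qq: "q = ((E, E'), R)" by (metis prod.exhaust)
    have d: "(E \<union> R) - (E' \<union> R) = E" "(E' \<union> R) - (E \<union> R) = E'" "(E \<union> R) \<inter> (E' \<union> R) = R"
      using q qq by auto
    show "((fst (fst (fst q) \<union> snd q, snd (fst q) \<union> snd q) - snd (fst (fst q) \<union> snd q, snd (fst q) \<union> snd q),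
       snd (fst (fst q) \<union> snd q, snd (fst q) \<union> snd q) - fst (fst (fst q) \<union> snd q, snd (fst q) \<union> snd q)),
       fst (fst (fst q) \<union> snd q, snd (fst q) \<union> snd q) \<inter> snd (fst (fst q) \<union> snd q, snd (fst q) \<union> snd q)) = q"
      unfolding qq by (simp add: d)
    show "(fst (fst q) \<union> snd q, snd (fst q) \<union> snd q) \<in> {(S,S'). card S = card S'}"
      using q c[of "E \<union> R" "E' \<union> R"] unfolding qq by (simp add: d)
  next
    fix p :: "'n set \<times> 'n set"
    have u: "(snd p - fst p) \<union> (fst p \<inter> snd p) = snd p" by blast
    assume "p \<in> {(S,S'). card S = card S'}"
    then show "((fst p - snd p, snd p - fst p), fst p \<inter> snd p) \<in> (SIGMA p:?B. Pow (- (fst p \<union> snd p)))"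
      by (auto simp: c)
    show "(fst (fst ((fst p - snd p, snd p - fst p), fst p \<inter> snd p)) \<union> snd ((fst p - snd p, snd p - fst p), fst p \<inter> snd p),
       snd (fst ((fst p - snd p, snd p - fst p), fst p \<inter> snd p)) \<union> snd ((fst p - snd p, snd p - fst p), fst p \<inter> snd p)) = p"
      by (simp add: u Un_Diff_Int)
    show "g (fst (fst ((fst p - snd p, snd p - fst p), fst p \<inter> snd p)) \<union> snd ((fst p - snd p, snd p - fst p), fst p \<inter> snd p))
       (snd (fst ((fst p - snd p, snd p - fst p), fst p \<inter> snd p)) \<union> snd ((fst p - snd p, snd p - fst p), fst p \<inter> snd p))
       = g (fst p) (snd p)"
      by (simp add: u Un_Diff_Int)
  qed
  also have "\<dots> = (\<Sum>p\<in>?B. \<Sum>R\<in>Pow (- (fst p \<union> snd p)). g (fst p \<union> R) (snd p \<union> R))"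
    by (subst sum.Sigma) (auto simp: case_prod_unfold)
  finally show ?thesis by (simp add: case_prod_unfold)
qed

text \<open>Contraction with a diagonal matrix adds one common element to both index sets, so the
  differences \<open>E\<close> and \<open>E'\<close> stay fixed while the intersection
  \<open>R\<close> varies. The ordering of \<open>R\<close> enters rows and columns alike, so its
  sign cancels.\<close>

definition block :: "nat \<Rightarrow> ('n::finite \<Rightarrow> real) \<Rightarrow> (nat \<Rightarrow> 'n list \<Rightarrow> 'n list \<Rightarrow> real) \<Rightarrow> 'n set \<Rightarrow> 'n set \<Rightarrow> 'n set \<Rightarrow> real" where
  "block d a T E E' R = T (card R + card E) (listing E @ listing R) (listing E' @ listing R)"

lemma tenergy_pairs:
  assumes "\<And>k. alternating (T k)" "\<And>k I J. k > d \<Longrightarrow> T k I J = 0"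
  shows "tenergy d (diagm a) T = (\<Sum>(S,S') | card S = card S'. let k = card S; t = T k (listing S) (listing S') in
     coef d k * (((\<Sum>i\<in>UNIV. a i) - (\<Sum>i\<in>S. a i)) * t\<^sup>2 - 2 * (t * (\<Sum>i\<in>UNIV. a i * T (Suc k) (i # listing S) (i # listing S'))))
     + coef d (k - 1) * ((\<Sum>i\<in>S. a i) * t\<^sup>2))"
proof -
  define F where "F k S S' = coef d k * (((\<Sum>i\<in>UNIV. a i) - (\<Sum>i\<in>S. a i)) * (T k (listing S) (listing S'))\<^sup>2
       - 2 * (T k (listing S) (listing S') * (\<Sum>i\<in>UNIV. a i * T (Suc k) (i # listing S) (i # listing S'))))
     + coef d (k - 1) * ((\<Sum>i\<in>S. a i) * (T k (listing S) (listing S'))\<^sup>2)" for k and S S' :: "'a set"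
  have tr: "trace (diagm a) = (\<Sum>i\<in>UNIV. a i)" by (simp add: trace_def)
  have "tenergy d (diagm a) T = (\<Sum>k\<le>d. \<Sum>S | card S = k. \<Sum>S' | card S' = k. F k S S')"
    unfolding tenergy_def tnorm_sets[OF assms(1)] tcross_sets[OF assms(1,1)] tleft_sets[OF assms(1)] tr F_def
    by (intro sum.cong refl) (simp add: sum_distrib_left sum_subtractf sum.distrib right_diff_distrib left_diff_distrib)
  also have "\<dots> = (\<Sum>k\<le>d. \<Sum>p\<in>{S. card S = k} \<times> {S'. card S' = k}. F k (fst p) (snd p))"
    by (simp add: sum.cartesian_product case_prod_unfold)
  also have "\<dots> = (\<Sum>q\<in>(SIGMA k:{..d}. {S. card S = k} \<times> {S'. card S' = k}). F (fst q) (fst (snd q)) (snd (snd q)))"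
    by (subst sum.Sigma) (auto simp: case_prod_unfold)
  also have "\<dots> = (\<Sum>p\<in>{(S,S'). card S = card S' \<and> card S \<le> d}. F (card (fst p)) (fst p) (snd p))"
    by (rule sum.reindex_bij_witness[of _ "\<lambda>p. (card (fst p), p)" snd]) auto
  also have "\<dots> = (\<Sum>p\<in>{(S,S'). card S = card S'}. F (card (fst p)) (fst p) (snd p))"
  proof (rule sum.mono_neutral_left)
    show "\<forall>p\<in>{(S,S'). card S = card S'} - {(S,S'). card S = card S' \<and> card S \<le> d}. F (card (fst p)) (fst p) (snd p) = 0"
    proof
      fix p assume "p \<in> {(S :: 'a set,S' :: 'a set). card S = card S'} - {(S,S'). card S = card S' \<and> card S \<le> d}"
      then have "card (fst p) > d" by auto
      then show "F (card (fst p)) (fst p) (snd p) = 0" by (simp add: F_def assms(2))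
    qed
  qed auto
  finally show ?thesis by (simp add: case_prod_unfold F_def Let_def)
qed

lemma listing_append:
  fixes E R :: "'n::finite set"
  assumes "E \<inter> R = {}"
  shows "mset (listing (E \<union> R)) = mset (listing E @ listing R)"
proof -
  have "distinct (listing E @ listing R)" "set (listing E @ listing R) = E \<union> R"
    using assms listing[of E] listing[of R] by auto
  then show ?thesis using mset_listing[of "listing E @ listing R"] by simp
qed

text \<open>Carrying \<open>i\<close> past \<open>listing E\<close> in the rows and past
  \<open>listing E'\<close> in the columns costs \<open>(- 1) ^ card E\<close> each time, as the two
  sets have equal size. The signs from sorting \<open>i\<close> into \<open>R\<close> cancel
  likewise.\<close>

lemma block_insert:
  fixes E E' R :: "'n::finite set"
  assumes "alternating (T (Suc (card R + card E)))" "card E = card E'" "i \<notin> R"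
  shows "T (Suc (card R + card E)) (i # listing E @ listing R) (i # listing E' @ listing R) = block d a T E E' (insert i R)"
proof -
  let ?T = "T (Suc (card R + card E))"
  have l: "length (listing E) = card E" "length (listing E') = card E" "length (listing R) = card R"
    "length (listing (insert i R)) = Suc (card R)"
    using listing(3)[of E] listing(3)[of E'] listing(3)[of R] listing(3)[of "insert i R"] assms by auto
  have "?T (i # listing E @ listing R) (i # listing E' @ listing R) =
      (- 1) ^ card E * ((- 1) ^ card E * ?T (listing E @ i # listing R) (listing E' @ i # listing R))"
    using alternating_move(1)[OF assms(1), of "i # listing E' @ listing R" "[]" "listing E" "listing R" i]
      alternating_move(2)[OF assms(1), of "listing E @ i # listing R" "[]" "listing E'" "listing R" i] l by simp
  also have "\<dots> = ?T (listing E @ i # listing R) (listing E' @ i # listing R)"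
    by (simp flip: mult.assoc power_mult_distrib)
  also have "\<dots> = ?T (listing E @ listing (insert i R)) (listing E' @ listing (insert i R))"
  proof -
    have "distinct (i # listing R)" "set (i # listing R) = insert i R" using listing[of R] assms by auto
    then have m: "mset (i # listing R) = mset (listing (insert i R))" using mset_listing by metis
    obtain \<epsilon> where e: "\<epsilon> * \<epsilon> = 1" "\<And>T P J. alternating T \<Longrightarrow> length J = length P + length (i # listing R) \<Longrightarrow>
       T (P @ i # listing R) J = \<epsilon> * T (P @ listing (insert i R)) J \<and> T J (P @ i # listing R) = \<epsilon> * T J (P @ listing (insert i R))"
      using alternating_perm[OF m] by blast
    have "?T (listing E @ i # listing R) (listing E' @ i # listing R) = \<epsilon> * (\<epsilon> * ?T (listing E @ listing (insert i R)) (listing E' @ listing (insert i R)))"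
      using e(2)[OF assms(1), of "listing E' @ i # listing R" "listing E"] e(2)[OF assms(1), of "listing E @ listing (insert i R)" "listing E'"] l
      by simp
    then show ?thesis using e(1) by (simp flip: mult.assoc)
  qed
  finally show ?thesis using assms by (simp add: block_def)
qed

text \<open>The left action sees the row set \<open>E \<union> R\<close> only. Its complement
  contains \<open>E'\<close>, which joins the trace part with coefficient at level \<open>k\<close>,
  whereas \<open>E\<close> joins the \<open>tleft\<close> part one level lower.\<close>

definition half_energy :: "nat \<Rightarrow> ('n::finite \<Rightarrow> real) \<Rightarrow> 'n set \<Rightarrow> 'n set \<Rightarrow> ('n set \<Rightarrow> real) \<Rightarrow> real" where
  "half_energy d a E E' u = (\<Sum>R\<in>Pow (- (E \<union> E')).
     coef d (card R + card E) * (\<Sum>i\<in>- (E \<union> E') - R. a i * (u R - u (insert i R))\<^sup>2)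
     + (coef d (card R + card E) * sum a E' + coef d (card R + card E - 1) * sum a E) * (u R)\<^sup>2)"

lemma tenergy_half:
  fixes a :: "'n::finite \<Rightarrow> real"
  assumes "\<And>k. alternating (T k)" "\<And>k I J. k > d \<Longrightarrow> T k I J = 0"
  shows "tenergy d (diagm a) T =
    (\<Sum>(E,E') | E \<inter> E' = {} \<and> card E = card E'. half_energy d a E E' (block d a T E E'))"
proof (rule trans[OF tenergy_pairs[OF assms]], assumption, unfold sum_pairs_blocks, intro sum.cong refl, clarify)
  fix E E' :: "'n set" assume E: "E \<inter> E' = {}" "card E = card E'"
  define N where "N = - (E \<union> E')"
  define u where "u = block d a T E E'"
  define c where "c R = coef d (card R + card E)" for R :: "'n set"
  define c' where "c' R = coef d (card R + card E - 1)" for R :: "'n set"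
  \<comment> \<open>The square at the far end of an edge is reassigned to the vertex there, which
    turns \<open>c\<close> into its shift \<open>c'\<close>.\<close>
  have "(\<Sum>R\<in>Pow N. c R * (\<Sum>i\<in>N - R. a i * (u (insert i R))\<^sup>2)) =
     (\<Sum>R\<in>Pow N. \<Sum>i\<in>N - R. c' (insert i R) * (a i * (u (insert i R))\<^sup>2))"
    unfolding sum_distrib_left by (intro sum.cong refl) (simp add: c_def c'_def card_insert_if)
  also have "\<dots> = (\<Sum>R\<in>Pow N. \<Sum>i\<in>R. c' R * (a i * (u R)\<^sup>2))"
    by (simp only: sum_remove_subsets'[of N "\<lambda>i R. c' (insert i R) * (a i * (u (insert i R))\<^sup>2)", symmetric] finite_code
      sum_remove_subsets[of N "\<lambda>i R. c' R * (a i * (u R)\<^sup>2)"])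
  also have "\<dots> = (\<Sum>R\<in>Pow N. c' R * sum a R * (u R)\<^sup>2)"
    by (simp add: sum_distrib_left sum_distrib_right mult.assoc)
  finally have shift: "(\<Sum>R\<in>Pow N. c R * (\<Sum>i\<in>N - R. a i * (u (insert i R))\<^sup>2)) = (\<Sum>R\<in>Pow N. c' R * sum a R * (u R)\<^sup>2)" .
  have sqr: "c R * (\<Sum>i\<in>N - R. a i * (u R - u (insert i R))\<^sup>2) =
     c R * (sum a (N - R) * (u R)\<^sup>2 - 2 * (\<Sum>i\<in>N - R. a i * (u R * u (insert i R)))) + c R * (\<Sum>i\<in>N - R. a i * (u (insert i R))\<^sup>2)" for R
  proof -
    have "(\<Sum>i\<in>N - R. a i * (u R - u (insert i R))\<^sup>2) =
       (\<Sum>i\<in>N - R. a i * (u R)\<^sup>2 - 2 * (a i * (u R * u (insert i R))) + a i * (u (insert i R))\<^sup>2)"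
      by (intro sum.cong refl) (simp add: power2_diff algebra_simps)
    also have "\<dots> = (sum a (N - R) * (u R)\<^sup>2 - 2 * (\<Sum>i\<in>N - R. a i * (u R * u (insert i R)))) + (\<Sum>i\<in>N - R. a i * (u (insert i R))\<^sup>2)"
      by (simp only: sum.distrib sum_subtractf sum_distrib_left sum_distrib_right)
    finally show ?thesis by (simp only: distrib_left)
  qed
  show "(\<Sum>R\<in>Pow (- (E \<union> E')). let k = card (E \<union> R); t = T k (listing (E \<union> R)) (listing (E' \<union> R)) in
     coef d k * (((\<Sum>i\<in>UNIV. a i) - (\<Sum>i\<in>E \<union> R. a i)) * t\<^sup>2 -
       2 * (t * (\<Sum>i\<in>UNIV. a i * T (Suc k) (i # listing (E \<union> R)) (i # listing (E' \<union> R)))))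
     + coef d (k - 1) * ((\<Sum>i\<in>E \<union> R. a i) * t\<^sup>2)) = half_energy d a E E' (block d a T E E')"
    (is "sum ?L _ = _")
  proof -
    have L: "?L R = c R * (sum a (N - R) * (u R)\<^sup>2 - 2 * (\<Sum>i\<in>N - R. a i * (u R * u (insert i R)))) + c' R * sum a R * (u R)\<^sup>2
       + (c R * sum a E' + c' R * sum a E) * (u R)\<^sup>2" if R: "R \<in> Pow N" for R
    proof -
      have dis: "E \<inter> R = {}" "E' \<inter> R = {}" using R N_def by auto
      have k: "card (E \<union> R) = card R + card E" using dis by (simp add: card_Un_disjoint)
      let ?k = "card R + card E"
      let ?t = "T ?k (listing (E \<union> R)) (listing (E' \<union> R))"
      have l: "length (listing (E \<union> R)) = length (listing (E' \<union> R))"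
        using dis E by (simp add: listing(3) card_Un_disjoint)
      have t2: "?t\<^sup>2 = (u R)\<^sup>2"
        using alternating_pair[OF assms(1) assms(1) listing_append[OF dis(1)] listing_append[OF dis(2)] l, of "[]" "[]" "[]" "[]" ?k ?k]
        by (simp add: u_def block_def power2_eq_square)
      have tt: "?t * T (Suc ?k) (i # listing (E \<union> R)) (i # listing (E' \<union> R)) =
         (if i \<in> N - R then u R * u (insert i R) else 0)" for i
      proof (cases "i \<in> N - R")
        case True
        have "?t * T (Suc ?k) (i # listing (E \<union> R)) (i # listing (E' \<union> R)) =
           u R * T (Suc ?k) (i # listing E @ listing R) (i # listing E' @ listing R)"
          using alternating_pair[OF assms(1) assms(1) listing_append[OF dis(1)] listing_append[OF dis(2)] l, of "[]" "[]" "[i]" "[i]" ?k "Suc ?k"]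
          by (simp add: u_def block_def)
        then show ?thesis using block_insert[of T R E E' i d a] assms(1) E True by (simp add: u_def)
      next
        case False
        then have "\<not> distinct (i # listing (E \<union> R)) \<or> \<not> distinct (i # listing (E' \<union> R))"
          by (auto simp: listing N_def)
        then have "T (Suc ?k) (i # listing (E \<union> R)) (i # listing (E' \<union> R)) = 0"
          using alternating_not_distinct[OF assms(1)] l by (metis length_Cons)
        then show ?thesis using False by auto
      qed
      have "?t * (\<Sum>i\<in>UNIV. a i * T (Suc ?k) (i # listing (E \<union> R)) (i # listing (E' \<union> R))) =
         (\<Sum>i\<in>UNIV. a i * (if i \<in> N - R then u R * u (insert i R) else 0))"
        unfolding tt[symmetric] sum_distrib_left by (intro sum.cong refl) (simp only: mult.left_commute)
      also have "\<dots> = (\<Sum>i\<in>N - R. a i * (u R * u (insert i R)))"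
        by (intro sum.mono_neutral_cong_right) auto
      finally have t3: "?t * (\<Sum>i\<in>UNIV. a i * T (Suc ?k) (i # listing (E \<union> R)) (i # listing (E' \<union> R))) =
         (\<Sum>i\<in>N - R. a i * (u R * u (insert i R)))" .
      have "UNIV = (E \<union> R) \<union> (E' \<union> (N - R))" "(E \<union> R) \<inter> (E' \<union> (N - R)) = {}" "E' \<inter> (N - R) = {}"
        using E dis R by (auto simp: N_def)
      then have s1: "sum a UNIV - sum a (E \<union> R) = sum a E' + sum a (N - R)"
        by (metis add_diff_cancel_left' finite_code sum.union_disjoint)
      have s2: "sum a (E \<union> R) = sum a E + sum a R" using dis by (simp add: sum.union_disjoint)
      show ?thesis
        unfolding Let_def k t2 t3 s1 unfolding s2 c_def c'_def by (simp add: algebra_simps)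
    qed
    have "sum ?L (Pow N) = (\<Sum>R\<in>Pow N. c R * (sum a (N - R) * (u R)\<^sup>2 - 2 * (\<Sum>i\<in>N - R. a i * (u R * u (insert i R)))))
       + (\<Sum>R\<in>Pow N. c' R * sum a R * (u R)\<^sup>2) + (\<Sum>R\<in>Pow N. (c R * sum a E' + c' R * sum a E) * (u R)\<^sup>2)"
      by (simp only: L sum.distrib cong: sum.cong)
    also have "\<dots> = (\<Sum>R\<in>Pow N. c R * (\<Sum>i\<in>N - R. a i * (u R - u (insert i R))\<^sup>2) + (c R * sum a E' + c' R * sum a E) * (u R)\<^sup>2)"
      unfolding shift[symmetric] by (simp only: sqr sum.distrib)
    finally show ?thesis unfolding N_def half_energy_def c_def c'_def u_def .
  qed
qed

text \<open>By the symmetry of the tensors, exchanging \<open>E\<close> and \<open>E'\<close> keeps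
  the block, so each \<open>half_energy\<close> can be averaged with its mirror image. The averaged
  weights are those of \<open>energy\<close>.\<close>

lemma tenergy_blocks:
  fixes a :: "'n::finite \<Rightarrow> real"
  assumes "\<And>k. alternating (T k)" "\<And>k I J. k > d \<Longrightarrow> T k I J = 0"
    and "\<And>k I J. length I = length J \<Longrightarrow> T k I J = T k J I"
  shows "tenergy d (diagm a) T = (\<Sum>(E,E') | E \<inter> E' = {} \<and> card E = card E'.
     energy d a (- (E \<union> E')) (card E) ((sum a E + sum a E') / 2) (block d a T E E'))"
proof -
  let ?B = "{(E,E'). E \<inter> E' = {} \<and> card E = card (E' :: 'n set)}"
  let ?h = "\<lambda>E E'. half_energy d a E E' (block d a T E E')"
  have 1: "(\<Sum>(E,E')\<in>?B. ?h E E') = (\<Sum>(E,E')\<in>?B. ?h E' E)"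
    by (rule sum.reindex_bij_witness[of _ prod.swap prod.swap]) auto
  have 2: "energy d a (- (E \<union> E')) (card E) ((sum a E + sum a E') / 2) (block d a T E E') = (?h E E' + ?h E' E) / 2"
    if "E \<inter> E' = {}" "card E = card E'" for E E'
  proof -
    have "block d a T E' E = block d a T E E'"
      using that assms(3) by (intro ext) (simp add: block_def listing(3))
    then show ?thesis
      unfolding energy_def half_energy_def that(2) Un_commute[of E' E] sum.distrib[symmetric] sum_divide_distrib
      by (intro sum.cong refl) (simp add: field_simps)
  qed
  have "tenergy d (diagm a) T = ((\<Sum>(E,E')\<in>?B. ?h E E') + (\<Sum>(E,E')\<in>?B. ?h E' E)) / 2"
    unfolding 1[symmetric] by (subst tenergy_half) (use assms in auto)
  also have "\<dots> = (\<Sum>(E,E')\<in>?B. (?h E E' + ?h E' E) / 2)"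
    by (simp add: sum.distrib case_prod_unfold flip: sum_divide_distrib)
  also have "\<dots> = (\<Sum>(E,E')\<in>?B. energy d a (- (E \<union> E')) (card E) ((sum a E + sum a E') / 2) (block d a T E E'))"
    using 2 by (intro sum.cong refl) auto
  finally show ?thesis .
qed

section \<open>Diagonalization and the spectral invariants\<close>

text \<open>At a maximizer \<open>v\<close> of the Rayleigh quotient on \<open>V\<close>, a nonzero
  residual \<open>w\<close> would be a direction of first-order increase.\<close>

lemma symmetric_eigenvector:
  fixes A :: "real^'n^'n"
  assumes "transpose A = A" "subspace V" "\<And>v. v \<in> V \<Longrightarrow> A *v v \<in> V" "V \<noteq> {0}"
  obtains v l where "v \<in> V" "norm v = 1" "A *v v = l *\<^sub>R v"
proof -
  have sym: "(A *v x) \<bullet> y = x \<bullet> (A *v y)" for x y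
    using dot_lmul_matrix[of x A y] assms(1) by (metis transpose_matrix_vector)
  obtain u where u: "u \<in> V" "u \<noteq> 0" using assms(2,4) subspace_0 by blast
  have "(1 / norm u) *\<^sub>R u \<in> V \<inter> sphere 0 1"
    using u assms(2) by (simp add: subspace_scale)
  moreover have "compact (V \<inter> sphere 0 1)"
    using closed_subspace[OF assms(2)] by (intro closed_Int_compact) auto
  moreover have "continuous_on (V \<inter> sphere 0 1) (\<lambda>v. v \<bullet> (A *v v))"
    by (intro continuous_intros linear_continuous_on_compose[OF continuous_on_id] matrix_vector_mul_linear)
  ultimately obtain v where v: "v \<in> V \<inter> sphere 0 1"
    and max: "\<And>u. u \<in> V \<inter> sphere 0 1 \<Longrightarrow> u \<bullet> (A *v u) \<le> v \<bullet> (A *v v)"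
    using continuous_attains_sup[of "V \<inter> sphere 0 1" "\<lambda>v. v \<bullet> (A *v v)"] by blast
  define l where "l = v \<bullet> (A *v v)"
  define w where "w = A *v v - l *\<^sub>R v"
  have vV: "v \<in> V" and vv: "v \<bullet> v = 1" using v by (auto simp: norm_eq_1)
  have wV: "w \<in> V" unfolding w_def using vV assms(2,3) by (simp add: subspace_diff subspace_scale)
  have wv: "w \<bullet> v = 0" unfolding w_def by (simp add: inner_diff_left vv l_def inner_commute[of "A *v v" v])
  have wAv: "w \<bullet> (A *v v) = w \<bullet> w"
  proof -
    have "A *v v = w + l *\<^sub>R v" by (simp add: w_def)
    then have "w \<bullet> (A *v v) = w \<bullet> (w + l *\<^sub>R v)" by simp
    then show ?thesis by (simp add: inner_add_right wv)
  qed
  have bound: "x \<bullet> (A *v x) \<le> l * (x \<bullet> x)" if "x \<in> V" for x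
  proof (cases "x = 0")
    case False
    have "(1 / norm x) *\<^sub>R x \<in> V \<inter> sphere 0 1" using that False assms(2) by (simp add: subspace_scale)
    from max[OF this] have "(x \<bullet> (A *v x)) / (norm x)\<^sup>2 \<le> l"
      by (simp add: l_def matrix_vector_mult_scaleR power2_eq_square)
    then show ?thesis using False by (simp add: divide_simps power2_norm_eq_inner split: if_splits)
  qed simp
  have "w \<bullet> w = 0"
  proof (rule ccontr)
    assume "w \<bullet> w \<noteq> 0"
    then have pos: "w \<bullet> w > 0" by simp
    define K where "K = l * (w \<bullet> w) - w \<bullet> (A *v w)"
    have ineq: "2 * t * (w \<bullet> w) \<le> t\<^sup>2 * K" for t
    proof -
      have "v + t *\<^sub>R w \<in> V" using vV wV assms(2) by (simp add: subspace_add subspace_scale)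
      from bound[OF this] have b: "(v + t *\<^sub>R w) \<bullet> (A *v (v + t *\<^sub>R w)) \<le> l * ((v + t *\<^sub>R w) \<bullet> (v + t *\<^sub>R w))" .
      have vw: "v \<bullet> w = 0" using wv by (simp add: inner_commute)
      have vAw: "v \<bullet> (A *v w) = w \<bullet> w" using sym[of v w] wAv by (simp add: inner_commute)
      have "A *v (v + t *\<^sub>R w) = A *v v + t *\<^sub>R (A *v w)"
        by (simp add: matrix_vector_right_distrib matrix_vector_mult_scaleR)
      then have "(v + t *\<^sub>R w) \<bullet> (A *v (v + t *\<^sub>R w)) = l + 2 * t * (w \<bullet> w) + t\<^sup>2 * (w \<bullet> (A *v w))"
        by (simp add: inner_add_left inner_add_right wAv vAw l_def[symmetric] power2_eq_square distrib_left)
      moreover have "(v + t *\<^sub>R w) \<bullet> (v + t *\<^sub>R w) = 1 + t\<^sup>2 * (w \<bullet> w)"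
        by (simp add: inner_add_left inner_add_right wv vw vv power2_eq_square)
      ultimately have "l + 2 * t * (w \<bullet> w) + t\<^sup>2 * (w \<bullet> (A *v w)) \<le> l * (1 + t\<^sup>2 * (w \<bullet> w))"
        using b by simp
      then show ?thesis by (simp add: K_def algebra_simps)
    qed
    \<comment> \<open>Small enough for \<open>t * K \<le> w \<bullet> w\<close> whatever the sign of
      \<open>K\<close>; the added \<open>1\<close> keeps the denominator positive.\<close>
    define t where "t = (w \<bullet> w) / (\<bar>K\<bar> + 1)"
    have t: "t > 0" unfolding t_def using pos by (intro divide_pos_pos) auto
    have "t * K \<le> t * (\<bar>K\<bar> + 1)" using t by (intro mult_left_mono) auto
    also have "\<dots> = w \<bullet> w" by (simp add: t_def)
    finally have "t * (t * K) \<le> t * (w \<bullet> w)" using t by (intro mult_left_mono) auto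
    then have "2 * t * (w \<bullet> w) \<le> t * (w \<bullet> w)" using ineq[of t] by (simp add: power2_eq_square)
    moreover have "t * (w \<bullet> w) > 0" using t pos by simp
    ultimately show False by simp
  qed
  then have "A *v v = l *\<^sub>R v" by (simp add: w_def)
  moreover have "norm v = 1" using v by simp
  ultimately show ?thesis using that vV by blast
qed

lemma symmetric_eigenbasis:
  fixes A :: "real^'n^'n"
  assumes "transpose A = A" "subspace V" "\<And>v. v \<in> V \<Longrightarrow> A *v v \<in> V"
  shows "\<exists>B. finite B \<and> B \<subseteq> V \<and> card B = dim V \<and> pairwise orthogonal B \<and>
    (\<forall>b\<in>B. norm b = 1 \<and> (\<exists>l. A *v b = l *\<^sub>R b))"
  using assms(2,3)
proof (induction "dim V" arbitrary: V)
  case 0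
  then show ?case by (intro exI[of _ "{}"]) auto
next
  case (Suc n)
  then have "V \<noteq> {0}" by force
  then obtain v l where v: "v \<in> V" "norm v = 1" "A *v v = l *\<^sub>R v"
    using symmetric_eigenvector[OF assms(1) Suc.prems(1) Suc.prems(2)] by blast
  define W where "W = {y \<in> V. \<forall>x\<in>span {v}. orthogonal x y}"
  have W: "y \<in> W \<longleftrightarrow> y \<in> V \<and> v \<bullet> y = 0" for y
    unfolding W_def orthogonal_def by (auto simp: span_singleton)
  have subW: "subspace W"
    using Suc.prems(1) by (auto simp: subspace_def W inner_add_right)
  have "dim W + dim (span {v}) = dim V"
    unfolding W_def using v Suc.prems(1) by (intro dim_subspace_orthogonal_to_vectors) (auto simp: span_minimal)
  moreover have "dim (span {v}) = 1" using v by (auto simp: dim_singleton)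
  ultimately have dW: "dim W = n" using Suc.hyps(2) by simp
  have inv: "A *v y \<in> W" if "y \<in> W" for y
  proof -
    have "v \<bullet> (A *v y) = (A *v v) \<bullet> y"
      using dot_lmul_matrix[of v A y] assms(1) by (metis transpose_matrix_vector)
    then show ?thesis using that Suc.prems(2) v by (auto simp: W)
  qed
  obtain B where B: "finite B" "B \<subseteq> W" "card B = dim W" "pairwise orthogonal B"
    "\<forall>b\<in>B. norm b = 1 \<and> (\<exists>l. A *v b = l *\<^sub>R b)"
    using Suc.hyps(1)[OF dW[symmetric] subW inv] by blast
  have "v \<notin> B" using B(2) v(2) W by (auto simp: norm_eq_1)
  moreover have "pairwise orthogonal (insert v B)"
    using B(2,4) W unfolding pairwise_insert by (auto simp: orthogonal_def inner_commute)
  ultimately show ?case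
    using B v W Suc.hyps(2) dW by (intro exI[of _ "insert v B"]) auto
qed

lemma symmetric_diagonalization:
  fixes A :: "real^'n^'n"
  assumes "transpose A = A"
  obtains Q x where "orthogonal_matrix Q" "A = Q ** diagm x ** transpose Q"
proof -
  obtain B where B: "finite B" "card B = dim (UNIV :: (real^'n) set)" "pairwise orthogonal B"
    "\<And>b. b \<in> B \<Longrightarrow> norm b = 1 \<and> (\<exists>l. A *v b = l *\<^sub>R b)"
    using symmetric_eigenbasis[OF assms subspace_UNIV] by auto
  then have "card B = CARD('n)" by (simp add: dim_UNIV)
  then obtain f where f: "bij_betw f (UNIV :: 'n set) B"
    using B(1) finite_same_card_bij[of "UNIV :: 'n set" B] by auto
  have fB: "f i \<in> B" for i using f bij_betwE by blast
  have orth: "f i \<bullet> f j = (if i = j then 1 else 0)" for i j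
  proof (cases "i = j")
    case True
    then show ?thesis using B(4)[OF fB] by (simp add: norm_eq_1)
  next
    case False
    then have "f i \<noteq> f j" using f by (metis bij_betw_inv_into_left UNIV_I)
    then show ?thesis using B(3) fB False by (auto simp: pairwise_def orthogonal_def)
  qed
  obtain x where x: "\<And>i. A *v f i = x i *\<^sub>R f i" using B(4)[OF fB] by metis
  define Q where "Q = (\<chi> i j. f j $ i)"
  have "transpose Q ** Q = mat 1"
    using orth by (simp add: Q_def vec_eq_iff matrix_matrix_mult_def transpose_def mat_def inner_vec_def)
  then have Q: "orthogonal_matrix Q" by (simp add: orthogonal_matrix)
  have "A ** Q = Q ** diagm x"
  proof -
    have "(A ** Q) $ i $ j = (Q ** diagm x) $ i $ j" for i j
    proof -
      have "(A ** Q) $ i $ j = (A *v f j) $ i"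
        by (simp add: matrix_matrix_mult_def matrix_vector_mult_def Q_def)
      also have "\<dots> = x j * f j $ i" by (simp add: x)
      also have "\<dots> = (Q ** diagm x) $ i $ j"
        by (simp add: matrix_matrix_mult_def Q_def if_distrib[of "\<lambda>c. _ * c"] cong: if_cong)
      finally show ?thesis .
    qed
    then show ?thesis by (simp add: vec_eq_iff)
  qed
  then have "Q ** diagm x ** transpose Q = A ** (Q ** transpose Q)" by (simp add: matrix_mul_assoc)
  also have "\<dots> = A" using Q by (simp add: orthogonal_matrix_def)
  finally show ?thesis using that[of Q x] Q by simp
qed

section \<open>Conjugation and eigenvalue invariants\<close>

lemma conj_add:
  fixes Q :: "real^'n^'n"
  shows "Q ** (X + Y) ** transpose Q = Q ** X ** transpose Q + Q ** Y ** transpose Q"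
  by (simp add: vec_eq_iff conj_entry sum.distrib distrib_left)

lemma conj_diff:
  fixes Q :: "real^'n^'n"
  shows "Q ** (X - Y) ** transpose Q = Q ** X ** transpose Q - Q ** Y ** transpose Q"
  by (simp add: vec_eq_iff conj_entry sum_subtractf right_diff_distrib)

lemma conj_scaleR:
  fixes Q :: "real^'n^'n"
  shows "Q ** (c *\<^sub>R X) ** transpose Q = c *\<^sub>R (Q ** X ** transpose Q)"
  by (simp add: vec_eq_iff conj_entry sum_distrib_left mult_ac)

lemma mat_eq_scaleR: "(mat t :: real^'n^'n) = t *\<^sub>R mat 1"
  by (simp add: vec_eq_iff mat_def)

lemma conj_mat:
  fixes Q :: "real^'n^'n"
  assumes "orthogonal_matrix Q"
  shows "Q ** mat t ** transpose Q = mat t"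
  unfolding mat_eq_scaleR[of t] conj_scaleR using assms by (simp add: orthogonal_matrix_def)

lemma transpose_conj:
  fixes Q :: "real^'n^'n"
  shows "transpose (Q ** X ** transpose Q) = Q ** transpose X ** transpose Q"
  by (simp add: matrix_transpose_mul matrix_mul_assoc)

lemma conj_conj:
  fixes Q :: "real^'n^'n"
  assumes "orthogonal_matrix Q"
  shows "Q ** (transpose Q ** X ** Q) ** transpose Q = X"
proof -
  have "Q ** (transpose Q ** X ** Q) ** transpose Q = (Q ** transpose Q) ** X ** (Q ** transpose Q)"
    by (simp add: matrix_mul_assoc)
  then show ?thesis using assms by (simp add: orthogonal_matrix_def)
qed

lemma prod_one_plus_esym:
  fixes x :: "'n::finite \<Rightarrow> real"
  shows "(\<Prod>i\<in>UNIV. 1 + s * x i) = (\<Sum>k\<le>CARD('n). esym UNIV k x * s ^ k)"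
proof -
  have "(\<Prod>i\<in>UNIV. s * x i + 1) = (\<Sum>S\<in>Pow UNIV. s ^ card S * (\<Prod>i\<in>S. x i))"
    by (subst prod_add) (simp_all add: prod.distrib)
  also have "\<dots> = (\<Sum>k\<le>CARD('n). \<Sum>S\<in>{S \<in> Pow UNIV. card S = k}. s ^ card S * (\<Prod>i\<in>S. x i))"
    by (rule sum.group[symmetric]) (auto intro: card_mono)
  also have "\<dots> = (\<Sum>k\<le>CARD('n). esym UNIV k x * s ^ k)"
    unfolding esym_def sum_distrib_right by (intro sum.cong refl) (auto intro!: sum.cong)
  finally show ?thesis by (simp add: add.commute)
qed

text \<open>The substitution \<open>t = - 1 / s\<close> turns equal characteristic polynomials into
  equal generating functions, whose coefficients are compared.\<close>

lemma esym_eqI: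
  fixes x y :: "'n::finite \<Rightarrow> real"
  assumes "\<And>t. (\<Prod>i\<in>UNIV. t - x i) = (\<Prod>i\<in>UNIV. t - y i)"
  shows "esym UNIV k x = esym UNIV k y"
proof (cases "k \<le> CARD('n)")
  case True
  have gen: "(\<Prod>i\<in>UNIV. 1 + s * z i) = (- s) ^ CARD('n) * (\<Prod>i\<in>UNIV. - 1 / s - z i)" if "s \<noteq> 0" for s and z :: "'n \<Rightarrow> real"
  proof -
    have "(\<Prod>i\<in>UNIV. 1 + s * z i) = (\<Prod>i\<in>UNIV. (- s) * (- 1 / s - z i))"
      using that by (intro prod.cong refl) (simp add: field_simps)
    then show ?thesis by (simp only: prod.distrib prod_constant)
  qed
  have "(\<Prod>i\<in>UNIV. 1 + s * x i) = (\<Prod>i\<in>UNIV. 1 + s * y i)" for s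
  proof (cases "s = 0")
    case False
    show ?thesis unfolding gen[OF False] assms ..
  qed simp
  then have "\<forall>s. (\<Sum>k\<le>CARD('n). esym UNIV k x * s ^ k) = (\<Sum>k\<le>CARD('n). esym UNIV k y * s ^ k)"
    by (simp add: prod_one_plus_esym)
  then show ?thesis using True by (simp add: polyfun_eq_coeffs)
qed (simp add: esym_eq_0)

text \<open>The vector chosen by \<open>eigenvalue_vec\<close> has the characteristic polynomial of
  \<open>x\<close>, and \<open>esym_eqI\<close> makes any other feature of the choice
  irrelevant.\<close>

lemma Ppoly_conj_diag:
  fixes Q :: "real^'n^'n"
  assumes "orthogonal_matrix Q"
  shows "Ppoly k (Q ** diagm x ** transpose Q) = esym UNIV k x"
proof -
  let ?X = "Q ** diagm x ** transpose Q"
  have det: "det (mat t - ?X) = (\<Prod>i\<in>UNIV. t - x i)" for t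
  proof -
    have "mat t - ?X = Q ** (mat t - diagm x) ** transpose Q"
      by (simp add: conj_diff conj_mat[OF assms])
    then have "det (mat t - ?X) = det (mat t - diagm x) * (det Q * det (transpose Q))"
      by (simp add: det_mul mult_ac)
    also have "det Q * det (transpose Q) = 1"
      using assms by (metis det_I det_mul orthogonal_matrix_def)
    also have "det (mat t - diagm x) = (\<Prod>i\<in>UNIV. (mat t - diagm x) $ i $ i)"
      by (rule det_diagonal) (simp add: mat_def)
    finally show ?thesis by (simp add: mat_def)
  qed
  have "\<exists>v :: real^'n. \<forall>t. det (mat t - ?X) = (\<Prod>i\<in>UNIV. t - v $ i)"
    by (rule exI[of _ "\<chi> i. x i"]) (simp add: det)
  then have "\<forall>t. det (mat t - ?X) = (\<Prod>i\<in>UNIV. t - eigenvalue_vec ?X $ i)"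
    unfolding eigenvalue_vec_def by (rule someI_ex)
  then have "esym UNIV k (\<lambda>i. eigenvalue_vec ?X $ i) = esym UNIV k x"
    by (intro esym_eqI) (simp add: det)
  then show ?thesis by (simp add: Ppoly_def elem_sym_def esym_def)
qed

lemma traced_minor_Nil_conj:
  fixes Q :: "real^'n^'n"
  assumes "orthogonal_matrix Q"
  shows "traced_minor (Q ** X ** transpose Q) r [] [] = traced_minor X r [] []"
  using covariant_traced_minor[OF assms, of 0 X r] by (simp add: covariant_def)

text \<open>This exhibits \<open>Ppoly\<close> on symmetric matrices as a polynomial in the entries,
  which makes it accessible to differentiation and to the claim on squares.\<close>

lemma Ppoly_eq_traced_minor:
  assumes "X \<in> sym_mats"
  shows "Ppoly k X = traced_minor X k [] []"
proof -
  obtain Q x where Q: "orthogonal_matrix Q" "X = Q ** diagm x ** transpose Q"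
    using assms symmetric_diagonalization[of X] by (auto simp: sym_mats_def)
  then show ?thesis
    using Ppoly_conj_diag[OF Q(1)] traced_minor_diag[of "[]" x k] by (simp add: traced_minor_Nil_conj)
qed

text \<open>In a term of the product rule, the undifferentiated factors vanish unless they are
  diagonal entries; then the differentiated factor is a diagonal entry too, as \<open>\<pi>\<close>
  only permutes \<open>I\<close>.\<close>

lemma has_derivative_minor_diag:
  fixes B :: "real^'n^'n"
  defines "B' \<equiv> diagm (\<lambda>i. B $ i $ i)"
  shows "\<exists>D. ((\<lambda>t. minor (diagm x + t *\<^sub>R B) I I) has_real_derivative D) (at 0) \<and>
    ((\<lambda>t. minor (diagm x + t *\<^sub>R B') I I) has_real_derivative D) (at 0)"
proof -
  let ?n = "length I" and ?X = "diagm x"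
  define D where "D B \<pi> = (\<Sum>a<?n. B $ (I ! a) $ (I ! \<pi> a) * (\<Prod>b\<in>{..<?n} - {a}. ?X $ (I ! b) $ (I ! \<pi> b)))"
    for B :: "real^'n^'n" and \<pi>
  have der: "((\<lambda>t. minor (?X + t *\<^sub>R B) I I) has_real_derivative
     (\<Sum>\<pi> | \<pi> permutes {..<?n}. of_int (sign \<pi>) * D B \<pi>)) (at 0)" for B
  proof -
    have e: "((\<lambda>t. (?X + t *\<^sub>R B) $ i $ j) has_real_derivative B $ i $ j) (at 0)" for i j
      by (auto intro!: derivative_eq_intros)
    have "((\<lambda>t. \<Prod>a<?n. (?X + t *\<^sub>R B) $ (I ! a) $ (I ! \<pi> a)) has_real_derivative D B \<pi>) (at 0)" for \<pi>
      using has_field_derivative_prod[of "{..<?n}" "\<lambda>a t. (?X + t *\<^sub>R B) $ (I ! a) $ (I ! \<pi> a)"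
          "\<lambda>a. B $ (I ! a) $ (I ! \<pi> a)" 0] e by (simp add: D_def)
    then show ?thesis unfolding minor_def
      by (intro DERIV_sum DERIV_cmult) auto
  qed
  have "D B \<pi> = D B' \<pi>" if p: "\<pi> permutes {..<?n}" for \<pi>
    unfolding D_def
  proof (intro sum.cong refl)
    fix a assume a: "a \<in> {..<?n}"
    show "B $ (I ! a) $ (I ! \<pi> a) * (\<Prod>b\<in>{..<?n} - {a}. ?X $ (I ! b) $ (I ! \<pi> b)) =
      B' $ (I ! a) $ (I ! \<pi> a) * (\<Prod>b\<in>{..<?n} - {a}. ?X $ (I ! b) $ (I ! \<pi> b))"
    proof (cases "\<forall>b\<in>{..<?n} - {a}. I ! b = I ! \<pi> b")
      case True
      \<comment> \<open>Counting the occurrences of \<open>I ! a\<close> copes with repetitions in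
        \<open>I\<close>.\<close>
      define g where "g i = (if i = I ! a then 1 else 0 :: nat)" for i
      have "(\<Sum>b<?n. g (I ! b)) = (\<Sum>b<?n. g (I ! \<pi> b))"
        using sum.permute[OF p, of "\<lambda>b. g (I ! b)"] by (simp add: comp_def)
      moreover have "(\<Sum>b\<in>{..<?n} - {a}. g (I ! b)) = (\<Sum>b\<in>{..<?n} - {a}. g (I ! \<pi> b))"
        using True by (intro sum.cong refl) simp
      ultimately have "g (I ! a) = g (I ! \<pi> a)"
        using a by (simp add: sum.remove[of "{..<?n}" a])
      then have "I ! a = I ! \<pi> a" by (simp add: g_def split: if_splits)
      then show ?thesis by (simp add: B'_def)
    next
      case False
      then have "(\<Prod>b\<in>{..<?n} - {a}. ?X $ (I ! b) $ (I ! \<pi> b)) = 0"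
        by (auto intro!: prod_zero)
      then show ?thesis by simp
    qed
  qed
  then have eq: "(\<Sum>\<pi> | \<pi> permutes {..<?n}. of_int (sign \<pi>) * D B \<pi>) = (\<Sum>\<pi> | \<pi> permutes {..<?n}. of_int (sign \<pi>) * D B' \<pi>)"
    by (intro sum.cong refl) simp
  show ?thesis
    by (intro exI[of _ "\<Sum>\<pi> | \<pi> permutes {..<?n}. of_int (sign \<pi>) * D B' \<pi>"] conjI der der[of B, unfolded eq])
qed

lemma has_derivative_traced_minor_diag:
  fixes B :: "real^'n^'n"
  defines "B' \<equiv> diagm (\<lambda>i. B $ i $ i)"
  shows "\<exists>D. ((\<lambda>t. traced_minor (diagm x + t *\<^sub>R B) r I I) has_real_derivative D) (at 0) \<and>
    ((\<lambda>t. traced_minor (diagm x + t *\<^sub>R B') r I I) has_real_derivative D) (at 0)"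
proof (induction r arbitrary: I)
  case 0
  then show ?case unfolding B'_def traced_minor.simps by (rule has_derivative_minor_diag)
next
  case (Suc r)
  have "\<forall>u. \<exists>D. ((\<lambda>t. traced_minor (diagm x + t *\<^sub>R B) r (u # I) (u # I)) has_real_derivative D) (at 0) \<and>
    ((\<lambda>t. traced_minor (diagm x + t *\<^sub>R B') r (u # I) (u # I)) has_real_derivative D) (at 0)"
    using Suc by blast
  from choice[OF this] obtain D where
    D: "((\<lambda>t. traced_minor (diagm x + t *\<^sub>R B) r (u # I) (u # I)) has_real_derivative D u) (at 0)"
    "((\<lambda>t. traced_minor (diagm x + t *\<^sub>R B') r (u # I) (u # I)) has_real_derivative D u) (at 0)" for u
    by blast
  show ?case unfolding traced_minor.simps
    by (intro exI[of _ "(\<Sum>u\<in>UNIV. D u) / real (Suc r)"] conjI DERIV_cdivide DERIV_sum D)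
qed

text \<open>The line stays within the symmetric matrices, so \<open>traced_minor\<close> can be
  differentiated in place of the eigenvalues, and conjugation moves the base point to a diagonal
  matrix.\<close>

lemma dir_deriv_Ppoly:
  fixes V :: "real^'n^'n"
  assumes V: "orthogonal_matrix V" and B: "transpose B = B"
  shows "dir_deriv (V ** B ** transpose V) (Ppoly k) (V ** diagm x ** transpose V) =
    desym UNIV k (\<lambda>i. B $ i $ i) x"
proof -
  let ?b = "\<lambda>i. B $ i $ i"
  have "V ** diagm x ** transpose V + t *\<^sub>R (V ** B ** transpose V) = V ** (diagm x + t *\<^sub>R B) ** transpose V" for t
    by (simp add: conj_add conj_scaleR)
  moreover have "V ** (diagm x + t *\<^sub>R B) ** transpose V \<in> sym_mats" for t
  proof -
    have "transpose (diagm x + t *\<^sub>R B) = diagm x + t *\<^sub>R B"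
      using B by (auto simp: transpose_def vec_eq_iff)
    then show ?thesis by (simp add: sym_mats_def transpose_conj)
  qed
  ultimately have eq: "Ppoly k (V ** diagm x ** transpose V + t *\<^sub>R (V ** B ** transpose V)) =
     traced_minor (diagm x + t *\<^sub>R B) k [] []" for t
    by (simp add: Ppoly_eq_traced_minor traced_minor_Nil_conj[OF V])
  obtain D where D: "((\<lambda>t. traced_minor (diagm x + t *\<^sub>R B) k [] []) has_real_derivative D) (at 0)"
    "((\<lambda>t. traced_minor (diagm x + t *\<^sub>R diagm ?b) k [] []) has_real_derivative D) (at 0)"
    using has_derivative_traced_minor_diag by blast
  have "traced_minor (diagm x + t *\<^sub>R diagm ?b) k [] [] = esym UNIV k (\<lambda>i. x i + t * ?b i)" for t
  proof -
    have "diagm x + t *\<^sub>R diagm ?b = diagm (\<lambda>i. x i + t * ?b i)" by (simp add: vec_eq_iff)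
    then show ?thesis using traced_minor_diag[of "[]" "\<lambda>i. x i + t * ?b i" k] by (simp only:) simp
  qed
  then have "((\<lambda>t. esym UNIV k (\<lambda>i. x i + t * ?b i)) has_real_derivative D) (at 0)"
    using D(2) by (simp only:)
  then have "D = desym UNIV k ?b x" using DERIV_unique[OF _ desym_deriv[of UNIV k x ?b]] by simp
  then show ?thesis unfolding dir_deriv_def eq using DERIV_imp_deriv[OF D(1)] by simp
qed

section \<open>The Wronskian as a tensor energy\<close>

lemma potential_diag_nonzero:
  "potential d (diagm x) k I J \<noteq> 0 \<Longrightarrow> length I = length J \<Longrightarrow> mset I = mset J"
  using traced_minor_diag_eq_0[of I J x "d - k"] by (auto simp: potential_def split: if_splits)

text \<open>A nonzero potential of a diagonal matrix has equal row and column multisets. When two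
  such potentials are paired through \<open>B\<close>, only diagonal entries of \<open>B\<close> can
  link them, just as in \<open>dir_deriv_Ppoly\<close>.\<close>

lemma tenergy_diag_potential:
  fixes B :: "real^'n^'n"
  shows "tenergy d B (potential d (diagm x)) = tenergy d (diagm (\<lambda>i. B $ i $ i)) (potential d (diagm x))"
proof -
  let ?b = "\<lambda>i. B $ i $ i" and ?T = "potential d (diagm x)"
  have 1: "?T k I J * insert_left B (?T k) I J = ?T k I J * insert_left (diagm ?b) (?T k) I J"
    if len: "length I = k" "length J = k" "k > 0" for k I J
  proof (cases "?T k I J = 0")
    case False
    then have m: "mset I = mset J" using potential_diag_nonzero[OF False] len by simp
    obtain i I' where I: "I = i # I'" using len by (cases I) auto
    have *: "B $ i $ u * ?T k (u # I') J = diagm ?b $ i $ u * ?T k (u # I') J" for u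
    proof (cases "?T k (u # I') J = 0")
      case False
      then have "mset (u # I') = mset J" using potential_diag_nonzero[of d x k "u # I'" J] len I by simp
      then have "add_mset u (mset I') = add_mset i (mset I')" using m I by simp
      then have "u = i" by simp
      then show ?thesis by simp
    qed simp
    have "insert_left B (?T k) I J = insert_left (diagm ?b) (?T k) I J"
      unfolding insert_left_def I list.sel by (intro sum.cong refl *)
    then show ?thesis by simp
  qed simp
  have l: "tleft B ?T k = tleft (diagm ?b) ?T k" for k
  proof (cases "k = 0")
    case False
    then have "(\<Sum>I\<in>nlists k. \<Sum>J\<in>nlists k. ?T k I J * insert_left B (?T k) I J) =
       (\<Sum>I\<in>nlists k. \<Sum>J\<in>nlists k. ?T k I J * insert_left (diagm ?b) (?T k) I J)"
      by (intro sum.cong refl 1) auto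
    then show ?thesis unfolding tleft_def by (simp only:)
  qed (simp add: tleft_def)
  have 2: "?T k I J * contract B (?T (Suc k)) I J = ?T k I J * contract (diagm ?b) (?T (Suc k)) I J"
    if "length I = k" "length J = k" for k I J
  proof (cases "?T k I J = 0")
    case False
    then have m: "mset I = mset J" using potential_diag_nonzero[OF False] that by simp
    have *: "B $ i $ j * ?T (Suc k) (i # I) (j # J) = diagm ?b $ i $ j * ?T (Suc k) (i # I) (j # J)" for i j
    proof (cases "?T (Suc k) (i # I) (j # J) = 0")
      case False
      then have "mset (i # I) = mset (j # J)" using potential_diag_nonzero[of d x "Suc k" "i # I" "j # J"] that by simp
      then have "i = j" using m by simp
      then show ?thesis by simp
    qed simp
    have "contract B (?T (Suc k)) I J = contract (diagm ?b) (?T (Suc k)) I J"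
      unfolding contract_def by (intro sum.cong refl *)
    then show ?thesis by simp
  qed simp
  have c: "tcross B ?T k = tcross (diagm ?b) ?T k" for k
  proof -
    have "(\<Sum>I\<in>nlists k. \<Sum>J\<in>nlists k. ?T k I J * contract B (?T (Suc k)) I J) =
       (\<Sum>I\<in>nlists k. \<Sum>J\<in>nlists k. ?T k I J * contract (diagm ?b) (?T (Suc k)) I J)"
      by (intro sum.cong refl 2) auto
    then show ?thesis unfolding tcross_def by (simp only:)
  qed
  have "trace B = trace (diagm ?b)" by (simp add: trace_def)
  then show ?thesis unfolding tenergy_def l c by simp
qed

lemma potential_sym:
  assumes "transpose X = X" "length I = length J"
  shows "potential d X k I J = potential d X k J I"
  using traced_minor_transpose[OF assms(2), of X "d - k"] assms(1) by (simp add: potential_def)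

lemma tenergy_potential_blocks:
  assumes "transpose X = X"
  shows "tenergy d (diagm a) (potential d X) = (\<Sum>(E,E') | E \<inter> E' = {} \<and> card E = card E'.
     energy d a (- (E \<union> E')) (card E) ((sum a E + sum a E') / 2) (block d a (potential d X) E E'))"
  by (rule tenergy_blocks) (auto simp: alternating_potential potential_sym[OF assms], simp add: potential_def)

lemma listing_empty [simp]: "listing {} = []"
  using listing(3)[of "{}"] by simp

lemma energy_zero: "(\<And>R. R \<subseteq> M \<Longrightarrow> w R = 0) \<Longrightarrow> energy d a M m s w = 0"
  using energy_cong[of M w "\<lambda>_. 0" d a m s] by (simp add: energy_def)

text \<open>Blocks with nonempty \<open>E\<close> have unequal row and column multisets and vanish.
  The block of empty sets carries \<open>tree_potential\<close>.\<close>

lemma tenergy_diag_diag: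
  fixes x :: "'n::finite \<Rightarrow> real"
  shows "tenergy d (diagm a) (potential d (diagm x)) = wronskian UNIV d a x"
proof -
  let ?T = "potential d (diagm x)"
  let ?B = "{(E,E'). E \<inter> E' = {} \<and> card E = card (E' :: 'n set)}"
  let ?e = "\<lambda>(E,E'). energy d a (- (E \<union> E')) (card E) ((sum a E + sum a E') / 2) (block d a ?T E E')"
  have sym: "transpose (diagm x) = diagm x" by (auto simp: transpose_def vec_eq_iff)
  have z: "?e p = 0" if "p \<in> ?B - {({},{})}" for p
  proof -
    obtain E E' where p: "p = (E,E')" by fastforce
    have EE: "E \<inter> E' = {}" "card E = card E'" "E \<noteq> {}" using that p by auto
    have "block d a ?T E E' R = 0" for R
    proof (rule ccontr)
      assume "block d a ?T E E' R \<noteq> 0"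
      then have "mset (listing E @ listing R) = mset (listing E' @ listing R)"
        unfolding block_def by (rule potential_diag_nonzero) (simp add: listing(3) EE)
      then have "set (listing E) = set (listing E')" by (metis add_right_cancel mset_append set_mset_mset)
      then show False using EE by (simp add: listing(2))
    qed
    then show ?thesis unfolding p by (simp add: energy_zero)
  qed
  have "tenergy d (diagm a) ?T = sum ?e ?B" by (rule tenergy_potential_blocks[OF sym])
  also have "\<dots> = sum ?e {({},{})}" by (rule sum.mono_neutral_right) (use z in auto)
  also have "\<dots> = energy d a UNIV 0 0 (block d a ?T {} {})" by simp
  also have "\<dots> = energy d a UNIV 0 0 (tree_potential UNIV d x)"
  proof (rule energy_cong)
    fix S :: "'n set"
    show "block d a ?T {} {} S = tree_potential UNIV d x S"
      using traced_minor_diag[OF listing(1)[of S], of x "d - card S"]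
      by (simp add: block_def potential_def tree_potential_def listing(2) Compl_eq_Diff_UNIV)
  qed
  also have "\<dots> = wronskian UNIV d a x" by (rule wronskian_energy[symmetric]) simp
  finally show ?thesis .
qed

text \<open>In an eigenbasis of the given \<open>X\<close>, both sides depend on the rotated
  \<open>A\<close> only through its diagonal and equal the Wronskian in that direction.\<close>

lemma wronskian_tenergy:
  fixes A X :: "real^'n^'n"
  assumes "A \<in> sym_mats" "X \<in> sym_mats"
  shows "dir_deriv A (Ppoly (Suc d)) X * Ppoly d X - Ppoly (Suc d) X * dir_deriv A (Ppoly d) X
    = tenergy d A (potential d X)"
proof -
  obtain V x where V: "orthogonal_matrix V" "X = V ** diagm x ** transpose V"
    using assms(2) symmetric_diagonalization[of X] by (auto simp: sym_mats_def)
  define B where "B = transpose V ** A ** V"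
  have A: "A = V ** B ** transpose V" unfolding B_def using conj_conj[OF V(1)] by simp
  have B: "transpose B = B"
    using assms(1) transpose_conj[of "transpose V" A] by (simp add: B_def sym_mats_def)
  show ?thesis
    unfolding A V(2) dir_deriv_Ppoly[OF V(1) B] Ppoly_conj_diag[OF V(1)] tenergy_conj[OF V(1)]
      tenergy_diag_potential[of d B x] tenergy_diag_diag wronskian_def ..
qed

section \<open>From the cone of matrices to the cone of eigenvalues\<close>

lemma esym_uminus: "esym N k (\<lambda>i. - y i) = (- 1) ^ k * esym N k y"
  unfolding esym_def sum_distrib_left
proof (intro sum.cong refl)
  fix S assume "S \<in> {S. S \<subseteq> N \<and> card S = k}"
  then show "(\<Prod>i\<in>S. - y i) = (- 1) ^ k * (\<Prod>i\<in>S. y i)"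
    using prod.distrib[of "\<lambda>_. - 1" y S] by simp
qed

lemma esym_cone_if_no_zero:
  assumes "finite N" "m \<le> card N" "\<And>s. s \<ge> 0 \<Longrightarrow> esym N m (\<lambda>i. a i + s) \<noteq> 0"
  shows "esym_cone N m a"
  unfolding esym_cone_def
proof (intro allI impI, rule ccontr)
  fix s :: real assume s: "s \<ge> 0" "\<not> esym N m (\<lambda>i. a i + s) > 0"
  obtain s1 where s1: "s1 \<ge> 0" "\<And>s. s > s1 \<Longrightarrow> esym N m (\<lambda>i. a i + s) > 0"
    using esym_shift_eventually_pos[OF assms(1,2), of a] by metis
  have "esym N m (\<lambda>i. a i + (s + s1 + 1)) > 0" using s s1 by auto
  then have "\<exists>r\<ge>s. r \<le> s + s1 + 1 \<and> esym N m (\<lambda>i. a i + r) = 0"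
    using s s1(1) by (intro IVT' esym_shift_continuous assms(1)) auto
  then obtain r where "s \<le> r" "esym N m (\<lambda>i. a i + r) = 0" by blast
  then show False using assms(3)[of r] s by auto
qed

text \<open>An interior point remains in the cone after subtracting a small multiple of the
  identity, which excludes a zero at \<open>s = 0\<close> as well; mere membership would allow one
  there.\<close>

lemma esym_cone_of_interior:
  fixes Q :: "real^'n^'n"
  assumes Q: "orthogonal_matrix Q" and m: "m \<le> CARD('n)"
    and "Q ** diagm a ** transpose Q \<in> (top_of_set sym_mats) interior_of (hyp_cone sym_mats (Ppoly m) (mat 1))"
  shows "esym_cone UNIV m a"
proof (rule esym_cone_if_no_zero)
  let ?A = "Q ** diagm a ** transpose Q"
  obtain U where U: "openin (top_of_set sym_mats) U" "?A \<in> U" "U \<subseteq> hyp_cone sym_mats (Ppoly m) (mat 1)"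
    using assms(3) unfolding interior_of_def by blast
  then obtain G where G: "open G" "U = sym_mats \<inter> G" unfolding openin_open by blast
  have A: "?A \<in> sym_mats" using U G by blast
  obtain r where r: "r > 0" "ball ?A r \<subseteq> G" using G U open_contains_ball by blast
  \<comment> \<open>The added \<open>1\<close> makes the shift strictly shorter than
    \<open>r\<close>.\<close>
  define c where "c = norm (mat 1 :: real^'n^'n) + 1"
  have c: "c > 0" unfolding c_def by (simp add: add_nonneg_pos)
  define \<epsilon> where "\<epsilon> = r / c"
  have \<epsilon>: "\<epsilon> > 0" using r c by (simp add: \<epsilon>_def)
  have "norm (\<epsilon> *\<^sub>R (mat 1 :: real^'n^'n)) < \<epsilon> * c"
    using \<epsilon> by (simp add: c_def)
  then have "?A - \<epsilon> *\<^sub>R mat 1 \<in> ball ?A r" using c by (simp add: dist_norm \<epsilon>_def)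
  moreover have "?A - \<epsilon> *\<^sub>R mat 1 \<in> sym_mats"
    using A by (auto simp: sym_mats_def transpose_def vec_eq_iff mat_def)
  ultimately have h: "?A - \<epsilon> *\<^sub>R mat 1 \<in> hyp_cone sym_mats (Ppoly m) (mat 1)" using r G U by blast
  fix s :: real assume s: "s \<ge> 0"
  show "esym UNIV m (\<lambda>i. a i + s) \<noteq> 0"
  proof
    assume z: "esym UNIV m (\<lambda>i. a i + s) = 0"
    \<comment> \<open>A zero at \<open>s\<close> on the ray is a zero at this negative number for
      the shifted matrix.\<close>
    let ?t = "- s - \<epsilon>"
    have "?t *\<^sub>R mat 1 - (?A - \<epsilon> *\<^sub>R mat 1) = mat (- s) - ?A"
      unfolding mat_eq_scaleR[of "- s"] by (simp add: algebra_simps)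
    also have "\<dots> = Q ** (mat (- s) - diagm a) ** transpose Q"
      by (simp add: conj_diff conj_mat[OF Q])
    also have "mat (- s) - diagm a = diagm (\<lambda>i. - (a i + s))"
      by (simp add: vec_eq_iff mat_def)
    finally have "Ppoly m (?t *\<^sub>R mat 1 - (?A - \<epsilon> *\<^sub>R mat 1)) = esym UNIV m (\<lambda>i. - (a i + s))"
      by (simp add: Ppoly_conj_diag[OF Q])
    also have "\<dots> = 0" unfolding esym_uminus z by simp
    finally have "0 \<le> ?t" using h unfolding hyp_cone_def by blast
    then show False using s \<epsilon> by simp
  qed
qed (use m in simp_all)

theorem theorem6p2:
  fixes d :: nat and A :: "real^'n^'n"
  assumes "d \<le> CARD('n) - 1"
    and "A \<in> (top_of_set sym_mats) interior_of (hyp_cone sym_mats (Ppoly (d + 1)) (mat 1))"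
  shows "Ppoly (d + 1) A > 0 \<and> Ppoly d A > 0 \<and>
    sum_of_squares_on sym_mats
      (\<lambda>X. dir_deriv A (Ppoly (d + 1)) X * Ppoly d X - Ppoly (d + 1) X * dir_deriv A (Ppoly d) X
           - Ppoly (d + 1) A / Ppoly d A * (Ppoly d X)\<^sup>2)"
proof -
  have "A \<in> hyp_cone sym_mats (Ppoly (d + 1)) (mat 1)"
    by (rule subsetD[OF interior_of_subset assms(2)])
  then have A: "A \<in> sym_mats" by (simp add: hyp_cone_def)
  then obtain Q a where Q: "orthogonal_matrix Q" and AQ: "A = Q ** diagm a ** transpose Q"
    using symmetric_diagonalization[of A] by (auto simp: sym_mats_def)
  have "Suc d \<le> CARD('n)" using assms(1) zero_less_card_finite[where 'a = 'n] by linarith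
  then have cone: "esym_cone UNIV (Suc d) a"
    using assms(2)[unfolded AQ] by (intro esym_cone_of_interior[OF Q]) simp_all
  then have cone': "esym_cone UNIV d a" using esym_cone_pred[of UNIV d a] by simp
  have P: "Ppoly (d + 1) A = esym UNIV (Suc d) a" "Ppoly d A = esym UNIV d a"
    unfolding AQ by (simp_all add: Ppoly_conj_diag[OF Q])
  \<comment> \<open>\<open>Y X\<close> is \<open>X\<close> in the eigenbasis of \<open>A\<close>.
    Its entries are linear in those of \<open>X\<close>, so polynomials in \<open>Y X\<close> are
    polynomials in \<open>X\<close>.\<close>
  define Y where "Y X = transpose Q ** X ** Q" for X
  have YX: "X = Q ** Y X ** transpose Q" for X unfolding Y_def using conj_conj[OF Q] by simp
  have Ysym: "transpose (Y X) = Y X" if "X \<in> sym_mats" for X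
    using that transpose_conj[of "transpose Q" X] by (simp add: Y_def sym_mats_def)
  have Ypoly: "real_polynomial_function (\<lambda>X. Y X $ i $ j)" for i j
  proof -
    have "bounded_linear (\<lambda>X :: real^'n^'n. X $ p $ q)" for p q
      by (intro bounded_linear_compose[OF bounded_linear_vec_nth bounded_linear_vec_nth])
    then show ?thesis
      using conj_entry[of "transpose Q" _ i j] unfolding Y_def
      by (simp only: transpose_transpose)
        (intro real_polynomial_function_sum real_polynomial_function.intros, simp_all)
  qed
  let ?B = "{(E,E'). E \<inter> E' = {} \<and> card E = card (E' :: 'n set)}"
  define w where "w E E' S X = block d a (potential d (Y X)) E E' S" for E E' S :: "'n set" and X
  have wpoly: "real_polynomial_function (w E E' S)" for E E' S
  proof (cases "card S + card E \<le> d")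
    case True
    then show ?thesis
      unfolding w_def block_def potential_def using traced_minor_polynomial[OF Ypoly] by simp
  next
    case False
    then show ?thesis unfolding w_def block_def potential_def by (simp add: real_polynomial_function.intros)
  qed
  have w0: "w E E' S X = 0" if "card S + card E > d" for E E' S X
    using that by (simp add: w_def block_def potential_def)
  let ?e = "\<lambda>p X. energy d a (- (fst p \<union> snd p)) (card (fst p)) ((sum a (fst p) + sum a (snd p)) / 2) (\<lambda>S. w (fst p) (snd p) S X)"
  define c where "c = Ppoly (d + 1) A / Ppoly d A"
  have c: "c = esym UNIV (Suc d) a / esym UNIV d a" unfolding c_def P ..
  \<comment> \<open>Only the block of empty sets gives up a square, since its root potential is
    \<open>Ppoly d X\<close>; the other blocks are sums of squares as they stand.\<close>
  have "sum_of_squares_on sym_mats (\<lambda>X. ?e ({},{}) X - c * (w {} {} {} X)\<^sup>2)"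
    using energy_sos[of UNIV d a "w {} {}" sym_mats] cone' wpoly w0[of _ "{}"] by (simp add: c)
  moreover have "sum_of_squares_on sym_mats (\<lambda>X. \<Sum>p\<in>?B - {({},{})}. ?e p X)"
  proof (rule sos_sum)
    fix p assume "p \<in> ?B - {({},{})}"
    then have "fst p \<inter> snd p = {}" "card (fst p) = card (snd p)" by auto
    then have "sum_of_squares_on sym_mats (\<lambda>X. energy d a (UNIV - (fst p \<union> snd p)) (card (fst p))
       ((sum a (fst p) + sum a (snd p)) / 2) (\<lambda>S. w (fst p) (snd p) S X))"
      by (intro energy_pairs_sos cone wpoly w0) auto
    then show "sum_of_squares_on sym_mats (?e p)" by (simp add: Compl_eq_Diff_UNIV)
  qed
  ultimately have "sum_of_squares_on sym_mats (\<lambda>X. ?e ({},{}) X - c * (w {} {} {} X)\<^sup>2 + (\<Sum>p\<in>?B - {({},{})}. ?e p X))"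
    by (rule sos_add)
  moreover have "dir_deriv A (Ppoly (d + 1)) X * Ppoly d X - Ppoly (d + 1) X * dir_deriv A (Ppoly d) X - c * (Ppoly d X)\<^sup>2
     = ?e ({},{}) X - c * (w {} {} {} X)\<^sup>2 + (\<Sum>p\<in>?B - {({},{})}. ?e p X)" if X: "X \<in> sym_mats" for X
  proof -
    have "dir_deriv A (Ppoly (d + 1)) X * Ppoly d X - Ppoly (d + 1) X * dir_deriv A (Ppoly d) X
       = tenergy d A (potential d X)"
      using wronskian_tenergy[OF A X] by simp
    also have "\<dots> = tenergy d (diagm a) (potential d (Y X))"
      using tenergy_conj[OF Q, of d "diagm a" "Y X"] unfolding AQ[symmetric] YX[of X, symmetric] .
    also have "\<dots> = (\<Sum>p\<in>?B. ?e p X)"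
      unfolding tenergy_potential_blocks[OF Ysym[OF X]] w_def by (simp add: case_prod_unfold)
    also have "\<dots> = ?e ({},{}) X + (\<Sum>p\<in>?B - {({},{})}. ?e p X)"
      by (rule sum.remove) auto
    finally have 1: "dir_deriv A (Ppoly (d + 1)) X * Ppoly d X - Ppoly (d + 1) X * dir_deriv A (Ppoly d) X
       = ?e ({},{}) X + (\<Sum>p\<in>?B - {({},{})}. ?e p X)" .
    have "w {} {} {} X = traced_minor (Y X) d [] []" by (simp add: w_def block_def potential_def)
    also have "\<dots> = Ppoly d X"
      using traced_minor_Nil_conj[OF Q, of "Y X" d] Ppoly_eq_traced_minor[OF X, of d] by (simp flip: YX)
    finally show ?thesis unfolding 1 by simp
  qed
  ultimately have "sum_of_squares_on sym_mats (\<lambda>X. dir_deriv A (Ppoly (d + 1)) X * Ppoly d X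
     - Ppoly (d + 1) X * dir_deriv A (Ppoly d) X - c * (Ppoly d X)\<^sup>2)"
    by (rule sos_cong[rotated])
  then show ?thesis
    using esym_cone_pos[OF cone] esym_cone_pos[OF cone'] unfolding P by (simp add: c)
qed

end
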